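(* Let $t_T:=\sup\{t\ge 0:\ \operatorname{ess\,sup}_{v\in\mathbb{X}}\mathbb{E}_t|C^v|<\infty\}$. For every $t\ge 0$ with $t<t_T$ there exists $\delta_1=\delta_1(t)>0$ such that $$\operatorname*{ess\,sup}_{v\in\mathbb{X}}\ \mathbb{E}_t\, e^{\delta_1|C^v|}<\infty .$$
   Context: $(\mathbb{X},d)$ is a complete separable metric space with its Borel $\sigma$-field, and $\lambda$ is a locally finite (finite on bounded sets), diffuse measure on $\mathbb{X}$. The connection function $\varphi:\mathbb{X}^2\to[0,1]$ is measurable and symmetric with $\int\varphi(x,y)\,\lambda(dy)<\infty$ for $\lambda$-a.e. $x$. For a simple point process $\chi$ on $\mathbb{X}$, the random connection model (RCM) based on $\chi$ is the random graph whose vertices are the points of $\chi$ and in which (given $\chi$) each pair of distinct points $x,y$ is joined by an edge with probability $\varphi(x,y)$, independently for different pairs. For $t\ge0$, $\mathbb{E}_t$ denotes expectation when $\eta$ is a Poisson process on $\mathbb{X}$ with intensity measure $t\lambda$. For $v\in\mathbb{X}$, $\xi^v$ is the RCM based on $\eta+\delta_v$, $C^v$ is the connected component (cluster) of $v$ in $\xi^v$, and $|C^v|$ is its number of vertices. All essential suprema over $\mathbb{X}$ are with respect to $\lambda$. *)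

theory Defs
  imports "HOL-Probability.Probability"
begin

definition num_points :: "'a set \<Rightarrow> ennreal" where
  "num_points C = emeasure (count_space UNIV) C"

text \<open>
  A locally finite simple counting measure is identified with its support, a set having finitely
  many points in every bounded set. The sigma-field is the usual one, generated by the counting
  maps of Borel sets. A simple point process is a random element of this space.
\<close>

definition locally_finite_set :: "'a::metric_space set \<Rightarrow> bool" where
  "locally_finite_set C \<longleftrightarrow> (\<forall>B. bounded B \<longrightarrow> finite (C \<inter> B))"

definition configurations :: "'a::metric_space set measure" where
  "configurations =
     sigma {C. locally_finite_set C}
       {{C. locally_finite_set C \<and> num_points (C \<inter> B) \<in> S} | B S.
          B \<in> sets borel \<and> S \<in> sets borel}"

definition simple_point_process :: "'w measure \<Rightarrow> ('w \<Rightarrow> 'a::metric_space set) \<Rightarrow> bool" where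
  "simple_point_process M X \<longleftrightarrow> X \<in> M \<rightarrow>\<^sub>M configurations"

text \<open>
  Only diffuse, locally finite intensity measures are of interest here; a Poisson process is then
  almost surely simple and can be represented as a random set. The Poisson distribution is spelled
  out because \<^const>\<open>poisson_pmf\<close> is specified for positive parameters only; here the
  parameter may be \<open>0\<close> (point mass at \<open>0\<close>) or \<open>\<infinity>\<close> (point mass at \<open>\<infinity>\<close>).
\<close>

definition poisson_process ::
    "'w measure \<Rightarrow> 'a::metric_space measure \<Rightarrow> ('w \<Rightarrow> 'a set) \<Rightarrow> bool" where
  "poisson_process M \<mu> \<eta> \<longleftrightarrow>
     simple_point_process M \<eta> \<and>
     (\<forall>B\<in>sets borel. emeasure \<mu> B < \<infinity> \<longrightarrow>
        (\<forall>k::nat. measure M {\<omega> \<in> space M. num_points (\<eta> \<omega> \<inter> B) = of_nat k}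
           = measure \<mu> B ^ k / fact k * exp (- measure \<mu> B))) \<and>
     (\<forall>B\<in>sets borel. emeasure \<mu> B = \<infinity> \<longrightarrow>
        (AE \<omega> in M. num_points (\<eta> \<omega> \<inter> B) = \<infinity>)) \<and>
     (\<forall>(I::nat set) B. finite I \<and> (\<forall>i\<in>I. B i \<in> sets borel) \<and> disjoint_family_on B I \<longrightarrow>
        prob_space.indep_vars M (\<lambda>_. borel) (\<lambda>i \<omega>. num_points (\<eta> \<omega> \<inter> B i)) I)"

text \<open>
  \<open>\<pi>\<close> lists the points of a configuration without repetition, measurably in the configuration;
  for a finite configuration with \<open>n\<close> points, \<open>\<pi> i C\<close> is irrelevant for \<open>i \<ge> n\<close>.
\<close>

definition measurable_enumeration :: "(nat \<Rightarrow> 'a::metric_space set \<Rightarrow> 'a) \<Rightarrow> bool" where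
  "measurable_enumeration \<pi> \<longleftrightarrow>
     (\<forall>i. \<pi> i \<in> configurations \<rightarrow>\<^sub>M borel) \<and>
     (\<forall>C\<in>space configurations. bij_betw (\<lambda>i. \<pi> i C) {i. of_nat i < num_points C} C)"

text \<open>
  The random graph has vertex set \<open>X \<omega>\<close> and edge set \<open>\<xi> \<omega>\<close>, a set of two-element subsets of
  \<open>X \<omega>\<close>. The last clause says that, conditionally on \<open>X\<close>, the events that the
  \<open>i\<close>-th and the \<open>j\<close>-th point of \<open>X\<close> (\<open>i < j\<close>) are joined are independent with the
  probabilities given by \<open>\<phi>\<close>. The joint conditional law of the edges does not depend on the
  enumeration.
\<close>

definition random_connection_model ::
    "'w measure \<Rightarrow> ('a::metric_space \<Rightarrow> 'a \<Rightarrow> real) \<Rightarrow> ('w \<Rightarrow> 'a set) \<Rightarrow> ('w \<Rightarrow> 'a set set) \<Rightarrow> bool" where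
  "random_connection_model M \<phi> X \<xi> \<longleftrightarrow>
     simple_point_process M X \<and>
     (\<forall>\<omega>\<in>space M. \<xi> \<omega> \<subseteq> {{x, y} | x y. x \<in> X \<omega> \<and> y \<in> X \<omega> \<and> x \<noteq> y}) \<and>
     (\<exists>\<pi>. measurable_enumeration \<pi> \<and>
       (let joined = (\<lambda>(i, j). {\<omega> \<in> space M.
              of_nat j < num_points (X \<omega>) \<and> {\<pi> i (X \<omega>), \<pi> j (X \<omega>)} \<in> \<xi> \<omega>});
            p = (\<lambda>(i, j) \<omega>.
              if of_nat j < num_points (X \<omega>) then \<phi> (\<pi> i (X \<omega>)) (\<pi> j (X \<omega>)) else 0)
        in (\<forall>i j. i < j \<longrightarrow> joined (i, j) \<in> sets M) \<and>
           (\<forall>F. finite F \<and> F \<subseteq> {(i, j). i < j} \<longrightarrow>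
              (AE \<omega> in M.
                 real_cond_exp M (vimage_algebra (space M) X configurations)
                   (indicator (space M \<inter> (\<Inter>e\<in>F. joined e))) \<omega>
                 = (\<Prod>e\<in>F. p e \<omega>)))))"

definition cluster :: "'a set set \<Rightarrow> 'a \<Rightarrow> 'a set" where
  "cluster E v = {y. (v, y) \<in> {(x, y). {x, y} \<in> E}\<^sup>*}"

text \<open>\<open>exp (\<delta> * |C|)\<close>, with value \<open>\<infinity>\<close> for infinite \<open>C\<close> (only used with \<open>\<delta> > 0\<close>).\<close>

definition exp_size :: "real \<Rightarrow> 'a set \<Rightarrow> ennreal" where
  "exp_size \<delta> C = (if finite C then ennreal (exp (\<delta> * real (card C))) else \<infinity>)"

text \<open>
  \<open>P t\<close> is the probability measure behind the expectation at intensity \<open>t\<close>, and \<open>\<xi> t v\<close> is the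
  edge set of the random connection model with the point \<open>v\<close> added. The functions of \<open>v\<close> below
  are measurable, so that the convention of \<^const>\<open>esssup\<close> for non-measurable functions plays
  no role.
\<close>

definition t_T ::
    "'a measure \<Rightarrow> (real \<Rightarrow> 'w measure) \<Rightarrow> (real \<Rightarrow> 'a \<Rightarrow> 'w \<Rightarrow> 'a set set) \<Rightarrow> ereal" where
  "t_T \<Lambda> P \<xi> =
     Sup (ereal ` {t. 0 \<le> t \<and>
       esssup \<Lambda> (\<lambda>v. \<integral>\<^sup>+\<omega>. num_points (cluster (\<xi> t v \<omega>) v) \<partial>P t) < \<infinity>})"

end

theory Submission
  imports Defs
begin

text \<open>Explore the cluster of a finite set of roots one root at a time. Exposing all edges at a root
  \<open>v\<close> splits the Poisson process of intensity \<open>f\<close> into two independent ones: the neighbours of \<open>v\<close>,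
  of intensity \<open>\<phi>(v, \<cdot>) f\<close>, which become new roots, and the undiscovered points, of intensity
  \<open>(1 - \<phi>(v, \<cdot>)) f\<close>. The conditional mean of the total cluster size is a martingale along this
  exploration. If the mean cluster size of a single root is bounded by \<open>K\<close>, then an increment of this
  martingale is at most \<open>K\<close> times a Poisson variable of mean at most \<open>K\<close>, up to centring, so it has
  uniformly bounded exponential moments. Hence the exponential moment of the cluster size is at most
  \<open>exp (\<epsilon> W)\<close>, where \<open>W\<close> is its mean and \<open>\<epsilon>\<close> is small. All this takes place in bounded windows,
  where the Poisson process is an explicit mixture of product measures; the bounds do not
  depend on the window, and the cluster is the increasing union of the clusters in the windows.
  Finally, the process of intensity \<open>t \<Lambda>\<close> with \<open>t < s\<close> is a thinning of the one of intensity \<open>s \<Lambda>\<close>.\<close>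

section \<open>Bernoulli sums\<close>

text \<open>No process or filtration appears: \<open>explore\<close> is a recursion on a cap
  \<open>n\<close>, and a step of the martingale becomes a step of an induction on \<open>n\<close>.
  This induction closes because of its generality. After one root the intensity has changed and the
  roots form a new list, so the claim is made for every thinning \<open>b\<close> of a fixed
  intensity \<open>f0\<close> and every list of distinct good roots. The constant \<open>K\<close>
  survives because means only decrease under thinning. This monotonicity is hidden in the recursion,
  which follows the order of the roots; it becomes visible once \<open>explore\<close> is identified
  with a mean over a finite graph with independent edges. The gain is a comparison of orders in
  \<open>\<epsilon>\<close>: counting a root lowers the mean of the remaining size by 1, worth a
  factor \<open>exp \<epsilon>\<close>, whereas the fluctuation of that mean costs only
  \<open>exp (\<epsilon>^2 * C)\<close>. The difference of the exponents is \<open>\<delta>\<close>.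
  Lists replace point sets so that thinning and measurability reduce to iterated integrals;
  diffuseness makes almost every list free of repetitions.\<close>

lemma ennreal_convex_combination: "(p::ennreal) * c + (1 - p) * c = c" if "p \<le> 1"
  using that by (metis add.commute diff_add_cancel_ennreal distrib_right mult_1)

text \<open>The mean of \<open>f\<close> at a random subset of \<open>A\<close> that keeps each
  \<open>e\<close> independently with probability \<open>p e\<close>. As a finite sum it involves
  neither a probability space nor measurability of \<open>f\<close>.\<close>

definition bernoulli_sum :: "('e \<Rightarrow> ennreal) \<Rightarrow> 'e set \<Rightarrow> ('e set \<Rightarrow> ennreal) \<Rightarrow> ennreal" where
  "bernoulli_sum p A f = (\<Sum>S\<in>Pow A. (\<Prod>e\<in>S. p e) * (\<Prod>e\<in>A - S. 1 - p e) * f S)"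

lemma bernoulli_sum_empty [simp]: "bernoulli_sum p {} f = f {}"
  by (simp add: bernoulli_sum_def)

lemma bernoulli_sum_cong:
  assumes "A = B" and "\<And>e. e \<in> B \<Longrightarrow> p e = q e" and "\<And>S. S \<subseteq> B \<Longrightarrow> f S = g S"
  shows "bernoulli_sum p A f = bernoulli_sum q B g"
  unfolding bernoulli_sum_def using assms
  by (auto intro!: sum.cong arg_cong2[where f = "(*)"] prod.cong)

lemma bernoulli_sum_mono:
  assumes "\<And>S. S \<subseteq> A \<Longrightarrow> f S \<le> g S"
  shows "bernoulli_sum p A f \<le> bernoulli_sum p A g"
  unfolding bernoulli_sum_def by (intro sum_mono mult_left_mono assms) auto

text \<open>Conditioning on the coin of \<open>e\<close>: the subsets of \<open>insert e A\<close>
  are sorted by whether they contain \<open>e\<close>. The rules below rest on this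
  recursion.\<close>

lemma bernoulli_sum_insert:
  assumes "finite A" "e \<notin> A"
  shows "bernoulli_sum p (insert e A) f =
    p e * bernoulli_sum p A (\<lambda>S. f (insert e S)) + (1 - p e) * bernoulli_sum p A f"
proof -
  let ?w = "\<lambda>B S. (\<Prod>e\<in>S. p e) * (\<Prod>e\<in>B - S. 1 - p e)"
  have inj: "inj_on (insert e) (Pow A)" using assms(2) by (auto simp: inj_on_def)
  have fin: "finite S" if "S \<subseteq> A" for S using that assms(1) finite_subset by blast
  have "bernoulli_sum p (insert e A) f =
      (\<Sum>S\<in>Pow A. ?w (insert e A) S * f S) + (\<Sum>S\<in>insert e ` Pow A. ?w (insert e A) S * f S)"
    unfolding bernoulli_sum_def Pow_insert
    by (rule sum.union_disjoint) (use assms in auto)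
  also have "(\<Sum>S\<in>insert e ` Pow A. ?w (insert e A) S * f S)
      = (\<Sum>S\<in>Pow A. ?w (insert e A) (insert e S) * f (insert e S))"
    using inj by (subst sum.reindex) auto
  also have "\<dots> = (\<Sum>S\<in>Pow A. p e * (?w A S * f (insert e S)))"
  proof (rule sum.cong[OF refl])
    fix S assume S: "S \<in> Pow A"
    then have "insert e A - insert e S = A - S" "e \<notin> S" using assms by auto
    then show "?w (insert e A) (insert e S) * f (insert e S) = p e * (?w A S * f (insert e S))"
      using fin[of S] S by (simp add: mult.assoc)
  qed
  also have "(\<Sum>S\<in>Pow A. ?w (insert e A) S * f S) = (\<Sum>S\<in>Pow A. (1 - p e) * (?w A S * f S))"
  proof (rule sum.cong[OF refl])
    fix S assume S: "S \<in> Pow A"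
    then have "insert e A - S = insert e (A - S)" "e \<notin> A - S" using assms by auto
    then show "?w (insert e A) S * f S = (1 - p e) * (?w A S * f S)"
      using assms by (simp add: mult.assoc mult.left_commute)
  qed
  finally show ?thesis
    by (simp add: bernoulli_sum_def sum_distrib_left add.commute)
qed

lemma bernoulli_sum_const:
  assumes "finite A" "\<And>e. e \<in> A \<Longrightarrow> p e \<le> 1"
  shows "bernoulli_sum p A (\<lambda>_. c) = c"
  using assms
proof (induction A)
  case (insert e A)
  then have "p e * c + (1 - p e) * c = c" by (intro ennreal_convex_combination) simp
  then show ?case using insert by (simp add: bernoulli_sum_insert)
qed simp

lemma bernoulli_sum_union:
  assumes "finite A" "finite B" "A \<inter> B = {}"
  shows "bernoulli_sum p (A \<union> B) f = bernoulli_sum p A (\<lambda>S. bernoulli_sum p B (\<lambda>T. f (S \<union> T)))"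
  using assms
proof (induction A arbitrary: f)
  case (insert e A)
  then show ?case by (simp add: bernoulli_sum_insert)
qed simp

text \<open>The coins outside \<open>A\<close> integrate to 1. This couples a random graph with its
  restriction to fewer vertices.\<close>

lemma bernoulli_sum_superset:
  assumes "finite B" "A \<subseteq> B" "\<And>e. e \<in> B \<Longrightarrow> p e \<le> 1"
  shows "bernoulli_sum p B (\<lambda>S. f (S \<inter> A)) = bernoulli_sum p A f"
proof -
  have "bernoulli_sum p (A \<union> (B - A)) (\<lambda>S. f (S \<inter> A))
      = bernoulli_sum p A (\<lambda>S. bernoulli_sum p (B - A) (\<lambda>T. f ((S \<union> T) \<inter> A)))"
    by (rule bernoulli_sum_union) (use assms finite_subset in auto)
  also have "\<dots> = bernoulli_sum p A (\<lambda>S. bernoulli_sum p (B - A) (\<lambda>T. f S))"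
    by (intro bernoulli_sum_cong refl arg_cong[where f = f]) auto
  also have "\<dots> = bernoulli_sum p A f"
    by (intro bernoulli_sum_cong refl bernoulli_sum_const) (use assms in auto)
  finally show ?thesis using assms(2) by (simp add: Un_absorb1)
qed

lemma bernoulli_sum_image:
  assumes "finite A" "inj_on h A"
  shows "bernoulli_sum p (h ` A) f = bernoulli_sum (p \<circ> h) A (\<lambda>S. f (h ` S))"
  using assms
proof (induction A arbitrary: f)
  case (insert e A)
  then have "h e \<notin> h ` A" by auto
  then show ?case using insert by (simp add: bernoulli_sum_insert)
qed simp

text \<open>The list form of \<open>bernoulli_sum\<close>: each point is sent to the first list with
  probability \<open>p x\<close> and to the second otherwise, in the original order. The recursion
  on the head matches that of the iterated integrals.\<close>

fun split_sum :: "('a \<Rightarrow> ennreal) \<Rightarrow> ('a list \<Rightarrow> 'a list \<Rightarrow> ennreal) \<Rightarrow> 'a list \<Rightarrow> ennreal" where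
  "split_sum p G [] = G [] []"
| "split_sum p G (x # xs) =
     p x * split_sum p (\<lambda>y z. G (x # y) z) xs + (1 - p x) * split_sum p (\<lambda>y z. G y (x # z)) xs"

text \<open>The outcomes are complementary sublists of \<open>xs\<close>. Recording only their
  multisets is enough, because the later uses need just membership and distinctness.\<close>

lemma split_sum_mono:
  assumes "\<And>y z. mset y + mset z = mset xs \<Longrightarrow> G y z \<le> G' y z"
  shows "split_sum p G xs \<le> split_sum p G' xs"
  using assms
proof (induction xs arbitrary: G G')
  case (Cons x xs)
  show ?case
    by (auto intro!: add_mono mult_left_mono Cons.IH Cons.prems)
qed auto

lemma split_sum_cong:
  assumes "\<And>y z. mset y + mset z = mset xs \<Longrightarrow> G y z = G' y z"
  shows "split_sum p G xs = split_sum p G' xs"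
  by (intro antisym split_sum_mono) (simp_all add: assms)

lemma split_sum_const:
  assumes "\<And>x. p x \<le> 1"
  shows "split_sum p (\<lambda>_ _. c) xs = c"
proof (induction xs)
  case (Cons x xs)
  then show ?case using assms by (simp add: ennreal_convex_combination)
qed simp

lemma split_sum_add:
  "split_sum p (\<lambda>y z. G y z + H y z) xs = split_sum p G xs + split_sum p H xs"
  by (induction xs arbitrary: G H) (simp_all add: algebra_simps)

lemma split_sum_cmult:
  "split_sum p (\<lambda>y z. c * G y z) xs = c * split_sum p G xs"
  by (induction xs arbitrary: G) (simp_all add: algebra_simps)

text \<open>The bridge from lists to sets: on a repetition-free list, the second part is the
  complement of the first.\<close>

lemma split_sum_set:
  assumes "distinct xs"
  shows "split_sum p (\<lambda>y z. G (set y) (set z)) xs = bernoulli_sum p (set xs) (\<lambda>S. G S (set xs - S))"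
  using assms
proof (induction xs arbitrary: G)
  case (Cons x xs)
  have "split_sum p (\<lambda>y z. G (set (x # y)) (set z)) xs
      = bernoulli_sum p (set xs) (\<lambda>S. G (insert x S) (set xs - S))"
    using Cons.IH[of "\<lambda>S T. G (insert x S) T"] Cons.prems by simp
  moreover have "split_sum p (\<lambda>y z. G (set y) (set (x # z))) xs
      = bernoulli_sum p (set xs) (\<lambda>S. G S (insert x (set xs - S)))"
    using Cons.IH[of "\<lambda>S T. G S (insert x T)"] Cons.prems by simp
  moreover have "bernoulli_sum p (set xs) (\<lambda>S. G (insert x S) (insert x (set xs) - insert x S))
      = bernoulli_sum p (set xs) (\<lambda>S. G (insert x S) (set xs - S))"
    using Cons.prems by (intro bernoulli_sum_cong refl) (auto intro!: arg_cong2[where f = G])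
  moreover have "bernoulli_sum p (set xs) (\<lambda>S. G S (insert x (set xs) - S))
      = bernoulli_sum p (set xs) (\<lambda>S. G S (insert x (set xs - S)))"
    using Cons.prems by (intro bernoulli_sum_cong refl) (auto intro!: arg_cong2[where f = G])
  ultimately show ?case using Cons.prems by (simp add: bernoulli_sum_insert)
qed simp

section \<open>Finite random graphs and their exploration\<close>

definition vertex_pairs :: "'a set \<Rightarrow> 'a set set" where
  "vertex_pairs V = {e. e \<subseteq> V \<and> card e = 2}"

lemma doubleton_mem_vertex_pairs: "{x, y} \<in> vertex_pairs V \<longleftrightarrow> x \<in> V \<and> y \<in> V \<and> x \<noteq> y"
  by (auto simp: vertex_pairs_def card_insert_if)

lemma vertex_pairs_mono: "V \<subseteq> W \<Longrightarrow> vertex_pairs V \<subseteq> vertex_pairs W"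
  by (auto simp: vertex_pairs_def)

lemma finite_vertex_pairs: "finite V \<Longrightarrow> finite (vertex_pairs V)"
  by (rule finite_subset[of _ "Pow V"]) (auto simp: vertex_pairs_def)

lemma vertex_pairs_insert:
  assumes "v \<notin> U"
  shows "vertex_pairs (insert v U) = (\<lambda>x. {v, x}) ` U \<union> vertex_pairs U"
proof (intro equalityI subsetI)
  fix e assume "e \<in> vertex_pairs (insert v U)"
  then obtain x y where e: "e = {x, y}" "x \<noteq> y" "x \<in> insert v U" "y \<in> insert v U"
    by (auto simp: vertex_pairs_def card_2_iff)
  show "e \<in> (\<lambda>x. {v, x}) ` U \<union> vertex_pairs U"
  proof (cases "x = v \<or> y = v")
    case True
    then show ?thesis using e by auto
  next
    case False
    then show ?thesis using e by (simp add: doubleton_mem_vertex_pairs)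
  qed
next
  fix e assume "e \<in> (\<lambda>x. {v, x}) ` U \<union> vertex_pairs U"
  then show "e \<in> vertex_pairs (insert v U)"
    using assms vertex_pairs_mono[of U "insert v U"] by (auto simp: doubleton_mem_vertex_pairs)
qed

section \<open>Vertices reachable from a set of roots\<close>

definition reach :: "'a set set \<Rightarrow> 'a set \<Rightarrow> 'a set" where
  "reach E A = (\<Union>x\<in>A. cluster E x)"

lemma reach_base: "x \<in> A \<Longrightarrow> x \<in> reach E A"
  by (auto simp: reach_def cluster_def)

lemma reach_empty [simp]: "reach E {} = {}"
  by (simp add: reach_def)

lemma reach_singleton [simp]: "reach E {v} = cluster E v"
  by (simp add: reach_def)

lemma reach_step: "x \<in> reach E A \<Longrightarrow> {x, y} \<in> E \<Longrightarrow> y \<in> reach E A"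
  by (auto simp: reach_def cluster_def intro: rtrancl_into_rtrancl)

lemma reach_induct [consumes 1, case_names base step]:
  assumes "y \<in> reach E A"
    and "\<And>x. x \<in> A \<Longrightarrow> P x"
    and "\<And>x y. x \<in> reach E A \<Longrightarrow> P x \<Longrightarrow> {x, y} \<in> E \<Longrightarrow> P y"
  shows "P y"
proof -
  obtain x where x: "x \<in> A" "(x, y) \<in> {(x, y). {x, y} \<in> E}\<^sup>*"
    using assms(1) by (auto simp: reach_def cluster_def)
  from x(2) have "y \<in> reach E A \<and> P y"
  proof induction
    case base
    then show ?case using assms(2) x(1) reach_base by auto
  next
    case (step y z)
    then have yz: "{y, z} \<in> E" by simp
    show ?case
      using step.IH assms(3)[of y z, OF _ _ yz] reach_step[of y, OF _ yz] by simp
  qed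
  then show ?thesis by simp
qed

lemma reach_mono:
  assumes "A \<subseteq> B" "E \<subseteq> F"
  shows "reach E A \<subseteq> reach F B"
proof
  fix y assume "y \<in> reach E A"
  then show "y \<in> reach F B"
  proof (induction rule: reach_induct)
    case (base x)
    then show ?case using assms(1) by (blast intro: reach_base)
  next
    case (step x y)
    show ?case using step.IH by (rule reach_step) (use step.hyps assms(2) in blast)
  qed
qed

lemma reach_subset:
  assumes "E \<subseteq> vertex_pairs U" "A \<subseteq> U"
  shows "reach E A \<subseteq> U"
proof
  fix y assume "y \<in> reach E A"
  then show "y \<in> U"
  proof (induction rule: reach_induct)
    case (step x y)
    then have "{x, y} \<in> vertex_pairs U" using assms(1) by blast
    then show ?case by (simp add: doubleton_mem_vertex_pairs)
  qed (use assms(2) in blast)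
qed

text \<open>The graph side of one exploration step. Every path through \<open>v\<close> can be
  restarted at its next vertex, which lies in \<open>S\<close>, so \<open>v\<close> may be deleted
  once its neighbours have become roots. \<open>S\<close> may meet \<open>A\<close>: edges from
  \<open>v\<close> to other roots change nothing.\<close>

lemma reach_star:
  assumes "E \<subseteq> vertex_pairs U" "v \<notin> U" "A \<subseteq> U" "S \<subseteq> U"
  shows "reach ((\<lambda>x. {v, x}) ` S \<union> E) (insert v A) = insert v (reach E (A \<union> S))"
proof (intro equalityI subsetI)
  fix y assume "y \<in> reach ((\<lambda>x. {v, x}) ` S \<union> E) (insert v A)"
  then show "y \<in> insert v (reach E (A \<union> S))"
  proof (induction rule: reach_induct)
    case (base x)
    then show ?case by (auto intro: reach_base)
  next
    case (step x y)
    show ?case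
    proof (cases "{x, y} \<in> E")
      case True
      then have "{x, y} \<in> vertex_pairs U" using assms(1) by blast
      then have "x \<noteq> v" using assms(2) by (auto simp: doubleton_mem_vertex_pairs)
      then have "x \<in> reach E (A \<union> S)" using step.IH by simp
      then show ?thesis using reach_step[OF _ True] by simp
    next
      case False
      then show ?thesis using step.hyps by (auto simp: doubleton_eq_iff intro: reach_base)
    qed
  qed
next
  fix y assume y: "y \<in> insert v (reach E (A \<union> S))"
  let ?R = "reach ((\<lambda>x. {v, x}) ` S \<union> E) (insert v A)"
  have v: "v \<in> ?R" by (rule reach_base) simp
  show "y \<in> ?R"
  proof (cases "y = v")
    case False
    then have "y \<in> reach E (A \<union> S)" using y by simp
    then show ?thesis
    proof (induction rule: reach_induct)
      case (base x)
      then show ?case using reach_base[of x] reach_step[OF v, of x] by auto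
    next
      case (step x y)
      show ?case using step.IH by (rule reach_step) (use step.hyps in simp)
    qed
  qed (use v in simp)
qed

text \<open>For symmetric \<open>\<phi>\<close> the supremum below is over a single value.\<close>

definition edge_weight :: "('a \<Rightarrow> 'a \<Rightarrow> ennreal) \<Rightarrow> 'a set \<Rightarrow> ennreal" where
  "edge_weight \<phi> e = Sup {\<phi> x y | x y. e = {x, y}}"

lemma edge_weight_doubleton:
  assumes "\<And>x y. \<phi> x y = \<phi> y x"
  shows "edge_weight \<phi> {x, y} = \<phi> x y"
proof -
  have "{\<phi> x' y' | x' y'. {x, y} = {x', y'}} = {\<phi> x y}"
    using assms by (auto simp: doubleton_eq_iff)
  then show ?thesis by (simp add: edge_weight_def)
qed

lemma edge_weight_le_1: "(\<And>x y. \<phi> x y \<le> 1) \<Longrightarrow> edge_weight \<phi> e \<le> 1"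
  by (auto simp: edge_weight_def intro: Sup_least)

text \<open>The mean of \<open>g\<close> applied to the size, capped at \<open>n\<close>, of the union of the clusters of the roots
  \<open>R\<close> in the random graph on the points of \<open>R\<close> and \<open>xs\<close>. Each step counts one root and exposes its
  edges to the points not yet reached, so edges between roots are irrelevant.\<close>

fun explore ::
    "('a \<Rightarrow> 'a \<Rightarrow> ennreal) \<Rightarrow> nat \<Rightarrow> (nat \<Rightarrow> ennreal) \<Rightarrow> 'a list \<Rightarrow> 'a list \<Rightarrow> ennreal" where
  "explore \<phi> 0 g R xs = g 0"
| "explore \<phi> (Suc n) g [] xs = g 0"
| "explore \<phi> (Suc n) g (v # R) xs =
     split_sum (\<phi> v) (\<lambda>y z. explore \<phi> n (\<lambda>k. g (Suc k)) (y @ R) z) xs"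

text \<open>The edges are revealed in three independent groups: from \<open>v\<close> to the points
  of \<open>xs\<close>, from \<open>v\<close> to the other roots, and among the vertices
  \<open>U\<close> other than \<open>v\<close>. The first group is the split made by
  \<open>explore\<close>, \<open>reach_star\<close> shows that the second has no effect, and the
  third is left to the induction hypothesis.\<close>

lemma explore_eq_bernoulli_sum:
  assumes sym: "\<And>x y. \<phi> x y = \<phi> y x" and le1: "\<And>x y. \<phi> x y \<le> 1"
  shows "distinct (R @ xs) \<Longrightarrow> explore \<phi> n g R xs =
    bernoulli_sum (edge_weight \<phi>) (vertex_pairs (set R \<union> set xs))
      (\<lambda>E. g (min n (card (reach E (set R)))))"
proof (induction n arbitrary: g R xs)
  case 0
  then show ?case
    by (simp add: bernoulli_sum_const finite_vertex_pairs edge_weight_le_1 le1)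
next
  case (Suc n)
  show ?case
  proof (cases R)
    case Nil
    then show ?thesis
      by (simp add: bernoulli_sum_const finite_vertex_pairs edge_weight_le_1 le1)
  next
    case (Cons v R')
    define U where "U = set R' \<union> set xs"
    define st where "st = (\<lambda>A::'a set. (\<lambda>x. {v, x}) ` A)"
    define H where "H = (\<lambda>S. bernoulli_sum (edge_weight \<phi>) (vertex_pairs U)
        (\<lambda>E. g (Suc (min n (card (reach E (set R' \<union> S)))))))"
    have vU: "v \<notin> U" and dist: "distinct (R' @ xs)" using Suc.prems Cons by (auto simp: U_def)
    have fin: "finite U" by (simp add: U_def)
    have le: "edge_weight \<phi> e \<le> 1" for e using le1 by (rule edge_weight_le_1)
    have inj: "inj_on (\<lambda>x. {v, x}) A" if "A \<subseteq> U" for A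
      using that vU by (auto simp: inj_on_def doubleton_eq_iff)
    have "explore \<phi> (Suc n) g R xs
        = split_sum (\<phi> v) (\<lambda>y z. explore \<phi> n (\<lambda>k. g (Suc k)) (y @ R') z) xs"
      by (simp add: Cons)
    also have "\<dots> = split_sum (\<phi> v) (\<lambda>y z. H (set y)) xs"
    proof (rule split_sum_cong)
      fix y z assume m: "mset y + mset z = mset xs"
      have "mset ((y @ R') @ z) = mset (R' @ xs)" using m by (simp add: ac_simps)
      then have d: "distinct ((y @ R') @ z)" using dist mset_eq_imp_distinct_iff by blast
      have "set y \<union> set z = set xs" using m by (metis set_mset_mset set_mset_union)
      then have "set (y @ R') \<union> set z = U" by (auto simp: U_def)
      then show "explore \<phi> n (\<lambda>k. g (Suc k)) (y @ R') z = H (set y)"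
        using Suc.IH[OF d] by (simp add: H_def Un_commute)
    qed
    also have "\<dots> = bernoulli_sum (\<phi> v) (set xs) H"
      using split_sum_set[of xs "\<phi> v" "\<lambda>S _. H S"] dist by simp
    also have "\<dots> = bernoulli_sum (edge_weight \<phi> \<circ> (\<lambda>x. {v, x})) (set xs) H"
      by (intro bernoulli_sum_cong) (simp_all add: edge_weight_doubleton[where \<phi> = \<phi>, OF sym])
    also have "\<dots> = bernoulli_sum (edge_weight \<phi> \<circ> (\<lambda>x. {v, x})) (set xs) (\<lambda>S.
        bernoulli_sum (edge_weight \<phi> \<circ> (\<lambda>x. {v, x})) (set R') (\<lambda>S'.
        bernoulli_sum (edge_weight \<phi>) (vertex_pairs U)
          (\<lambda>E. g (min (Suc n) (card (reach (st S \<union> (st S' \<union> E)) (set R)))))))"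
    proof (intro bernoulli_sum_cong refl)
      fix S assume S: "S \<subseteq> set xs"
      \<comment> \<open>Coins for the edges from \<open>v\<close> to the other roots are introduced,
        although \<open>explore\<close> never tosses them, in order to complete the edge set of the
        whole graph.\<close>
      have "H S = bernoulli_sum (edge_weight \<phi> \<circ> (\<lambda>x. {v, x})) (set R') (\<lambda>S'. H S)"
        by (rule bernoulli_sum_const[symmetric]) (simp_all add: le)
      also have "\<dots> = bernoulli_sum (edge_weight \<phi> \<circ> (\<lambda>x. {v, x})) (set R') (\<lambda>S'.
        bernoulli_sum (edge_weight \<phi>) (vertex_pairs U)
          (\<lambda>E. g (min (Suc n) (card (reach (st S \<union> (st S' \<union> E)) (set R))))))"
        unfolding H_def
      proof (intro bernoulli_sum_cong refl)
        fix S' E assume S': "S' \<subseteq> set R'" and E: "E \<subseteq> vertex_pairs U"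
        have "reach (st S \<union> (st S' \<union> E)) (set R) = reach (st (S \<union> S') \<union> E) (insert v (set R'))"
          by (simp add: st_def image_Un Un_assoc Cons)
        also have "\<dots> = insert v (reach E (set R' \<union> (S \<union> S')))"
          unfolding st_def by (rule reach_star[OF E vU]) (use S S' in \<open>auto simp: U_def\<close>)
        also have "set R' \<union> (S \<union> S') = set R' \<union> S" using S' by auto
        finally have eq: "reach (st S \<union> (st S' \<union> E)) (set R) = insert v (reach E (set R' \<union> S))" .
        have sub: "reach E (set R' \<union> S) \<subseteq> U"
          by (rule reach_subset[OF E]) (use S in \<open>auto simp: U_def\<close>)
        then have "finite (reach E (set R' \<union> S))" "v \<notin> reach E (set R' \<union> S)"
          using fin vU finite_subset by auto
        then show "g (Suc (min n (card (reach E (set R' \<union> S)))))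
            = g (min (Suc n) (card (reach (st S \<union> (st S' \<union> E)) (set R))))"
          by (simp add: eq)
      qed
      finally show "H S = bernoulli_sum (edge_weight \<phi> \<circ> (\<lambda>x. {v, x})) (set R') (\<lambda>S'.
        bernoulli_sum (edge_weight \<phi>) (vertex_pairs U)
          (\<lambda>E. g (min (Suc n) (card (reach (st S \<union> (st S' \<union> E)) (set R))))))" .
    qed
    also have "\<dots> = bernoulli_sum (edge_weight \<phi>) (st (set xs)) (\<lambda>T.
        bernoulli_sum (edge_weight \<phi>) (st (set R')) (\<lambda>T'.
        bernoulli_sum (edge_weight \<phi>) (vertex_pairs U)
          (\<lambda>E. g (min (Suc n) (card (reach (T \<union> (T' \<union> E)) (set R)))))))"
      unfolding st_def
      by (subst (1 2) bernoulli_sum_image) (auto intro!: inj simp: U_def)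
    also have "\<dots> = bernoulli_sum (edge_weight \<phi>) (st (set xs) \<union> (st (set R') \<union> vertex_pairs U))
        (\<lambda>E. g (min (Suc n) (card (reach E (set R)))))"
    proof -
      have d1: "st (set R') \<inter> vertex_pairs U = {}"
        using vU by (auto simp: st_def doubleton_mem_vertex_pairs)
      have d2: "st (set xs) \<inter> (st (set R') \<union> vertex_pairs U) = {}"
        using vU dist by (auto simp: st_def doubleton_mem_vertex_pairs doubleton_eq_iff U_def)
      have f: "finite (st (set xs))" "finite (st (set R'))" "finite (vertex_pairs U)"
        using fin by (auto simp: st_def finite_vertex_pairs)
      show ?thesis
        using d1 d2 f by (subst bernoulli_sum_union) (auto intro!: bernoulli_sum_cong bernoulli_sum_union[symmetric])
    qed
    also have "st (set xs) \<union> (st (set R') \<union> vertex_pairs U) = vertex_pairs (set R \<union> set xs)"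
    proof -
      have "set R \<union> set xs = insert v U" by (auto simp: Cons U_def)
      moreover have "st U = st (set xs) \<union> st (set R')" by (auto simp: st_def U_def)
      ultimately show ?thesis using vertex_pairs_insert[OF vU] by (simp add: st_def Un_assoc)
    qed
    finally show ?thesis .
  qed
qed

text \<open>A coupling: the smaller graph is realised as the induced subgraph of the larger one,
  where fewer roots and fewer edges reach fewer vertices.\<close>

lemma explore_subset_mono:
  assumes sym: "\<And>x y. \<phi> x y = \<phi> y x" and le1: "\<And>x y. \<phi> x y \<le> 1"
    and "mono g" "distinct (R @ xs)" "distinct (R' @ xs')"
    and "set R' \<subseteq> set R" "set R' \<union> set xs' \<subseteq> set R \<union> set xs"
  shows "explore \<phi> n g R' xs' \<le> explore \<phi> n g R xs"
proof -
  let ?P = "vertex_pairs (set R \<union> set xs)" and ?P' = "vertex_pairs (set R' \<union> set xs')"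
  have sub: "?P' \<subseteq> ?P" by (rule vertex_pairs_mono) (use assms in auto)
  have "explore \<phi> n g R' xs'
      = bernoulli_sum (edge_weight \<phi>) ?P' (\<lambda>E. g (min n (card (reach E (set R')))))"
    by (rule explore_eq_bernoulli_sum) (use assms in auto)
  also have "\<dots> = bernoulli_sum (edge_weight \<phi>) ?P (\<lambda>E. g (min n (card (reach (E \<inter> ?P') (set R')))))"
    by (rule bernoulli_sum_superset[symmetric])
       (use sub in \<open>auto simp: finite_vertex_pairs edge_weight_le_1 le1\<close>)
  also have "\<dots> \<le> bernoulli_sum (edge_weight \<phi>) ?P (\<lambda>E. g (min n (card (reach E (set R)))))"
  proof (intro bernoulli_sum_mono monoD[OF \<open>mono g\<close>] min.mono order_refl card_mono)
    fix E assume E: "E \<subseteq> ?P"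
    show "finite (reach E (set R))"
      using reach_subset[OF E, of "set R"] finite_subset by fastforce
    show "reach (E \<inter> ?P') (set R') \<subseteq> reach E (set R)"
      by (rule reach_mono) (use assms in auto)
  qed
  also have "\<dots> = explore \<phi> n g R xs"
    by (rule explore_eq_bernoulli_sum[symmetric]) (use assms in auto)
  finally show ?thesis .
qed

lemma explore_le_Suc:
  assumes le1: "\<And>x y. \<phi> x y \<le> 1" and "mono g"
  shows "explore \<phi> n g R xs \<le> explore \<phi> (Suc n) g R xs"
  using \<open>mono g\<close>
proof (induction n arbitrary: g R xs)
  case 0
  have "explore \<phi> 0 g R = (\<lambda>_. g 0)" for g R
    by auto
  then show ?case using 0
    by (cases R) (auto simp: split_sum_const[where p = "\<phi> _"] le1 monoD)
next
  case (Suc n)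
  then have "mono (\<lambda>k. g (Suc k))" by (auto simp: mono_def)
  then have *: "explore \<phi> n (\<lambda>k. g (Suc k)) R xs \<le> explore \<phi> (Suc n) (\<lambda>k. g (Suc k)) R xs" for R xs
    by (rule Suc.IH)
  show ?case
  proof (cases R)
    case (Cons v R')
    have "split_sum (\<phi> v) (\<lambda>y z. explore \<phi> n (\<lambda>k. g (Suc k)) (y @ R') z) xs
      \<le> split_sum (\<phi> v) (\<lambda>y z. explore \<phi> (Suc n) (\<lambda>k. g (Suc k)) (y @ R') z) xs"
      by (intro split_sum_mono *)
    then show ?thesis unfolding Cons explore.simps(3) .
  qed simp
qed

lemma explore_add:
  assumes le1: "\<And>x y. \<phi> x y \<le> 1"
  shows "explore \<phi> n (\<lambda>k. c + g k) R xs = c + explore \<phi> n g R xs"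
proof (induction n arbitrary: g R xs)
  case (Suc n)
  then have IH: "explore \<phi> n (\<lambda>k. c + g k) R = (\<lambda>xs. c + explore \<phi> n g R xs)" for g R
    by auto
  show ?case
    by (cases R) (simp_all add: IH split_sum_add split_sum_const[where p = "\<phi> _"] le1)
qed simp

lemma explore_cmult: "explore \<phi> n (\<lambda>k. c * g k) R xs = c * explore \<phi> n g R xs"
proof (induction n arbitrary: g R xs)
  case (Suc n)
  then have IH: "explore \<phi> n (\<lambda>k. c * g k) R = (\<lambda>xs. c * explore \<phi> n g R xs)" for g R
    by auto
  show ?case by (cases R) (simp_all add: IH split_sum_cmult)
qed simp

text \<open>Every root is counted before the exploration stops, unless the cap intervenes; a step
  removes one root and adds \<open>y\<close>. Used to bound the mean degree by the mean cluster
  size.\<close>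

lemma explore_ge_min_length:
  assumes le1: "\<And>x y. \<phi> x y \<le> 1"
  shows "of_nat (min n (length R)) \<le> explore \<phi> n of_nat R xs"
proof (induction n arbitrary: R xs)
  case (Suc n)
  show ?case
  proof (cases R)
    case (Cons v R')
    have "of_nat (min (Suc n) (length R)) = split_sum (\<phi> v) (\<lambda>y z. of_nat (min (Suc n) (length R))) xs"
      by (simp add: split_sum_const le1)
    also have "\<dots> \<le> split_sum (\<phi> v) (\<lambda>y z. explore \<phi> n (\<lambda>k. of_nat (Suc k)) (y @ R') z) xs"
    proof (rule split_sum_mono)
      fix y z :: "'a list"
      have "of_nat (min (Suc n) (length R)) \<le> 1 + (of_nat (min n (length (y @ R'))) :: ennreal)"
      proof -
        have "min (Suc n) (length R) \<le> 1 + min n (length (y @ R'))" by (auto simp: Cons)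
        then have "(of_nat (min (Suc n) (length R)) :: ennreal) \<le> of_nat (1 + min n (length (y @ R')))"
          by (simp only: of_nat_le_iff)
        then show ?thesis by (simp only: of_nat_add of_nat_1)
      qed
      also have "\<dots> \<le> 1 + explore \<phi> n of_nat (y @ R') z"
        by (intro add_left_mono Suc.IH)
      also have "\<dots> = explore \<phi> n (\<lambda>k. of_nat (Suc k)) (y @ R') z"
        by (simp add: explore_add le1)
      finally show "of_nat (min (Suc n) (length R)) \<le> explore \<phi> n (\<lambda>k. of_nat (Suc k)) (y @ R') z" .
    qed
    finally show ?thesis by (simp add: Cons)
  qed simp
qed simp

section \<open>Iterated integrals over lists of points\<close>

text \<open>Instead of a \<open>\<sigma>\<close>-field on lists, measurability of a function of lists is tested along the finite
  lists of coordinates of a random sequence.\<close>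

definition list_measurable :: "('a::topological_space list \<Rightarrow> ennreal) \<Rightarrow> bool" where
  "list_measurable F \<longleftrightarrow>
     (\<forall>is. (\<lambda>x. F (map x is)) \<in> borel_measurable (Pi\<^sub>M (UNIV :: nat set) (\<lambda>_. borel)))"

definition list_measurable2 :: "('a::topological_space list \<Rightarrow> 'a list \<Rightarrow> ennreal) \<Rightarrow> bool" where
  "list_measurable2 G \<longleftrightarrow>
     (\<forall>is js. (\<lambda>x. G (map x is) (map x js)) \<in> borel_measurable (Pi\<^sub>M (UNIV :: nat set) (\<lambda>_. borel)))"

text \<open>Testing on coordinates of a sequence suffices for arbitrary measurable points, because
  finitely many random points can be made coordinates of one random sequence.\<close>

lemma list_measurable2D:
  fixes G :: "'a::topological_space list \<Rightarrow> 'a list \<Rightarrow> ennreal"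
  assumes "list_measurable2 G" "set rs \<subseteq> N \<rightarrow>\<^sub>M borel" "set xs \<subseteq> N \<rightarrow>\<^sub>M borel"
  shows "(\<lambda>\<omega>. G (map (\<lambda>r. r \<omega>) rs) (map (\<lambda>r. r \<omega>) xs)) \<in> borel_measurable N"
proof -
  define fs where "fs = rs @ xs"
  \<comment> \<open>The maps in \<open>rs @ xs\<close> become the first coordinates; the remaining
    ones are constant.\<close>
  define X where "X = (\<lambda>\<omega> i. if i < length fs then (fs ! i) \<omega> else undefined)"
  have "X \<in> N \<rightarrow>\<^sub>M Pi\<^sub>M UNIV (\<lambda>_. borel)"
  proof (rule measurable_PiM_single')
    fix i show "(\<lambda>\<omega>. X \<omega> i) \<in> N \<rightarrow>\<^sub>M borel"
    proof (cases "i < length fs")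
      case True
      then have "fs ! i \<in> set fs" by simp
      then have "fs ! i \<in> N \<rightarrow>\<^sub>M borel" using assms by (auto simp: fs_def)
      then show ?thesis using True by (simp add: X_def)
    qed (simp add: X_def)
  qed (auto simp: space_PiM)
  then have "(\<lambda>\<omega>. G (map (X \<omega>) [0..<length rs]) (map (X \<omega>) [length rs..<length fs]))
      \<in> borel_measurable N"
    using assms(1) measurable_compose unfolding list_measurable2_def by blast
  moreover have "map (X \<omega>) [0..<length rs] = map (\<lambda>r. r \<omega>) rs" for \<omega>
    by (rule nth_equalityI) (auto simp: X_def fs_def nth_append)
  moreover have "map (X \<omega>) [length rs..<length fs] = map (\<lambda>r. r \<omega>) xs" for \<omega>
    by (rule nth_equalityI) (auto simp: X_def fs_def nth_append)
  ultimately show ?thesis by simp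
qed

lemma list_measurable_iff_2: "list_measurable F \<longleftrightarrow> list_measurable2 (\<lambda>_. F)"
  by (auto simp: list_measurable_def list_measurable2_def)

lemma list_measurableD:
  assumes "list_measurable F" "set xs \<subseteq> N \<rightarrow>\<^sub>M borel"
  shows "(\<lambda>\<omega>. F (map (\<lambda>r. r \<omega>) xs)) \<in> borel_measurable N"
  using list_measurable2D[of "\<lambda>_. F" "[]" N xs] assms by (simp add: list_measurable_iff_2)

lemma PiM_component_lists:
  "set (map (\<lambda>i x. x i) is) \<subseteq> Pi\<^sub>M UNIV (\<lambda>_. borel) \<rightarrow>\<^sub>M borel"
  by auto

text \<open>The last form, \<open>list_measurable2_move\<close>, treats an integration variable as
  the head of the parameter list and shifts it to the argument list. This yields joint measurability
  in parameters and variable; the value 0 on the empty list is a default.\<close>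

lemma list_measurable2_transform:
  fixes G :: "'a::topological_space list \<Rightarrow> 'a list \<Rightarrow> ennreal"
  assumes "list_measurable2 G"
  shows list_measurable2_swap: "list_measurable2 (\<lambda>y z. G z y)"
    and list_measurable2_snd: "list_measurable (G R)"
    and list_measurable2_append: "list_measurable2 (\<lambda>y z. G (y @ R) z)"
    and list_measurable2_Cons1: "list_measurable2 (\<lambda>y z. G (x # y) z)"
    and list_measurable2_Cons2: "list_measurable2 (\<lambda>y z. G y (x # z))"
    and list_measurable2_move:
      "list_measurable2 (\<lambda>p l. case p of [] \<Rightarrow> 0 | y # p' \<Rightarrow> G p' (y # l))"
proof -
  let ?c = "\<lambda>is. map (\<lambda>i (x::nat \<Rightarrow> 'a). x i) is" and ?k = "\<lambda>l. map (\<lambda>r _. r) l"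
  have c: "set (?c is) \<subseteq> Pi\<^sub>M UNIV (\<lambda>_. borel) \<rightarrow>\<^sub>M borel" for "is" :: "nat list" by auto
  have k: "set (?k l) \<subseteq> Pi\<^sub>M (UNIV::nat set) (\<lambda>_. borel) \<rightarrow>\<^sub>M borel" for l :: "'a list" by auto
  have e: "map (\<lambda>r. r x) (?c is) = map x is" "map (\<lambda>r. r x) (?k l) = l" for x l "is" by (simp_all add: comp_def)
  have ck: "set (a @ b) \<subseteq> Pi\<^sub>M (UNIV::nat set) (\<lambda>_. borel) \<rightarrow>\<^sub>M (borel :: 'a measure)"
    if "set a \<subseteq> Pi\<^sub>M UNIV (\<lambda>_. borel) \<rightarrow>\<^sub>M borel" "set b \<subseteq> Pi\<^sub>M UNIV (\<lambda>_. borel) \<rightarrow>\<^sub>M borel" for a b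
    using that by auto
  show "list_measurable2 (\<lambda>y z. G z y)" using assms by (auto simp: list_measurable2_def)
  show "list_measurable (G R)" unfolding list_measurable_def
    using list_measurable2D[OF assms k[of R] c] unfolding e by simp
  show "list_measurable2 (\<lambda>y z. G (y @ R) z)" unfolding list_measurable2_def
    using list_measurable2D[OF assms ck[OF c k[of R]] c] unfolding e map_append by simp
  show "list_measurable2 (\<lambda>y z. G (x # y) z)" unfolding list_measurable2_def
    using list_measurable2D[OF assms ck[OF k[of "[x]"] c] c] unfolding e map_append by simp
  show "list_measurable2 (\<lambda>y z. G y (x # z))" unfolding list_measurable2_def
    using list_measurable2D[OF assms c ck[OF k[of "[x]"] c]] unfolding e map_append by simp
  show "list_measurable2 (\<lambda>p l. case p of [] \<Rightarrow> 0 | y # p' \<Rightarrow> G p' (y # l))"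
    unfolding list_measurable2_def
  proof (intro allI)
    fix "is" js :: "nat list"
    show "(\<lambda>x. case map x is of [] \<Rightarrow> 0 | y # p' \<Rightarrow> G p' (y # map x js))
      \<in> borel_measurable (Pi\<^sub>M UNIV (\<lambda>_. borel))"
    proof (cases "is")
      case (Cons i is')
      have "(\<lambda>x. G (map x is') (map x (i # js))) \<in> borel_measurable (Pi\<^sub>M UNIV (\<lambda>_. borel))"
        using assms unfolding list_measurable2_def by blast
      then show ?thesis by (simp add: Cons)
    qed simp
  qed
qed

lemma list_measurable_Cons: "list_measurable F \<Longrightarrow> list_measurable (\<lambda>l. F (x # l))"
  unfolding list_measurable_iff_2 by (rule list_measurable2_Cons2)

lemma list_measurable_const: "list_measurable (\<lambda>_. c)"
  by (simp add: list_measurable_def)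

lemma list_measurable_comp_length: "list_measurable (\<lambda>l. h (length l))"
  by (simp add: list_measurable_def)

lemma list_measurable_suminf:
  fixes F :: "nat \<Rightarrow> 'a::topological_space list \<Rightarrow> ennreal"
  shows "(\<And>i. list_measurable (F i)) \<Longrightarrow> list_measurable (\<lambda>l. \<Sum>i. F i l)"
  unfolding list_measurable_def by (intro allI borel_measurable_suminf_order) blast

lemma list_measurable_sum:
  fixes F :: "'i \<Rightarrow> 'a::topological_space list \<Rightarrow> ennreal"
  shows "(\<And>i. list_measurable (F i)) \<Longrightarrow> list_measurable (\<lambda>l. \<Sum>i\<in>I. F i l)"
  unfolding list_measurable_def by (intro allI borel_measurable_sum) blast

context
  fixes F G :: "'a::topological_space list \<Rightarrow> ennreal"
  assumes F: "list_measurable F" and G: "list_measurable G"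
begin

lemma list_measurable_add: "list_measurable (\<lambda>l. F l + G l)"
  and list_measurable_diff: "list_measurable (\<lambda>l. F l - G l)"
  and list_measurable_times: "list_measurable (\<lambda>l. F l * G l)"
proof -
  have [measurable]: "(\<lambda>x. F (map x is)) \<in> borel_measurable (Pi\<^sub>M (UNIV :: nat set) (\<lambda>_. borel))"
    "(\<lambda>x. G (map x is)) \<in> borel_measurable (Pi\<^sub>M (UNIV :: nat set) (\<lambda>_. borel))" for "is"
    using F G unfolding list_measurable_def by blast+
  show "list_measurable (\<lambda>l. F l + G l)" "list_measurable (\<lambda>l. F l - G l)" "list_measurable (\<lambda>l. F l * G l)"
    unfolding list_measurable_def by measurable
qed

end

text \<open>\<open>p\<close> and \<open>G\<close> depend on \<open>\<omega>\<close> because the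
  recursion stores the current random point inside \<open>G\<close>, and because \<open>p\<close>
  will be the kernel at a random root.\<close>

lemma split_sum_measurable:
  fixes xs :: "('n \<Rightarrow> 'a::topological_space) list"
  assumes "set xs \<subseteq> N \<rightarrow>\<^sub>M borel"
    and "\<And>r. r \<in> N \<rightarrow>\<^sub>M borel \<Longrightarrow> (\<lambda>\<omega>. p \<omega> (r \<omega>)) \<in> borel_measurable N"
    and "\<And>y z. set y \<subseteq> N \<rightarrow>\<^sub>M borel \<Longrightarrow> set z \<subseteq> N \<rightarrow>\<^sub>M borel \<Longrightarrow>
      (\<lambda>\<omega>. G \<omega> (map (\<lambda>r. r \<omega>) y) (map (\<lambda>r. r \<omega>) z)) \<in> borel_measurable N"
  shows "(\<lambda>\<omega>. split_sum (p \<omega>) (G \<omega>) (map (\<lambda>r. r \<omega>) xs)) \<in> borel_measurable N"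
  using assms(1,3)
proof (induction xs arbitrary: G)
  case Nil
  then show ?case using Nil(2)[of "[]" "[]"] by simp
next
  case (Cons r xs)
  have r: "r \<in> N \<rightarrow>\<^sub>M borel" and xs: "set xs \<subseteq> N \<rightarrow>\<^sub>M borel" using Cons.prems by auto
  have [measurable]: "(\<lambda>\<omega>. p \<omega> (r \<omega>)) \<in> borel_measurable N" using r by (rule assms(2))
  have [measurable]: "(\<lambda>\<omega>. split_sum (p \<omega>) (\<lambda>y z. G \<omega> (r \<omega> # y) z) (map (\<lambda>r. r \<omega>) xs))
      \<in> borel_measurable N"
  proof (rule Cons.IH[OF xs])
    fix y z :: "('n \<Rightarrow> 'a) list"
    assume "set y \<subseteq> N \<rightarrow>\<^sub>M borel" "set z \<subseteq> N \<rightarrow>\<^sub>M borel"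
    then show "(\<lambda>\<omega>. G \<omega> (r \<omega> # map (\<lambda>r. r \<omega>) y) (map (\<lambda>r. r \<omega>) z)) \<in> borel_measurable N"
      using Cons.prems(2)[of "r # y" z] r by simp
  qed
  have [measurable]: "(\<lambda>\<omega>. split_sum (p \<omega>) (\<lambda>y z. G \<omega> y (r \<omega> # z)) (map (\<lambda>r. r \<omega>) xs))
      \<in> borel_measurable N"
  proof (rule Cons.IH[OF xs])
    fix y z :: "('n \<Rightarrow> 'a) list"
    assume "set y \<subseteq> N \<rightarrow>\<^sub>M borel" "set z \<subseteq> N \<rightarrow>\<^sub>M borel"
    then show "(\<lambda>\<omega>. G \<omega> (map (\<lambda>r. r \<omega>) y) (r \<omega> # map (\<lambda>r. r \<omega>) z)) \<in> borel_measurable N"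
      using Cons.prems(2)[of y "r # z"] r by simp
  qed
  show ?case by simp
qed

lemma explore_measurable:
  fixes R xs :: "('n \<Rightarrow> 'a::second_countable_topology) list"
  assumes "(\<lambda>(x, y). \<phi> x y) \<in> borel_measurable (borel \<Otimes>\<^sub>M borel)"
  shows "set R \<subseteq> N \<rightarrow>\<^sub>M borel \<Longrightarrow> set xs \<subseteq> N \<rightarrow>\<^sub>M borel \<Longrightarrow>
    (\<lambda>\<omega>. explore \<phi> n g (map (\<lambda>r. r \<omega>) R) (map (\<lambda>r. r \<omega>) xs)) \<in> borel_measurable N"
proof (induction n arbitrary: g R xs)
  case (Suc n)
  show ?case
  proof (cases R)
    case (Cons v R')
    have v [measurable]: "v \<in> N \<rightarrow>\<^sub>M borel" and R': "set R' \<subseteq> N \<rightarrow>\<^sub>M borel"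
      using Suc.prems Cons by auto
    have "(\<lambda>\<omega>. split_sum (\<phi> (v \<omega>))
        (\<lambda>y z. explore \<phi> n (\<lambda>k. g (Suc k)) (y @ map (\<lambda>r. r \<omega>) R') z) (map (\<lambda>r. r \<omega>) xs))
      \<in> borel_measurable N"
    proof (rule split_sum_measurable[OF Suc.prems(2)])
      fix r :: "'n \<Rightarrow> 'a" assume [measurable]: "r \<in> N \<rightarrow>\<^sub>M borel"
      have "(\<lambda>\<omega>. (v \<omega>, r \<omega>)) \<in> N \<rightarrow>\<^sub>M borel \<Otimes>\<^sub>M borel" by measurable
      from measurable_compose[OF this assms] show "(\<lambda>\<omega>. \<phi> (v \<omega>) (r \<omega>)) \<in> borel_measurable N"
        by simp
    next
      fix y z :: "('n \<Rightarrow> 'a) list"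
      assume "set y \<subseteq> N \<rightarrow>\<^sub>M borel" "set z \<subseteq> N \<rightarrow>\<^sub>M borel"
      then show "(\<lambda>\<omega>. explore \<phi> n (\<lambda>k. g (Suc k)) (map (\<lambda>r. r \<omega>) y @ map (\<lambda>r. r \<omega>) R')
          (map (\<lambda>r. r \<omega>) z)) \<in> borel_measurable N"
        using Suc.IH[of "y @ R'" z] R' by simp
    qed
    then show ?thesis by (simp add: Cons)
  qed simp
qed simp

lemma list_measurable2_explore:
  fixes \<phi> :: "'a::second_countable_topology \<Rightarrow> _"
  assumes "(\<lambda>(x, y). \<phi> x y) \<in> borel_measurable (borel \<Otimes>\<^sub>M borel)"
  shows "list_measurable2 (explore \<phi> n g)"
  unfolding list_measurable2_def
proof (intro allI)
  fix "is" js :: "nat list"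
  show "(\<lambda>x. explore \<phi> n g (map x is) (map x js)) \<in> borel_measurable (Pi\<^sub>M UNIV (\<lambda>_. borel))"
    using explore_measurable[OF assms, of "map (\<lambda>i x. x i) is" _ "map (\<lambda>i x. x i) js",
        OF PiM_component_lists PiM_component_lists]
    by (simp add: comp_def)
qed

lemma list_measurable_split_sum:
  fixes G :: "'a::topological_space list \<Rightarrow> _"
  assumes "list_measurable2 G" "p \<in> borel_measurable borel"
  shows "list_measurable (split_sum p G)"
  unfolding list_measurable_def
proof
  fix "is" :: "nat list"
  have "(\<lambda>x. split_sum p G (map (\<lambda>r. r x) (map (\<lambda>i x. x i) is))) \<in> borel_measurable (Pi\<^sub>M UNIV (\<lambda>_. borel))"
    using assms by (intro split_sum_measurable list_measurable2D PiM_component_lists) auto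
  then show "(\<lambda>x. split_sum p G (map x is)) \<in> borel_measurable (Pi\<^sub>M UNIV (\<lambda>_. borel))"
    by (simp add: comp_def)
qed

fun iter_integral :: "'a measure \<Rightarrow> ('a \<Rightarrow> ennreal) \<Rightarrow> nat \<Rightarrow> ('a list \<Rightarrow> ennreal) \<Rightarrow> ennreal" where
  "iter_integral \<Lambda> f 0 F = F []"
| "iter_integral \<Lambda> f (Suc n) F = (\<integral>\<^sup>+x. f x * iter_integral \<Lambda> f n (\<lambda>l. F (x # l)) \<partial>\<Lambda>)"

text \<open>The expectation of \<open>F\<close> over the points of a Poisson process of finite intensity \<open>f \<Lambda>\<close>, listed in
  uniformly random order.\<close>

definition poisson_integral :: "'a measure \<Rightarrow> ('a \<Rightarrow> ennreal) \<Rightarrow> ('a list \<Rightarrow> ennreal) \<Rightarrow> ennreal" where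
  "poisson_integral \<Lambda> f F = ennreal (exp (- enn2real (\<integral>\<^sup>+x. f x \<partial>\<Lambda>))) *
     (\<Sum>n. iter_integral \<Lambda> f n F / ennreal (fact n))"

locale diffuse_measure = sigma_finite_measure \<Lambda> for \<Lambda> :: "'a::polish_space measure" +
  assumes sets_borel [measurable_cong]: "sets \<Lambda> = sets borel"
    and diffuse: "emeasure \<Lambda> {x} = 0"
begin

abbreviation "itg \<equiv> iter_integral \<Lambda>"
abbreviation "pois \<equiv> poisson_integral \<Lambda>"

lemma space_UNIV [simp]: "space \<Lambda> = UNIV"
  using sets_eq_imp_space_eq[OF sets_borel] by simp

text \<open>Measurability in the parameter list \<open>R\<close> is proved for all \<open>G\<close>
  at once, so that the outermost integration variable can be turned into one more parameter.\<close>

lemma list_measurable_itg: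
  assumes [measurable]: "f \<in> borel_measurable borel"
  shows "list_measurable2 G \<Longrightarrow> list_measurable (\<lambda>R. itg f n (G R))"
proof (induction n arbitrary: G)
  case 0
  then show ?case using list_measurable2_snd[OF list_measurable2_swap[OF 0], of "[]"] by simp
next
  case (Suc n)
  \<comment> \<open>With the integration variable at the head of the parameters, the induction
    hypothesis gives the joint measurability required for integrating it out.\<close>
  define G' where "G' = (\<lambda>p l. case p of [] \<Rightarrow> 0 | y # p' \<Rightarrow> G p' (y # l))"
  have G': "list_measurable (\<lambda>R. itg f n (G' R))"
    unfolding G'_def by (intro Suc.IH list_measurable2_move Suc.prems)
  show ?case unfolding list_measurable_def
  proof
    fix "is" :: "nat list"
    let ?P = "Pi\<^sub>M UNIV (\<lambda>_::nat. borel) :: (nat \<Rightarrow> 'a) measure"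
    have "set (snd # map (\<lambda>i (x, y). x i) is) \<subseteq> ?P \<Otimes>\<^sub>M \<Lambda> \<rightarrow>\<^sub>M borel"
      by auto
    from list_measurableD[OF G' this]
    have [measurable]: "(\<lambda>(x, y). itg f n (\<lambda>l. G (map x is) (y # l))) \<in> borel_measurable (?P \<Otimes>\<^sub>M \<Lambda>)"
      by (simp add: G'_def comp_def case_prod_beta')
    show "(\<lambda>x. itg f (Suc n) (G (map x is))) \<in> borel_measurable ?P"
      by simp
  qed
qed

lemma measurable_itg_Cons:
  assumes "f \<in> borel_measurable borel" "list_measurable F"
  shows "(\<lambda>x. itg f n (\<lambda>l. F (x # l))) \<in> borel_measurable borel"
proof -
  have "list_measurable2 (\<lambda>p l. case p of [] \<Rightarrow> 0 | y # p' \<Rightarrow> F (y # l))"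
    using list_measurable2_move[of "\<lambda>_. F"] assms by (simp add: list_measurable_iff_2)
  from list_measurableD[OF list_measurable_itg[OF assms(1) this, of n], of "[\<lambda>x. x]" borel]
  show ?thesis by simp
qed

text \<open>By diffuseness each new point almost surely avoids \<open>A\<close> and the finitely
  many points already listed; the induction therefore enlarges \<open>A\<close> by every integrated
  point. Hence a comparison is only required on repetition-free lists of good points off
  \<open>A\<close>.\<close>

lemma itg_mono_AE:
  assumes "AE x in \<Lambda>. good x" "finite A"
    and "\<And>xs. distinct xs \<Longrightarrow> length xs = n \<Longrightarrow> set xs \<inter> A = {} \<Longrightarrow> (\<forall>x\<in>set xs. good x) \<Longrightarrow> F xs \<le> G xs"
  shows "itg f n F \<le> itg f n G"
  using assms(2,3)
proof (induction n arbitrary: F G A)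
  case 0
  then show ?case by simp
next
  case (Suc n)
  have "A \<in> null_sets \<Lambda>"
  proof -
    have "(\<Union>x\<in>A. {x}) \<in> null_sets \<Lambda>"
      using Suc.prems(1) by (intro null_sets_UN') (auto simp: null_sets_def diffuse countable_finite sets_borel)
    then show ?thesis by simp
  qed
  then have "AE x in \<Lambda>. x \<notin> A" by (rule AE_not_in)
  with assms(1) have "AE x in \<Lambda>. f x * itg f n (\<lambda>l. F (x # l)) \<le> f x * itg f n (\<lambda>l. G (x # l))"
  proof eventually_elim
    case (elim x)
    show ?case
    proof (intro mult_left_mono Suc.IH[of "insert x A"])
      fix xs assume "distinct xs" "length xs = n" "set xs \<inter> insert x A = {}" "\<forall>x\<in>set xs. good x"
      then show "F (x # xs) \<le> G (x # xs)" using elim by (intro Suc.prems(2)) auto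
    qed (use Suc.prems in auto)
  qed
  then show ?case by (simp add: nn_integral_mono_AE)
qed

lemma itg_cong:
  assumes "\<And>xs. length xs = n \<Longrightarrow> F xs = G xs"
  shows "itg f n F = itg f n G"
  by (intro antisym itg_mono_AE[of "\<lambda>_. True" "{}"]) (simp_all add: assms)

lemma itg_add:
  assumes [measurable]: "f \<in> borel_measurable borel"
  shows "list_measurable F \<Longrightarrow> list_measurable G \<Longrightarrow> itg f n (\<lambda>l. F l + G l) = itg f n F + itg f n G"
proof (induction n arbitrary: F G)
  case (Suc n)
  note [measurable] = measurable_itg_Cons[OF assms Suc.prems(1)] measurable_itg_Cons[OF assms Suc.prems(2)]
  show ?case
    by (simp add: Suc.IH Suc.prems list_measurable_Cons distrib_left nn_integral_add)
qed simp

lemma itg_cmult: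
  assumes [measurable]: "f \<in> borel_measurable borel"
  shows "list_measurable F \<Longrightarrow> itg f n (\<lambda>l. c * F l) = c * itg f n F"
proof (induction n arbitrary: F)
  case (Suc n)
  note [measurable] = measurable_itg_Cons[OF assms Suc.prems]
  show ?case
    by (simp add: Suc.IH Suc.prems list_measurable_Cons mult.left_commute nn_integral_cmult)
qed simp

lemma itg_suminf:
  assumes [measurable]: "f \<in> borel_measurable borel"
  shows "(\<And>i. list_measurable (F i)) \<Longrightarrow> itg f n (\<lambda>l. \<Sum>i. F i l) = (\<Sum>i. itg f n (F i))"
proof (induction n arbitrary: F)
  case (Suc n)
  note [measurable] = measurable_itg_Cons[OF assms Suc.prems]
  show ?case
    by (simp add: Suc.IH Suc.prems list_measurable_Cons nn_integral_suminf flip: ennreal_suminf_cmult)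
qed simp

lemma itg_const: "itg f n (\<lambda>_. c) = c * (\<integral>\<^sup>+x. f x \<partial>\<Lambda>) ^ n" if [measurable]: "f \<in> borel_measurable borel"
proof (induction n)
  case (Suc n)
  then show ?case by (simp add: nn_integral_multc nn_integral_cmult mult.left_commute)
qed simp

lemma itg_length: "itg f n (\<lambda>l. h (length l)) = h n * (\<integral>\<^sup>+x. f x \<partial>\<Lambda>) ^ n" if "f \<in> borel_measurable borel"
proof -
  have "itg f n (\<lambda>l. h (length l)) = itg f n (\<lambda>l. h n)" by (rule itg_cong) simp
  then show ?thesis by (simp add: itg_const that)
qed

text \<open>Tonelli's theorem for one integral against \<open>n\<close> nested ones. Measurability
  of \<open>H\<close> in point and list is phrased by placing the point at the head of a parameter
  list.\<close>

lemma itg_nn_integral_swap: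
  assumes [measurable]: "f \<in> borel_measurable borel" "b \<in> borel_measurable borel"
  shows "list_measurable2 (\<lambda>p l. case p of [] \<Rightarrow> 0 | x # p' \<Rightarrow> H x l) \<Longrightarrow>
    itg f n (\<lambda>l. \<integral>\<^sup>+x. b x * H x l \<partial>\<Lambda>) = (\<integral>\<^sup>+x. b x * itg f n (H x) \<partial>\<Lambda>)"
proof (induction n arbitrary: H)
  case (Suc n)
  let ?G = "\<lambda>p l. case p of [] \<Rightarrow> 0 | x # p' \<Rightarrow> H x l"
  have meas: "list_measurable (\<lambda>R. itg f n ((\<lambda>p l. case p of [] \<Rightarrow> 0 | y # p' \<Rightarrow> ?G p' (y # l)) R))"
    by (intro list_measurable_itg list_measurable2_move Suc.prems assms)
  have [measurable]: "(\<lambda>(x, y). itg f n (\<lambda>l. H x (y # l))) \<in> borel_measurable (\<Lambda> \<Otimes>\<^sub>M \<Lambda>)"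
    using list_measurableD[OF meas, of "[snd, fst]" "\<Lambda> \<Otimes>\<^sub>M \<Lambda>"] by (auto simp: case_prod_beta')
  interpret L: pair_sigma_finite \<Lambda> \<Lambda> ..
  have "itg f (Suc n) (\<lambda>l. \<integral>\<^sup>+x. b x * H x l \<partial>\<Lambda>)
      = (\<integral>\<^sup>+y. f y * itg f n (\<lambda>l. \<integral>\<^sup>+x. b x * H x (y # l) \<partial>\<Lambda>) \<partial>\<Lambda>)" by simp
  also have "\<dots> = (\<integral>\<^sup>+y. f y * (\<integral>\<^sup>+x. b x * itg f n (\<lambda>l. H x (y # l)) \<partial>\<Lambda>) \<partial>\<Lambda>)"
  proof (intro nn_integral_cong arg_cong2[where f = "(*)"] refl Suc.IH)
    fix y
    have "list_measurable2 (\<lambda>p l. ?G p (y # l))"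
      by (rule list_measurable2_Cons2[OF Suc.prems])
    then show "list_measurable2 (\<lambda>p l. case p of [] \<Rightarrow> 0 | x # p' \<Rightarrow> H x (y # l))" .
  qed
  also have "\<dots> = (\<integral>\<^sup>+y. \<integral>\<^sup>+x. f y * (b x * itg f n (\<lambda>l. H x (y # l))) \<partial>\<Lambda> \<partial>\<Lambda>)"
    by (intro nn_integral_cong nn_integral_cmult[symmetric]) measurable
  also have "\<dots> = (\<integral>\<^sup>+x. \<integral>\<^sup>+y. f y * (b x * itg f n (\<lambda>l. H x (y # l))) \<partial>\<Lambda> \<partial>\<Lambda>)"
    by (rule L.Fubini') measurable
  also have "\<dots> = (\<integral>\<^sup>+x. \<integral>\<^sup>+y. b x * (f y * itg f n (\<lambda>l. H x (y # l))) \<partial>\<Lambda> \<partial>\<Lambda>)"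
    by (simp add: mult.left_commute)
  also have "\<dots> = (\<integral>\<^sup>+x. b x * (\<integral>\<^sup>+y. f y * itg f n (\<lambda>l. H x (y # l)) \<partial>\<Lambda>) \<partial>\<Lambda>)"
    by (intro nn_integral_cong nn_integral_cmult) measurable
  finally show ?case by simp
qed simp

end

section \<open>Poisson integrals\<close>

lemma suminf_triangle_ennreal:
  fixes B :: "nat \<Rightarrow> nat \<Rightarrow> ennreal"
  shows "(\<Sum>n. \<Sum>k\<le>n. B k (n - k)) = (\<Sum>k. \<Sum>l. B k l)"
proof -
  have "(\<Sum>n. \<Sum>k\<le>n. B k (n - k)) = (\<Sum>n. \<Sum>k. if k \<le> n then B k (n - k) else 0)"
  proof (rule suminf_cong)
    fix n
    have "(\<Sum>k. if k \<le> n then B k (n - k) else 0) = (\<Sum>k\<in>{..n}. if k \<le> n then B k (n - k) else 0)"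
      by (rule suminf_finite) auto
    also have "\<dots> = (\<Sum>k\<le>n. B k (n - k))" by (rule sum.cong) auto
    finally show "(\<Sum>k\<le>n. B k (n - k)) = (\<Sum>k. if k \<le> n then B k (n - k) else 0)" by simp
  qed
  also have "\<dots> = (\<Sum>k. \<Sum>n. if k \<le> n then B k (n - k) else 0)"
    unfolding nn_integral_count_space_nat[symmetric]
    by (rule nn_integral_count_space_nn_integral) auto
  also have "\<dots> = (\<Sum>k. \<Sum>l. B k l)"
  proof (rule suminf_cong)
    fix k
    have "(\<Sum>n. if k \<le> n then B k (n - k) else 0)
        = (\<Sum>n. if k \<le> n + k then B k (n + k - k) else 0) + (\<Sum>i<k. if k \<le> i then B k (i - k) else 0)"
      by (rule suminf_offset) (rule summableI)
    then show "(\<Sum>n. if k \<le> n then B k (n - k) else 0) = (\<Sum>l. B k l)" by simp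
  qed
  finally show ?thesis .
qed

text \<open>Pascal's rule: one more point joins either the first class or the second.\<close>

lemma sum_binomial_Suc_ennreal:
  fixes A :: "nat \<Rightarrow> nat \<Rightarrow> ennreal"
  shows "(\<Sum>k\<le>n. of_nat (n choose k) * (A (Suc k) (n - k) + A k (Suc (n - k))))
    = (\<Sum>k\<le>Suc n. of_nat (Suc n choose k) * A k (Suc n - k))"
proof -
  have "(\<Sum>k\<le>n. of_nat (n choose k) * A k (Suc (n - k))) = (\<Sum>k\<le>n. of_nat (n choose k) * A k (Suc n - k))"
    by (intro sum.cong refl) (simp add: Suc_diff_le)
  also have "\<dots> = (\<Sum>k\<le>Suc n. of_nat (n choose k) * A k (Suc n - k))"
    by simp
  also have "\<dots> = A 0 (Suc n) + (\<Sum>k\<le>n. of_nat (n choose Suc k) * A (Suc k) (n - k))"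
    by (subst sum.atMost_Suc_shift) simp
  finally have *: "(\<Sum>k\<le>n. of_nat (n choose k) * A k (Suc (n - k)))
      = A 0 (Suc n) + (\<Sum>k\<le>n. of_nat (n choose Suc k) * A (Suc k) (n - k))" .
  have "(\<Sum>k\<le>Suc n. of_nat (Suc n choose k) * A k (Suc n - k))
      = A 0 (Suc n) + (\<Sum>k\<le>n. of_nat (Suc n choose Suc k) * A (Suc k) (n - k))"
    by (subst sum.atMost_Suc_shift) simp
  also have "\<dots> = A 0 (Suc n) + ((\<Sum>k\<le>n. of_nat (n choose k) * A (Suc k) (n - k))
      + (\<Sum>k\<le>n. of_nat (n choose Suc k) * A (Suc k) (n - k)))"
    by (simp add: distrib_right flip: sum.distrib)
  finally show ?thesis
    by (simp add: distrib_left sum.distrib * ac_simps)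
qed

lemma exp_series_ennreal:
  assumes "0 \<le> m"
  shows "(\<Sum>n. ennreal m ^ n / ennreal (fact n)) = ennreal (exp m)"
proof -
  have "(\<lambda>n. m ^ n / fact n) sums exp m"
    using exp_converges[of m] by (simp add: divide_inverse mult.commute)
  then have "(\<lambda>n. ennreal (m ^ n / fact n)) sums ennreal (exp m)"
    using assms by (subst sums_ennreal) auto
  moreover have "ennreal (m ^ n / fact n) = ennreal m ^ n / ennreal (fact n)" for n
    using assms by (simp add: divide_ennreal ennreal_power)
  ultimately show ?thesis by (simp add: sums_iff)
qed

context diffuse_measure
begin

text \<open>A binomial expansion: each of the \<open>n\<close> points is coloured independently, and
  since the two colours are collected in separate lists, all colourings with \<open>k\<close> points
  of the first colour contribute the same integral.\<close>

lemma itg_split_sum: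
  assumes [measurable]: "f \<in> borel_measurable borel" "p \<in> borel_measurable borel"
  shows "list_measurable2 G \<Longrightarrow> itg f n (split_sum p G) =
    (\<Sum>k\<le>n. of_nat (n choose k) *
      itg (\<lambda>x. p x * f x) k (\<lambda>y. itg (\<lambda>x. (1 - p x) * f x) (n - k) (G y)))"
proof (induction n arbitrary: G)
  case (Suc n)
  let ?f1 = "\<lambda>x. p x * f x" and ?f2 = "\<lambda>x. (1 - p x) * f x"
  note G = Suc.prems
  define A where "A = (\<lambda>k l. itg ?f1 k (\<lambda>y. itg ?f2 l (G y)))"
  have m1 [measurable]: "?f1 \<in> borel_measurable borel" and m2 [measurable]: "?f2 \<in> borel_measurable borel"
    by measurable
  have lm: "list_measurable (\<lambda>y. itg ?f2 l (G y))" for l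
    by (rule list_measurable_itg[OF m2 G])
  \<comment> \<open>The joint measurability that \<open>itg_nn_integral_swap\<close> asks
    for.\<close>
  have lmH: "list_measurable2 (\<lambda>q l. case q of [] \<Rightarrow> 0 | x # q' \<Rightarrow> itg ?f2 k (\<lambda>z. G l (x # z)))" for k
    unfolding list_measurable2_def
  proof (intro allI)
    fix "is" js :: "nat list"
    show "(\<lambda>x. case map x is of [] \<Rightarrow> 0 | a # q' \<Rightarrow> itg ?f2 k (\<lambda>z. G (map x js) (a # z)))
        \<in> borel_measurable (Pi\<^sub>M UNIV (\<lambda>_. borel))"
    proof (cases "is")
      case (Cons i is')
      define G' where "G' = (\<lambda>p l. case p of [] \<Rightarrow> 0 | y # p' \<Rightarrow> G p' (y # l))"
      have "list_measurable (\<lambda>p. itg ?f2 k (G' p))"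
        unfolding G'_def by (intro list_measurable_itg m2 list_measurable2_move G)
      then have "(\<lambda>x. itg ?f2 k (G' (map x (i # js)))) \<in> borel_measurable (Pi\<^sub>M UNIV (\<lambda>_. borel))"
        unfolding list_measurable_def by blast
      then show ?thesis by (simp add: G'_def Cons)
    qed simp
  qed
  have lmk: "(\<lambda>x. itg ?f1 k (\<lambda>y. itg ?f2 l (G (x # y)))) \<in> borel_measurable borel" for k l
    by (rule measurable_itg_Cons[OF m1 lm])
  have lmk': "(\<lambda>x. itg ?f1 k (\<lambda>y. itg ?f2 l (\<lambda>z. G y (x # z)))) \<in> borel_measurable borel" for k l
    using list_measurableD[OF list_measurable_itg[OF m1 lmH], of "[\<lambda>x. x]" borel] by simp
  note [measurable] = lmk lmk'
  have "itg f (Suc n) (split_sum p G) = (\<integral>\<^sup>+x. f x * itg f n (\<lambda>l.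
      p x * split_sum p (\<lambda>y z. G (x # y) z) l + (1 - p x) * split_sum p (\<lambda>y z. G y (x # z)) l) \<partial>\<Lambda>)"
    by simp
  also have "\<dots> = (\<integral>\<^sup>+x. f x * (p x * itg f n (split_sum p (\<lambda>y z. G (x # y) z))
      + (1 - p x) * itg f n (split_sum p (\<lambda>y z. G y (x # z)))) \<partial>\<Lambda>)"
  proof (intro nn_integral_cong arg_cong2[where f = "(*)"] refl)
    fix x
    have l1: "list_measurable (split_sum p (\<lambda>y z. G (x # y) z))"
      and l2: "list_measurable (split_sum p (\<lambda>y z. G y (x # z)))"
      by (intro list_measurable_split_sum list_measurable2_Cons1 list_measurable2_Cons2 G assms)+
    show "itg f n (\<lambda>l. p x * split_sum p (\<lambda>y z. G (x # y) z) l + (1 - p x) * split_sum p (\<lambda>y z. G y (x # z)) l)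
      = p x * itg f n (split_sum p (\<lambda>y z. G (x # y) z)) + (1 - p x) * itg f n (split_sum p (\<lambda>y z. G y (x # z)))"
      by (simp add: itg_add itg_cmult l1 l2 list_measurable_times list_measurable_const)
  qed
  also have "\<dots> = (\<integral>\<^sup>+x. (\<Sum>k\<le>n. of_nat (n choose k) *
      (?f1 x * itg ?f1 k (\<lambda>y. itg ?f2 (n - k) (G (x # y))) +
       ?f2 x * itg ?f1 k (\<lambda>y. itg ?f2 (n - k) (\<lambda>z. G y (x # z))))) \<partial>\<Lambda>)"
  proof (intro nn_integral_cong)
    fix x
    have e1: "itg f n (split_sum p (\<lambda>y z. G (x # y) z))
      = (\<Sum>k\<le>n. of_nat (n choose k) * itg ?f1 k (\<lambda>y. itg ?f2 (n - k) (G (x # y))))"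
      by (rule Suc.IH) (rule list_measurable2_Cons1[OF G])
    have e2: "itg f n (split_sum p (\<lambda>y z. G y (x # z)))
      = (\<Sum>k\<le>n. of_nat (n choose k) * itg ?f1 k (\<lambda>y. itg ?f2 (n - k) (\<lambda>z. G y (x # z))))"
      by (rule Suc.IH) (rule list_measurable2_Cons2[OF G])
    show "f x * (p x * itg f n (split_sum p (\<lambda>y z. G (x # y) z))
        + (1 - p x) * itg f n (split_sum p (\<lambda>y z. G y (x # z))))
      = (\<Sum>k\<le>n. of_nat (n choose k) *
      (?f1 x * itg ?f1 k (\<lambda>y. itg ?f2 (n - k) (G (x # y))) +
       ?f2 x * itg ?f1 k (\<lambda>y. itg ?f2 (n - k) (\<lambda>z. G y (x # z)))))"
      unfolding e1 e2 by (simp add: sum_distrib_left distrib_left sum.distrib ac_simps)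
  qed
  also have "\<dots> = (\<Sum>k\<le>n. of_nat (n choose k) *
      ((\<integral>\<^sup>+x. ?f1 x * itg ?f1 k (\<lambda>y. itg ?f2 (n - k) (G (x # y))) \<partial>\<Lambda>) +
       (\<integral>\<^sup>+x. ?f2 x * itg ?f1 k (\<lambda>y. itg ?f2 (n - k) (\<lambda>z. G y (x # z))) \<partial>\<Lambda>)))"
    by (subst nn_integral_sum) (auto simp: nn_integral_cmult nn_integral_add)
  also have "\<dots> = (\<Sum>k\<le>n. of_nat (n choose k) * (A (Suc k) (n - k) + A k (Suc (n - k))))"
  proof (intro sum.cong refl arg_cong2[where f = "(*)"] arg_cong2[where f = "(+)"])
    fix k
    show "(\<integral>\<^sup>+x. ?f1 x * itg ?f1 k (\<lambda>y. itg ?f2 (n - k) (G (x # y))) \<partial>\<Lambda>) = A (Suc k) (n - k)"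
      by (simp add: A_def)
    \<comment> \<open>Here the new point joins the second list, so its integral has to move inside
      the \<open>k\<close> integrals over the first list.\<close>
    show "(\<integral>\<^sup>+x. ?f2 x * itg ?f1 k (\<lambda>y. itg ?f2 (n - k) (\<lambda>z. G y (x # z))) \<partial>\<Lambda>) = A k (Suc (n - k))"
      unfolding A_def by (simp add: itg_nn_integral_swap[OF m1 m2 lmH])
  qed
  also have "\<dots> = (\<Sum>k\<le>Suc n. of_nat (Suc n choose k) * A k (Suc n - k))"
    by (rule sum_binomial_Suc_ennreal)
  finally show ?case by (simp add: A_def)
qed simp

lemma pois_mono_AE:
  assumes "AE x in \<Lambda>. good x" "finite A"
    and "\<And>xs. distinct xs \<Longrightarrow> set xs \<inter> A = {} \<Longrightarrow> (\<forall>x\<in>set xs. good x) \<Longrightarrow> F xs \<le> G xs"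
  shows "pois f F \<le> pois f G"
  unfolding poisson_integral_def
proof (intro mult_left_mono suminf_le summableI divide_right_mono_ennreal)
  fix n
  show "itg f n F \<le> itg f n G"
    by (rule itg_mono_AE[OF assms(1,2)]) (rule assms(3))
qed simp

lemma pois_mono: "(\<And>xs. F xs \<le> G xs) \<Longrightarrow> pois f F \<le> pois f G"
  by (rule pois_mono_AE[of "\<lambda>_. True" "{}"]) auto

lemma pois_add:
  assumes "f \<in> borel_measurable borel" "list_measurable F" "list_measurable G"
  shows "pois f (\<lambda>l. F l + G l) = pois f F + pois f G"
  unfolding poisson_integral_def
  by (simp add: itg_add assms add_divide_distrib_ennreal distrib_left flip: suminf_add)

lemma pois_cmult:
  assumes "f \<in> borel_measurable borel" "list_measurable F"
  shows "pois f (\<lambda>l. c * F l) = c * pois f F"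
  unfolding poisson_integral_def
  by (simp add: itg_cmult assms ennreal_times_divide[symmetric] mult.left_commute)

text \<open>The probability generating function of the Poisson number of points. At
  \<open>c = 1\<close> it shows total mass 1; at \<open>c = exp 2\<close> it bounds the quadratic
  remainder of the exponential estimate.\<close>

lemma pois_power_length:
  assumes "f \<in> borel_measurable borel" "(\<integral>\<^sup>+x. f x \<partial>\<Lambda>) < \<infinity>" "0 \<le> c"
  shows "pois f (\<lambda>l. ennreal c ^ length l) = ennreal (exp ((c - 1) * enn2real (\<integral>\<^sup>+x. f x \<partial>\<Lambda>)))"
proof -
  define m where "m = enn2real (\<integral>\<^sup>+x. f x \<partial>\<Lambda>)"
  have m: "(\<integral>\<^sup>+x. f x \<partial>\<Lambda>) = ennreal m" "0 \<le> m" using assms by (auto simp: m_def)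
  have "itg f n (\<lambda>l. ennreal c ^ length l) = ennreal (c * m) ^ n" for n
    using assms m by (simp add: itg_length ennreal_mult power_mult_distrib)
  then have "pois f (\<lambda>l. ennreal c ^ length l) = ennreal (exp (- m)) * ennreal (exp (c * m))"
    using assms m by (simp add: poisson_integral_def m_def[symmetric] exp_series_ennreal)
  also have "\<dots> = ennreal (exp ((c - 1) * m))"
    by (simp add: algebra_simps flip: ennreal_mult exp_add)
  finally show ?thesis by (simp add: m_def)
qed

lemma pois_const:
  assumes "f \<in> borel_measurable borel" "(\<integral>\<^sup>+x. f x \<partial>\<Lambda>) < \<infinity>"
  shows "pois f (\<lambda>_. c) = c"
  using pois_power_length[OF assms, of 1] pois_cmult[OF assms(1) list_measurable_const, of c 1] by simp

text \<open>The colouring theorem for Poisson processes: the two colour classes are independent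
  Poisson processes. The binomial expansion divided by \<open>fact n\<close> is a Cauchy product,
  and the normalising exponentials multiply because the two masses add up.\<close>

lemma pois_split_sum:
  assumes [measurable]: "f \<in> borel_measurable borel" "p \<in> borel_measurable borel"
    and fin: "(\<integral>\<^sup>+x. f x \<partial>\<Lambda>) < \<infinity>" and le1: "\<And>x. p x \<le> 1" and G: "list_measurable2 G"
  shows "pois f (split_sum p G) = pois (\<lambda>x. p x * f x) (\<lambda>y. pois (\<lambda>x. (1 - p x) * f x) (G y))"
proof -
  let ?f1 = "\<lambda>x. p x * f x" and ?f2 = "\<lambda>x. (1 - p x) * f x"
  define A where "A = (\<lambda>k l. itg ?f1 k (\<lambda>y. itg ?f2 l (G y)))"
  define m m1 m2 where "m = (\<integral>\<^sup>+x. f x \<partial>\<Lambda>)" and "m1 = (\<integral>\<^sup>+x. ?f1 x \<partial>\<Lambda>)" and "m2 = (\<integral>\<^sup>+x. ?f2 x \<partial>\<Lambda>)"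
  have m12: "m = m1 + m2"
    unfolding m_def m1_def m2_def
    by (subst nn_integral_add[symmetric]) (auto simp: ennreal_convex_combination le1)
  then have fin12: "m1 < top" "m2 < top" using fin by (auto simp: m_def)
  have lm: "list_measurable (\<lambda>y. itg ?f2 l (G y))" for l
    by (rule list_measurable_itg[OF _ G]) measurable
  \<comment> \<open>The binomial coefficient turns the weight \<open>1 / fact n\<close> into a
    product of separate weights for the two colours.\<close>
  have eq: "of_nat (n choose k) * a / ennreal (fact n) = a / ennreal (fact k) / ennreal (fact (n - k))"
    if "k \<le> n" for n k a
  proof -
    have "of_nat (n choose k) * a / ennreal (fact n) = a * (ennreal (of_nat (n choose k)) / ennreal (fact n))"
      by (simp add: ennreal_times_divide ennreal_of_nat_eq_real_of_nat mult.commute)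
    also have "ennreal (of_nat (n choose k)) / ennreal (fact n)
        = ennreal (1 / fact k / fact (n - k))"
      using that by (simp add: divide_ennreal binomial_fact)
    also have "a * ennreal (1 / fact k / fact (n - k)) = a / ennreal (fact k) / ennreal (fact (n - k))"
      by (simp add: divide_ennreal_def inverse_ennreal[symmetric] divide_inverse inverse_mult_distrib
          ennreal_mult mult.assoc)
    finally show ?thesis .
  qed
  have "(\<Sum>n. itg f n (split_sum p G) / ennreal (fact n))
      = (\<Sum>n. \<Sum>k\<le>n. A k (n - k) / ennreal (fact k) / ennreal (fact (n - k)))"
  proof (rule suminf_cong)
    fix n
    have "itg f n (split_sum p G) / ennreal (fact n)
        = (\<Sum>k\<le>n. of_nat (n choose k) * A k (n - k) / ennreal (fact n))"
      by (simp add: itg_split_sum G A_def divide_ennreal_def sum_distrib_right)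
    then show "itg f n (split_sum p G) / ennreal (fact n)
        = (\<Sum>k\<le>n. A k (n - k) / ennreal (fact k) / ennreal (fact (n - k)))"
      by (simp add: eq)
  qed
  also have "\<dots> = (\<Sum>k. \<Sum>l. A k l / ennreal (fact k) / ennreal (fact l))"
    by (rule suminf_triangle_ennreal)
  also have "\<dots> = (\<Sum>k. itg ?f1 k (\<lambda>y. \<Sum>l. itg ?f2 l (G y) / ennreal (fact l)) / ennreal (fact k))"
  proof (rule suminf_cong)
    fix k
    have "itg ?f1 k (\<lambda>y. \<Sum>l. itg ?f2 l (G y) / ennreal (fact l))
        = (\<Sum>l. itg ?f1 k (\<lambda>y. inverse (ennreal (fact l)) * itg ?f2 l (G y)))"
      unfolding divide_ennreal_def mult.commute[of "itg _ _ _"]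
      by (rule itg_suminf) (auto intro!: list_measurable_times list_measurable_const lm)
    also have "\<dots> = (\<Sum>l. A k l / ennreal (fact l))"
      unfolding A_def divide_ennreal_def
      by (subst itg_cmult[OF _ lm]) (simp_all add: mult.commute)
    finally show "(\<Sum>l. A k l / ennreal (fact k) / ennreal (fact l))
      = itg ?f1 k (\<lambda>y. \<Sum>l. itg ?f2 l (G y) / ennreal (fact l)) / ennreal (fact k)"
      by (simp add: divide_ennreal_def mult.assoc mult.commute[of "inverse (ennreal (fact k))"]
          flip: ennreal_suminf_multc)
  qed
  finally have 1: "(\<Sum>n. itg f n (split_sum p G) / ennreal (fact n)) =
      (\<Sum>k. itg ?f1 k (\<lambda>y. \<Sum>l. itg ?f2 l (G y) / ennreal (fact l)) / ennreal (fact k))" .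
  have "pois ?f1 (\<lambda>y. pois ?f2 (G y))
      = ennreal (exp (- enn2real m2)) * pois ?f1 (\<lambda>y. \<Sum>l. itg ?f2 l (G y) / ennreal (fact l))"
    unfolding poisson_integral_def[of _ ?f2] m2_def[symmetric]
    by (rule pois_cmult)
       (auto intro!: list_measurable_suminf list_measurable_times lm list_measurable_const simp: divide_ennreal_def)
  also have "\<dots> = ennreal (exp (- enn2real m2)) * (ennreal (exp (- enn2real m1)) *
      (\<Sum>n. itg f n (split_sum p G) / ennreal (fact n)))"
    unfolding poisson_integral_def[of _ ?f1] m1_def[symmetric] 1 ..
  also have "\<dots> = ennreal (exp (- enn2real m)) * (\<Sum>n. itg f n (split_sum p G) / ennreal (fact n))"
    unfolding m12 using fin12
    by (simp add: enn2real_plus mult.commute flip: mult.assoc ennreal_mult exp_add)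
  finally show ?thesis by (simp add: poisson_integral_def m_def)
qed

end

section \<open>Clusters rooted at finitely many points\<close>

lemma explore_Nil [simp]: "explore \<phi> n g [] xs = g 0"
  by (cases n) simp_all

text \<open>Multiplying \<open>(1 - u) * exp u \<le> 1\<close> by \<open>1 + u\<close> gives
  \<open>(1 - u^2) * exp u \<le> 1 + u\<close>.\<close>

lemma exp_le_second_order:
  fixes u :: real
  assumes "0 \<le> u"
  shows "exp u \<le> 1 + u + u\<^sup>2 * exp u"
proof -
  have "1 - u \<le> exp (- u)" using exp_ge_add_one_self[of "-u"] by simp
  then have "exp u * (1 - u) \<le> 1"
    using mult_left_mono[of "1 - u" "exp (- u)" "exp u"] by (simp flip: exp_add)
  then have "(1 + u) * (exp u * (1 - u)) \<le> (1 + u) * 1"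
    using assms by (intro mult_left_mono) auto
  then show ?thesis by (simp add: algebra_simps power2_eq_square)
qed

text \<open>For an increment \<open>u\<close> of at most \<open>c\<close> per new root, with
  \<open>n\<close> new roots. One factor \<open>exp n\<close> dominates half of \<open>n^2\<close>,
  a second one dominates \<open>exp u\<close>. The square of \<open>c\<close> makes the error of
  second order, while the exponential base stays independent of \<open>c\<close>.\<close>

lemma exp_increment_bound:
  fixes u c :: real and n :: nat
  assumes "0 \<le> u" "u \<le> c * real n" "0 \<le> c" "c \<le> 1"
  shows "exp u \<le> 1 + u + 2 * c\<^sup>2 * exp 2 ^ n"
proof -
  have un: "u \<le> real n" using assms mult_right_mono[of c 1 "real n"] by simp
  have "u\<^sup>2 \<le> c\<^sup>2 * (real n)\<^sup>2" using assms power_mono[of u "c * real n" 2] by (simp add: power_mult_distrib)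
  also have "(real n)\<^sup>2 \<le> 2 * exp (real n)"
    using exp_lower_Taylor_quadratic[of "real n"] by simp
  finally have "u\<^sup>2 * exp u \<le> (c\<^sup>2 * (2 * exp (real n))) * exp (real n)"
    using un by (intro mult_mono) (auto simp: mult_left_mono)
  also have "\<dots> = 2 * c\<^sup>2 * exp 2 ^ n"
    by (simp flip: exp_of_nat_mult exp_add)
  finally show ?thesis using exp_le_second_order[OF assms(1)] by linarith
qed

locale connection_kernel = diffuse_measure \<Lambda> for \<Lambda> :: "'a::polish_space measure" +
  fixes \<phi> :: "'a \<Rightarrow> 'a \<Rightarrow> ennreal"
  assumes kernel_measurable: "(\<lambda>(x, y). \<phi> x y) \<in> borel_measurable (borel \<Otimes>\<^sub>M borel)"
    and kernel_sym: "\<phi> x y = \<phi> y x"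
    and kernel_le_1: "\<phi> x y \<le> 1"
begin

text \<open>The intensity \<open>f\<close> is an argument because exploration changes it from step
  to step. The cap \<open>n\<close> makes the exploration a finite recursion and keeps the means
  amenable to induction; it is removed by monotone convergence only at the very end.\<close>

definition cluster_mean :: "nat \<Rightarrow> (nat \<Rightarrow> ennreal) \<Rightarrow> ('a \<Rightarrow> ennreal) \<Rightarrow> 'a list \<Rightarrow> ennreal" where
  "cluster_mean n g f R = pois f (explore \<phi> n g R)"

lemma kernel_section_measurable [measurable]: "\<phi> v \<in> borel_measurable borel"
proof -
  have "(\<lambda>x. (v, x)) \<in> borel \<rightarrow>\<^sub>M borel \<Otimes>\<^sub>M borel" by measurable
  from measurable_compose[OF this kernel_measurable] show ?thesis by simp
qed

lemma list_measurable_pois: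
  assumes "f \<in> borel_measurable borel" "list_measurable2 G"
  shows "list_measurable (\<lambda>R. pois f (G R))"
  unfolding poisson_integral_def divide_ennreal_def
  by (intro list_measurable_times list_measurable_const list_measurable_suminf list_measurable_itg assms)

lemma list_measurable_explore: "list_measurable (explore \<phi> n g R)"
  using list_measurable2_snd[OF list_measurable2_explore[OF kernel_measurable]] .

lemma list_measurable_cluster_mean:
  assumes "f \<in> borel_measurable borel"
  shows "list_measurable (\<lambda>y. cluster_mean n g f (y @ R))"
  unfolding cluster_mean_def
  by (intro list_measurable_pois assms list_measurable2_append list_measurable2_explore kernel_measurable)

lemma borel_measurable_cluster_mean:
  assumes "f \<in> borel_measurable borel"
  shows "(\<lambda>v. cluster_mean n g f [v]) \<in> borel_measurable borel"
  using list_measurableD[OF list_measurable_cluster_mean[OF assms, of _ _ "[]"], of "[\<lambda>x. x]" borel] by simp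

lemma cluster_mean_Nil:
  assumes "f \<in> borel_measurable borel" "(\<integral>\<^sup>+x. f x \<partial>\<Lambda>) < \<infinity>"
  shows "cluster_mean n g f [] = g 0"
proof -
  have "explore \<phi> n g [] = (\<lambda>_. g 0)" by auto
  then show ?thesis by (simp add: cluster_mean_def pois_const[OF assms])
qed

lemma cluster_mean_0:
  assumes "f \<in> borel_measurable borel" "(\<integral>\<^sup>+x. f x \<partial>\<Lambda>) < \<infinity>"
  shows "cluster_mean 0 g f R = g 0"
proof -
  have "explore \<phi> 0 g R = (\<lambda>_. g 0)" by auto
  then show ?thesis by (simp add: cluster_mean_def pois_const[OF assms])
qed

lemma cluster_mean_cmult:
  assumes "f \<in> borel_measurable borel"
  shows "cluster_mean n (\<lambda>k. c * g k) f R = c * cluster_mean n g f R"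
proof -
  have "explore \<phi> n (\<lambda>k. c * g k) R = (\<lambda>xs. c * explore \<phi> n g R xs)"
    by (auto simp: explore_cmult)
  then show ?thesis by (simp add: cluster_mean_def pois_cmult assms list_measurable_explore)
qed

lemma cluster_mean_add:
  assumes "f \<in> borel_measurable borel" "(\<integral>\<^sup>+x. f x \<partial>\<Lambda>) < \<infinity>"
  shows "cluster_mean n (\<lambda>k. c + g k) f R = c + cluster_mean n g f R"
proof -
  have "explore \<phi> n (\<lambda>k. c + g k) R = (\<lambda>xs. c + explore \<phi> n g R xs)"
    by (auto simp: explore_add kernel_le_1)
  then show ?thesis
    by (simp add: cluster_mean_def pois_add pois_const[OF assms] assms(1) list_measurable_explore list_measurable_const)
qed

lemma cluster_mean_le_Suc:
  assumes "mono g"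
  shows "cluster_mean n g f R \<le> cluster_mean (Suc n) g f R"
  unfolding cluster_mean_def by (intro pois_mono explore_le_Suc kernel_le_1 assms)

lemma cluster_mean_Suc:
  assumes "f \<in> borel_measurable borel" "(\<integral>\<^sup>+x. f x \<partial>\<Lambda>) < \<infinity>"
  shows "cluster_mean (Suc n) g f (v # R) =
    pois (\<lambda>x. \<phi> v x * f x) (\<lambda>y. cluster_mean n (\<lambda>k. g (Suc k)) (\<lambda>x. (1 - \<phi> v x) * f x) (y @ R))"
proof -
  have "cluster_mean (Suc n) g f (v # R)
      = pois f (split_sum (\<phi> v) (\<lambda>y z. explore \<phi> n (\<lambda>k. g (Suc k)) (y @ R) z))"
    unfolding cluster_mean_def explore.simps(3)[abs_def] ..
  also have "\<dots> = pois (\<lambda>x. \<phi> v x * f x)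
      (\<lambda>y. pois (\<lambda>x. (1 - \<phi> v x) * f x) (explore \<phi> n (\<lambda>k. g (Suc k)) (y @ R)))"
    by (rule pois_split_sum)
       (use assms kernel_le_1 in \<open>auto intro!: list_measurable2_append list_measurable2_explore kernel_measurable\<close>)
  finally show ?thesis by (simp add: cluster_mean_def)
qed

lemma thinned_integral_le:
  assumes "\<And>x. b x \<le> 1"
  shows "(\<integral>\<^sup>+x. b x * f x \<partial>\<Lambda>) \<le> (\<integral>\<^sup>+x. f x \<partial>\<Lambda>)"
  using assms by (intro nn_integral_mono) (metis mult_1 mult_right_mono zero_le)

lemma thinned_integral_finite:
  assumes "(\<integral>\<^sup>+x. f x \<partial>\<Lambda>) < \<infinity>" "\<And>x. b x \<le> 1"
  shows "(\<integral>\<^sup>+x. b x * f x \<partial>\<Lambda>) < \<infinity>"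
  using thinned_integral_le[of b f] assms by (auto intro: le_less_trans)

text \<open>A coupling: the process of intensity \<open>b * f\<close> is realised as one colour
  class of the process of intensity \<open>f\<close>, and deleting points can only shrink the
  clusters.\<close>

lemma cluster_mean_thinning:
  assumes [measurable]: "f \<in> borel_measurable borel" "b \<in> borel_measurable borel"
    and fin: "(\<integral>\<^sup>+x. f x \<partial>\<Lambda>) < \<infinity>" and b: "\<And>x. b x \<le> 1" and "mono g" "distinct R"
  shows "cluster_mean n g (\<lambda>x. b x * f x) R \<le> cluster_mean n g f R"
proof -
  have fin': "(\<integral>\<^sup>+x. (1 - b x) * f x \<partial>\<Lambda>) < \<infinity>" by (intro thinned_integral_finite fin diff_le_self_ennreal)
  have "list_measurable2 (\<lambda>z. explore \<phi> n g R)"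
    using list_measurable_explore by (simp add: list_measurable_iff_2)
  then have lm: "list_measurable2 (\<lambda>y z. explore \<phi> n g R y)"
    by (rule list_measurable2_swap)
  have "cluster_mean n g (\<lambda>x. b x * f x) R
      = pois (\<lambda>x. b x * f x) (\<lambda>y. pois (\<lambda>x. (1 - b x) * f x) (\<lambda>z. explore \<phi> n g R y))"
    using fin' by (simp add: cluster_mean_def pois_const)
  also have "\<dots> = pois f (split_sum b (\<lambda>y z. explore \<phi> n g R y))"
    by (rule pois_split_sum[symmetric]) (use assms lm in auto)
  also have "\<dots> \<le> pois f (explore \<phi> n g R)"
  \<comment> \<open>Almost surely the points are distinct and differ from the roots, as
    \<open>explore_subset_mono\<close> demands.\<close>
  proof (rule pois_mono_AE[of "\<lambda>_. True" "set R"])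
    fix xs :: "'a list" assume xs: "distinct xs" "set xs \<inter> set R = {}"
    have "split_sum b (\<lambda>y z. explore \<phi> n g R y) xs \<le> split_sum b (\<lambda>y z. explore \<phi> n g R xs) xs"
    proof (rule split_sum_mono)
      fix y z assume m: "mset y + mset z = mset xs"
      then have "set y \<subseteq> set xs" by (metis Un_upper1 set_mset_mset set_mset_union)
      moreover have "distinct y"
      proof -
        have "distinct (y @ z)" using xs(1) m mset_eq_imp_distinct_iff[of "y @ z" xs] by simp
        then show ?thesis by simp
      qed
      ultimately show "explore \<phi> n g R y \<le> explore \<phi> n g R xs"
        using xs assms by (intro explore_subset_mono kernel_sym kernel_le_1) auto
    qed
    then show "split_sum b (\<lambda>y z. explore \<phi> n g R y) xs \<le> explore \<phi> n g R xs"
      by (simp add: split_sum_const b)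
  qed auto
  finally show ?thesis by (simp add: cluster_mean_def)
qed

lemma cluster_mean_root_mono:
  assumes "mono g" "distinct (y @ R)"
  shows "cluster_mean n g f R \<le> cluster_mean n g f (y @ R)"
  unfolding cluster_mean_def
proof (rule pois_mono_AE[of "\<lambda>_. True" "set (y @ R)"])
  fix xs assume "distinct xs" "set xs \<inter> set (y @ R) = {}"
  then show "explore \<phi> n g R xs \<le> explore \<phi> n g (y @ R) xs"
    using assms by (intro explore_subset_mono kernel_sym kernel_le_1) auto
qed auto

lemma mono_of_nat_ennreal: "mono (of_nat :: nat \<Rightarrow> ennreal)"
  by (auto simp: mono_def)

text \<open>The martingale identity: the mean before a step is the counted root plus the average of
  the means after it.\<close>

lemma cluster_mean_size_Suc:
  assumes [measurable]: "f \<in> borel_measurable borel" and fin: "(\<integral>\<^sup>+x. f x \<partial>\<Lambda>) < \<infinity>"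
  shows "cluster_mean (Suc n) of_nat f (v # R) =
    1 + pois (\<lambda>x. \<phi> v x * f x) (\<lambda>y. cluster_mean n of_nat (\<lambda>x. (1 - \<phi> v x) * f x) (y @ R))"
proof -
  have fin1: "(\<integral>\<^sup>+x. \<phi> v x * f x \<partial>\<Lambda>) < \<infinity>"
    by (intro thinned_integral_finite kernel_le_1 fin)
  have fin2: "(\<integral>\<^sup>+x. (1 - \<phi> v x) * f x \<partial>\<Lambda>) < \<infinity>"
    by (intro thinned_integral_finite diff_le_self_ennreal fin)
  have "cluster_mean n (\<lambda>k. of_nat (Suc k)) (\<lambda>x. (1 - \<phi> v x) * f x) R'
      = 1 + cluster_mean n of_nat (\<lambda>x. (1 - \<phi> v x) * f x) R'" for R'
    using cluster_mean_add[of "\<lambda>x. (1 - \<phi> v x) * f x" n 1 of_nat R'] fin2 by simp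
  then show ?thesis
    unfolding cluster_mean_Suc[OF assms]
    using fin1 by (simp add: pois_add list_measurable_const list_measurable_cluster_mean pois_const)
qed

text \<open>The roots in \<open>A\<close> are explored first, and \<open>B\<close> then sees only a
  thinned process. The induction ranges over all lists \<open>A\<close>, so it applies to
  \<open>y @ A'\<close> for every list \<open>y\<close> of new neighbours.\<close>

lemma cluster_mean_subadditive:
  assumes "f \<in> borel_measurable borel" "(\<integral>\<^sup>+x. f x \<partial>\<Lambda>) < \<infinity>" and B: "distinct B"
  shows "cluster_mean n of_nat f (A @ B) \<le> cluster_mean n of_nat f A + cluster_mean n of_nat f B"
  using assms(1,2)
proof (induction n arbitrary: f A)
  case 0
  then show ?case by (simp add: cluster_mean_0)
next
  case (Suc n)
  show ?case
  proof (cases A)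
    case (Cons v A')
    note [measurable] = Suc.prems(1)
    define f1 f2 where "f1 = (\<lambda>x. \<phi> v x * f x)" and "f2 = (\<lambda>x. (1 - \<phi> v x) * f x)"
    have [measurable]: "f1 \<in> borel_measurable borel" "f2 \<in> borel_measurable borel"
      by (simp_all add: f1_def f2_def)
    have fin1: "(\<integral>\<^sup>+x. f1 x \<partial>\<Lambda>) < \<infinity>" unfolding f1_def
    by (intro thinned_integral_finite kernel_le_1 Suc.prems)
    have fin2: "(\<integral>\<^sup>+x. f2 x \<partial>\<Lambda>) < \<infinity>" unfolding f2_def
    by (intro thinned_integral_finite diff_le_self_ennreal Suc.prems)
    have "cluster_mean (Suc n) of_nat f (A @ B) = 1 + pois f1 (\<lambda>y. cluster_mean n of_nat f2 ((y @ A') @ B))"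
      using cluster_mean_size_Suc[OF Suc.prems] by (simp add: Cons f1_def f2_def)
    also have "\<dots> \<le> 1 + pois f1 (\<lambda>y. cluster_mean n of_nat f2 (y @ A') + cluster_mean n of_nat f2 B)"
      by (intro add_left_mono pois_mono Suc.IH fin2) measurable
    also have "\<dots> = 1 + pois f1 (\<lambda>y. cluster_mean n of_nat f2 (y @ A')) + cluster_mean n of_nat f2 B"
      using fin1 by (simp add: pois_add pois_const list_measurable_cluster_mean list_measurable_const add.assoc)
    also have "1 + pois f1 (\<lambda>y. cluster_mean n of_nat f2 (y @ A')) = cluster_mean (Suc n) of_nat f A"
      using cluster_mean_size_Suc[OF Suc.prems] by (simp add: Cons f1_def f2_def)
    \<comment> \<open>Losing the neighbours of \<open>v\<close> is a thinning, so the mean for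
      \<open>B\<close> cannot increase.\<close>
    also have "cluster_mean n of_nat f2 B \<le> cluster_mean n of_nat f B"
      unfolding f2_def
      by (rule cluster_mean_thinning) (use Suc.prems B in \<open>auto simp: mono_of_nat_ennreal diff_le_self_ennreal\<close>)
    also have "\<dots> \<le> cluster_mean (Suc n) of_nat f B"
      by (rule cluster_mean_le_Suc) (rule mono_of_nat_ennreal)
    finally show ?thesis by (simp add: add_left_mono)
  qed (simp add: cluster_mean_Nil Suc.prems)
qed

text \<open>The cluster contains all neighbours of \<open>v\<close>, whose number is Poisson. The
  capped means dominate the partial sums of its mean, and the cap then tends to infinity.\<close>

lemma degree_le_cluster_mean:
  assumes [measurable]: "f \<in> borel_measurable borel" and fin: "(\<integral>\<^sup>+x. f x \<partial>\<Lambda>) < \<infinity>"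
    and bound: "\<And>n. cluster_mean n of_nat f [v] \<le> c"
  shows "(\<integral>\<^sup>+x. \<phi> v x * f x \<partial>\<Lambda>) \<le> c"
proof -
  define f1 f2 where "f1 = (\<lambda>x. \<phi> v x * f x)" and "f2 = (\<lambda>x. (1 - \<phi> v x) * f x)"
  have [measurable]: "f1 \<in> borel_measurable borel" "f2 \<in> borel_measurable borel"
    by (simp_all add: f1_def f2_def)
  have fin1: "(\<integral>\<^sup>+x. f1 x \<partial>\<Lambda>) < \<infinity>" unfolding f1_def
    by (intro thinned_integral_finite kernel_le_1 fin)
  have fin2: "(\<integral>\<^sup>+x. f2 x \<partial>\<Lambda>) < \<infinity>" unfolding f2_def
    by (intro thinned_integral_finite diff_le_self_ennreal fin)
  define m where "m = enn2real (\<integral>\<^sup>+x. f1 x \<partial>\<Lambda>)"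
  have m: "(\<integral>\<^sup>+x. f1 x \<partial>\<Lambda>) = ennreal m" "0 \<le> m" using fin1 by (auto simp: m_def)
  \<comment> \<open>For \<open>j < n\<close> the capped value \<open>min n j\<close> equals
    \<open>j\<close>, so the first \<open>n\<close> terms are not affected by the cap.\<close>
  have partial: "ennreal (exp (- m)) * (\<Sum>j<n. of_nat j * (ennreal m ^ j / ennreal (fact j))) \<le> c" for n
  proof -
    have "(\<Sum>j<n. of_nat j * (ennreal m ^ j / ennreal (fact j)))
        = (\<Sum>j<n. of_nat (min n j) * ennreal m ^ j / ennreal (fact j))"
      by (intro sum.cong) (auto simp: ennreal_times_divide)
    also have "\<dots> \<le> (\<Sum>j. of_nat (min n j) * ennreal m ^ j / ennreal (fact j))"
      by (intro sum_le_suminf) auto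
    finally have "ennreal (exp (- m)) * (\<Sum>j<n. of_nat j * (ennreal m ^ j / ennreal (fact j)))
        \<le> pois f1 (\<lambda>y. of_nat (min n (length y)))"
      unfolding poisson_integral_def m_def[symmetric]
      by (simp add: itg_length[where h = "\<lambda>k. of_nat (min n k)"] m mult_left_mono)
    also have "\<dots> \<le> pois f1 (\<lambda>y. cluster_mean n of_nat f2 (y @ []))"
    proof (rule pois_mono)
      fix y :: "'a list"
      have "of_nat (min n (length y)) = pois f2 (\<lambda>_. of_nat (min n (length y)))"
        using fin2 by (simp add: pois_const)
      also have "\<dots> \<le> cluster_mean n of_nat f2 (y @ [])"
        unfolding cluster_mean_def
        by (rule pois_mono) (simp add: explore_ge_min_length kernel_le_1 del: of_nat_min)
      finally show "of_nat (min n (length y)) \<le> cluster_mean n of_nat f2 (y @ [])" .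
    qed
    also have "\<dots> \<le> cluster_mean (Suc n) of_nat f [v]"
      using cluster_mean_size_Suc[OF assms(1) fin, of n v "[]"] by (simp add: f1_def f2_def)
    also have "\<dots> \<le> c" by (rule bound)
    finally show ?thesis .
  qed
  have exp_term: "of_nat (Suc j) * (ennreal m ^ Suc j / ennreal (fact (Suc j))) = ennreal m * (ennreal m ^ j / ennreal (fact j))" for j
  proof -
    have "of_nat (Suc j) * (ennreal m ^ Suc j / ennreal (fact (Suc j)))
        = ennreal (real (Suc j) * (m ^ Suc j / fact (Suc j)))"
      using m(2) by (simp add: ennreal_power divide_ennreal ennreal_of_nat_eq_real_of_nat del: of_nat_Suc power_Suc fact_Suc flip: ennreal_mult)
    also have "real (Suc j) * (m ^ Suc j / fact (Suc j)) = m * (m ^ j / fact j)"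
      by (simp add: fact_Suc del: of_nat_Suc)
    also have "ennreal \<dots> = ennreal m * (ennreal m ^ j / ennreal (fact j))"
      using m(2) by (simp add: ennreal_power divide_ennreal flip: ennreal_mult)
    finally show ?thesis .
  qed
  have "ennreal (exp (- m)) * (\<Sum>j. of_nat j * (ennreal m ^ j / ennreal (fact j)))
      = (SUP n. ennreal (exp (- m)) * (\<Sum>j<n. of_nat j * (ennreal m ^ j / ennreal (fact j))))"
    by (simp add: suminf_eq_SUP SUP_mult_left_ennreal)
  also have "\<dots> \<le> c" by (rule SUP_least) (rule partial)
  also have "(\<Sum>j. of_nat j * (ennreal m ^ j / ennreal (fact j)))
      = (\<Sum>j. of_nat (Suc j) * (ennreal m ^ Suc j / ennreal (fact (Suc j))))"
    using suminf_offset[OF summableI, of "\<lambda>j. of_nat j * (ennreal m ^ j / ennreal (fact j))" 1] by simp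
  also have "\<dots> = ennreal m * ennreal (exp m)"
    unfolding exp_term by (simp add: exp_series_ennreal m)
  also have "ennreal (exp (- m)) * (ennreal m * ennreal (exp m)) = ennreal m"
    using m(2) by (simp add: mult.commute exp_minus flip: ennreal_mult)
  finally show ?thesis using m by (simp add: f1_def)
qed

end

section \<open>The exponential bound at finite total intensity\<close>

context connection_kernel
begin

text \<open>Subadditivity over the roots, then thinning for each of them. It serves twice: for
  finiteness of the conditional means, and for the bound of \<open>K\<close> per new root on their
  increments.\<close>

lemma cluster_mean_finite:
  assumes "f0 \<in> borel_measurable borel" "(\<integral>\<^sup>+x. f0 x \<partial>\<Lambda>) < \<infinity>"
    and "b \<in> borel_measurable borel" "\<And>x. b x \<le> 1"
    and "distinct R" "\<And>x. x \<in> set R \<Longrightarrow> cluster_mean n of_nat f0 [x] \<le> ennreal K"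
  shows "cluster_mean n of_nat (\<lambda>x. b x * f0 x) R \<le> of_nat (length R) * ennreal K"
  using assms(5,6)
proof (induction R)
  case Nil
  have "(\<integral>\<^sup>+x. b x * f0 x \<partial>\<Lambda>) < \<infinity>"
    by (rule thinned_integral_finite) (use assms in auto)
  then show ?case using assms by (simp add: cluster_mean_Nil)
next
  case (Cons x R)
  have fin: "(\<integral>\<^sup>+x. b x * f0 x \<partial>\<Lambda>) < \<infinity>"
    by (rule thinned_integral_finite) (use assms in auto)
  have "cluster_mean n of_nat (\<lambda>x. b x * f0 x) ([x] @ R)
      \<le> cluster_mean n of_nat (\<lambda>x. b x * f0 x) [x] + cluster_mean n of_nat (\<lambda>x. b x * f0 x) R"
    by (rule cluster_mean_subadditive) (use assms fin Cons in auto)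
  also have "cluster_mean n of_nat (\<lambda>x. b x * f0 x) [x] \<le> cluster_mean n of_nat f0 [x]"
    by (rule cluster_mean_thinning) (use assms in \<open>auto simp: mono_of_nat_ennreal\<close>)
  also have "\<dots> \<le> ennreal K" using Cons by simp
  also have "cluster_mean n of_nat (\<lambda>x. b x * f0 x) R \<le> of_nat (length R) * ennreal K"
    using Cons by simp
  finally show ?case by (simp add: distrib_right add_left_mono add_right_mono)
qed

text \<open>Write \<open>w1\<close> for the mean before a step, \<open>w0\<close> for the mean after
  it without new neighbours, and \<open>X y\<close> for the excess caused by new neighbours
  \<open>y\<close>. Then \<open>0 \<le> X y \<le> K * length y\<close>, and \<open>w1\<close> is at
  least \<open>1 + w0\<close> plus the mean \<open>x0\<close> of \<open>X\<close>. The increment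
  bound gives the factor \<open>1 + \<epsilon> * x0 + \<epsilon>^2 * C\<close>, with
  \<open>C\<close> coming from the Poisson degree of mean at most \<open>K\<close>. Since
  \<open>\<delta> + \<epsilon>^2 * C = \<epsilon>\<close>, the exponents add up to
  \<open>\<epsilon> * (1 + w0 + x0)\<close>.\<close>

theorem exponential_cluster_mean_le:
  fixes \<epsilon> K :: real and f0 :: "'a \<Rightarrow> ennreal"
  assumes f0 [measurable]: "f0 \<in> borel_measurable borel" and fin0: "(\<integral>\<^sup>+x. f0 x \<partial>\<Lambda>) < \<infinity>"
    and good: "AE x in \<Lambda>. \<forall>n. cluster_mean n of_nat f0 [x] \<le> ennreal K"
    and pos: "0 \<le> K" "0 \<le> \<epsilon>" "\<epsilon> * K \<le> 1"
    and C: "C = 2 * K\<^sup>2 * exp ((exp 2 - 1) * K)"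
    and \<delta>: "\<delta> = \<epsilon> - \<epsilon>\<^sup>2 * C" "0 \<le> \<delta>"
  shows "b \<in> borel_measurable borel \<Longrightarrow> (\<And>x. b x \<le> 1) \<Longrightarrow> distinct R \<Longrightarrow>
    (\<And>x. x \<in> set R \<Longrightarrow> (\<forall>n. cluster_mean n of_nat f0 [x] \<le> ennreal K)) \<Longrightarrow>
    cluster_mean n (\<lambda>k. ennreal (exp (\<delta> * real k))) (\<lambda>x. b x * f0 x) R
      \<le> ennreal (exp (\<epsilon> * enn2real (cluster_mean n of_nat (\<lambda>x. b x * f0 x) R)))"
proof (induction n arbitrary: b R)
  case 0
  have "(\<integral>\<^sup>+x. b x * f0 x \<partial>\<Lambda>) < \<infinity>"
    by (rule thinned_integral_finite) (use 0 fin0 in auto)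
  then show ?case using 0 by (simp add: cluster_mean_0)
next
  case (Suc n)
  note [measurable] = Suc.prems(1)
  define f where "f = (\<lambda>x. b x * f0 x)"
  have f [measurable]: "f \<in> borel_measurable borel" by (simp add: f_def)
  have fin: "(\<integral>\<^sup>+x. f x \<partial>\<Lambda>) < \<infinity>"
    unfolding f_def by (intro thinned_integral_finite fin0 Suc.prems)
  show ?case
  proof (cases R)
    case Nil
    then show ?thesis using f fin by (simp add: cluster_mean_Nil flip: f_def)
  next
    case (Cons v R')
    define f1 where "f1 = (\<lambda>x. \<phi> v x * f x)"
    \<comment> \<open>The undiscovered process is again a thinning of the same \<open>f0\<close>, so
      the induction hypothesis applies with the same \<open>K\<close>.\<close>
    define b' where "b' = (\<lambda>x. (1 - \<phi> v x) * b x)"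
    define f2 where "f2 = (\<lambda>x. b' x * f0 x)"
    have f2_eq: "f2 = (\<lambda>x. (1 - \<phi> v x) * f x)" by (simp add: f2_def b'_def f_def mult.assoc)
    have meas [measurable]: "f1 \<in> borel_measurable borel" "f2 \<in> borel_measurable borel"
        "b' \<in> borel_measurable borel"
      by (simp_all add: f1_def f2_def b'_def)
    have b': "b' x \<le> 1" for x
    proof -
      have "(1 - \<phi> v x) * b x \<le> 1 * 1"
        using Suc.prems(2) by (intro mult_mono) (auto simp: diff_le_self_ennreal)
      then show ?thesis by (simp add: b'_def)
    qed
    have fin1: "(\<integral>\<^sup>+x. f1 x \<partial>\<Lambda>) < \<infinity>"
      unfolding f1_def by (intro thinned_integral_finite fin kernel_le_1)
    have R': "distinct R'" "\<And>x. x \<in> set R' \<Longrightarrow> \<forall>n. cluster_mean n of_nat f0 [x] \<le> ennreal K"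
        and v: "\<And>n. cluster_mean n of_nat f0 [v] \<le> ennreal K" "v \<notin> set R'"
      using Suc.prems Cons by auto
    define W where "W = (\<lambda>y. cluster_mean n of_nat f2 (y @ R'))"
    \<comment> \<open>The reference value for centring: the smallest mean after the step, attained
      when no new neighbour appears.\<close>
    define w0 where "w0 = cluster_mean n of_nat f2 R'"
    define w1 where "w1 = cluster_mean (Suc n) of_nat f R"
    have lmW: "list_measurable W" unfolding W_def by (rule list_measurable_cluster_mean) simp
    have lt: "of_nat m * ennreal K < top" for m :: nat
      by (simp add: ennreal_mult_less_top ennreal_of_nat_eq_real_of_nat)
    have w0_fin: "w0 < top" unfolding w0_def f2_def
      by (rule le_less_trans[OF cluster_mean_finite[OF f0 fin0 meas(3) b' R'(1)] lt])
         (use R' in auto)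
    have w1_fin: "w1 < top" unfolding w1_def f_def
      by (rule le_less_trans[OF cluster_mean_finite[OF f0 fin0 Suc.prems(1,2,3)] lt])
         (use Suc.prems in auto)
    have w1_eq: "w1 = 1 + pois f1 W"
      unfolding w1_def Cons W_def f1_def f2_eq by (rule cluster_mean_size_Suc[OF f fin])
    define X where "X = (\<lambda>y. W y - w0)"
    have lmX: "list_measurable X"
      unfolding X_def by (intro list_measurable_diff lmW list_measurable_const)
    have bounds: "w0 \<le> W y" "W y \<le> w0 + of_nat (length y) * ennreal K"
      if "distinct y" "set y \<inter> set R' = {}"
        "\<forall>x\<in>set y. \<forall>n. cluster_mean n of_nat f0 [x] \<le> ennreal K" for y
    proof -
      show "w0 \<le> W y" unfolding w0_def W_def
        by (rule cluster_mean_root_mono[OF mono_of_nat_ennreal]) (use that R' in auto)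
      have fin2: "(\<integral>\<^sup>+x. f2 x \<partial>\<Lambda>) < \<infinity>"
        unfolding f2_def by (intro thinned_integral_finite fin0 b')
      have "W y \<le> cluster_mean n of_nat f2 y + w0" unfolding w0_def W_def
        by (rule cluster_mean_subadditive) (use R' fin2 in auto)
      also have "cluster_mean n of_nat f2 y \<le> of_nat (length y) * ennreal K" unfolding f2_def
        by (rule cluster_mean_finite[OF f0 fin0 meas(3) b' that(1)]) (use that in auto)
      finally show "W y \<le> w0 + of_nat (length y) * ennreal K" by (simp add: add.commute)
    qed
    \<comment> \<open>The subtraction in \<open>X\<close> is truncated; \<open>w0 \<le> W y\<close>
      makes it exact for almost every list \<open>y\<close>.\<close>
    have sum_X: "w0 + pois f1 X \<le> pois f1 W"
    proof -
      have "w0 + pois f1 X = pois f1 (\<lambda>y. w0 + X y)"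
        using fin1 by (simp add: pois_add pois_const lmX list_measurable_const)
      also have "\<dots> \<le> pois f1 W"
        by (rule pois_mono_AE[OF good, of "set R'"])
           (auto simp: X_def add_diff_self_ennreal bounds)
      finally show ?thesis .
    qed
    have pX_fin: "pois f1 X < top"
      using sum_X w1_fin unfolding w1_eq
      by (metis ennreal_add_eq_top infinity_ennreal_def less_top top.extremum_uniqueI)
    define x0 where "x0 = enn2real (pois f1 X)"
    \<comment> \<open>Controls the exponential moment of the number of new neighbours, which is
      Poisson with this mean.\<close>
    have deg: "enn2real (\<integral>\<^sup>+x. f1 x \<partial>\<Lambda>) \<le> K"
    proof -
      have "(\<integral>\<^sup>+x. f1 x \<partial>\<Lambda>) \<le> (\<integral>\<^sup>+x. \<phi> v x * f0 x \<partial>\<Lambda>)"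
        unfolding f1_def f_def using thinned_integral_le[of b "\<lambda>x. \<phi> v x * f0 x"] Suc.prems(2)
        by (simp add: mult.left_commute)
      also have "\<dots> \<le> ennreal K" by (rule degree_le_cluster_mean[OF f0 fin0 v(1)])
      finally show ?thesis using pos by (simp add: enn2real_leI)
    qed
    \<comment> \<open>The remainder of \<open>exp_increment_bound\<close> with
      \<open>c = \<epsilon> * K\<close>; this is where \<open>\<epsilon> * K \<le> 1\<close>
      enters.\<close>
    let ?r = "\<lambda>y::'a list. ennreal (2 * (\<epsilon> * K)\<^sup>2) * ennreal (exp 2) ^ length y"
    have lm_r: "list_measurable ?r"
      by (rule list_measurable_comp_length)
    have step: "ennreal (exp (\<epsilon> * enn2real (W y)))
        \<le> ennreal (exp (\<epsilon> * enn2real w0)) * (1 + ennreal \<epsilon> * X y + ?r y)"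
      if y: "distinct y" "set y \<inter> set R' = {}"
        "\<forall>x\<in>set y. \<forall>n. cluster_mean n of_nat f0 [x] \<le> ennreal K" for y
    proof -
      define r0 where "r0 = enn2real w0"
      have r0: "w0 = ennreal r0" "0 \<le> r0" using w0_fin by (auto simp: r0_def)
      define x where "x = enn2real (W y) - r0"
      have up: "of_nat (length y) * ennreal K = ennreal (real (length y) * K)"
        using pos by (simp add: ennreal_mult ennreal_of_nat_eq_real_of_nat)
      have le: "W y \<le> ennreal (r0 + real (length y) * K)"
        using bounds(2)[OF y] pos r0 by (simp add: up)
      have Wfin: "W y < top"
        using le by (rule le_less_trans) simp
      obtain w where w: "W y = ennreal w" "0 \<le> w" using Wfin by (cases "W y") auto
      have x: "W y = ennreal (r0 + x)" "0 \<le> x" "x \<le> real (length y) * K"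
        using bounds(1)[OF y] le r0 pos w
        by (auto simp: x_def ennreal_le_iff simp flip: ennreal_plus)
      have X: "X y = ennreal x"
        unfolding X_def using x r0 by (simp add: ennreal_minus)
      have "\<epsilon> * x \<le> (\<epsilon> * K) * real (length y)"
        using x pos mult_left_mono[of x "real (length y) * K" \<epsilon>] by (simp add: ac_simps)
      then have "exp (\<epsilon> * x) \<le> 1 + \<epsilon> * x + 2 * (\<epsilon> * K)\<^sup>2 * exp 2 ^ length y"
        using x pos by (intro exp_increment_bound) auto
      then have "exp (\<epsilon> * (r0 + x)) \<le> exp (\<epsilon> * r0) * (1 + \<epsilon> * x + 2 * (\<epsilon> * K)\<^sup>2 * exp 2 ^ length y)"
        unfolding distrib_left[of \<epsilon>] exp_add by (rule mult_left_mono) simp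
      then have "ennreal (exp (\<epsilon> * (r0 + x)))
          \<le> ennreal (exp (\<epsilon> * r0) * (1 + \<epsilon> * x + 2 * (\<epsilon> * K)\<^sup>2 * exp 2 ^ length y))"
        by (rule ennreal_leI)
      also have "\<dots> = ennreal (exp (\<epsilon> * r0)) * (1 + ennreal \<epsilon> * ennreal x + ?r y)"
        using x pos by (simp add: ennreal_mult ennreal_plus ennreal_power flip: ennreal_1)
      finally show ?thesis using x(2) r0 by (simp add: X x(1) del: ennreal_plus)
    qed
    have "cluster_mean (Suc n) (\<lambda>k. ennreal (exp (\<delta> * real k))) f R
        = pois f1 (\<lambda>y. cluster_mean n (\<lambda>k. ennreal (exp (\<delta> * real (Suc k)))) f2 (y @ R'))"
      unfolding Cons f1_def f2_eq by (rule cluster_mean_Suc[OF f fin])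
    also have "\<dots> = pois f1 (\<lambda>y. ennreal (exp \<delta>) * cluster_mean n (\<lambda>k. ennreal (exp (\<delta> * real k))) f2 (y @ R'))"
      by (simp add: distrib_left exp_add ennreal_mult flip: cluster_mean_cmult)
    also have "\<dots> \<le> pois f1 (\<lambda>y. ennreal (exp \<delta>) *
        (ennreal (exp (\<epsilon> * enn2real w0)) * (1 + ennreal \<epsilon> * X y + ?r y)))"
    proof (rule pois_mono_AE[OF good, of "set R'"], goal_cases)
      case (2 y)
      have "cluster_mean n (\<lambda>k. ennreal (exp (\<delta> * real k))) f2 (y @ R')
          \<le> ennreal (exp (\<epsilon> * enn2real (W y)))"
        unfolding W_def f2_def
        by (rule Suc.IH[OF meas(3) b']) (use 2 R' in auto)
      also have "\<dots> \<le> ennreal (exp (\<epsilon> * enn2real w0)) * (1 + ennreal \<epsilon> * X y + ?r y)"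
        by (rule step) (use 2 in auto)
      finally show ?case by (rule mult_left_mono) simp
    qed simp
    also have "\<dots> = ennreal (exp \<delta>) * (ennreal (exp (\<epsilon> * enn2real w0)) *
        (1 + ennreal \<epsilon> * pois f1 X + ennreal (2 * (\<epsilon> * K)\<^sup>2) * pois f1 (\<lambda>y. ennreal (exp 2) ^ length y)))"
    proof -
      have l1: "list_measurable (\<lambda>y. ennreal \<epsilon> * X y)"
        by (intro list_measurable_times list_measurable_const lmX)
      have l2: "list_measurable (\<lambda>y. 1 + ennreal \<epsilon> * X y)"
        by (intro list_measurable_add list_measurable_const l1)
      have l3: "list_measurable (\<lambda>y. 1 + ennreal \<epsilon> * X y + ?r y)"
        by (intro list_measurable_add l2 lm_r)
      have l4: "list_measurable (\<lambda>y. ennreal (exp (\<epsilon> * enn2real w0)) * (1 + ennreal \<epsilon> * X y + ?r y))"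
        by (intro list_measurable_times list_measurable_const l3)
      have l5: "list_measurable (\<lambda>y::'a list. ennreal (exp 2) ^ length y)"
        by (rule list_measurable_comp_length)
      have c1: "pois f1 (\<lambda>_. 1) = 1" using fin1 by (simp add: pois_const)
      show ?thesis
        unfolding pois_cmult[OF meas(1) l4] pois_cmult[OF meas(1) l3] pois_add[OF meas(1) l2 lm_r]
          pois_add[OF meas(1) list_measurable_const l1] pois_cmult[OF meas(1) lmX]
          pois_cmult[OF meas(1) l5] c1 ..
    qed
    also have "\<dots> \<le> ennreal (exp \<delta>) * (ennreal (exp (\<epsilon> * enn2real w0)) *
        (1 + ennreal \<epsilon> * ennreal x0 + ennreal (2 * (\<epsilon> * K)\<^sup>2) * ennreal (exp ((exp 2 - 1) * K))))"
    proof (intro mult_left_mono add_mono order_refl)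
      show "pois f1 X \<le> ennreal x0" using pX_fin by (simp add: x0_def)
      have "pois f1 (\<lambda>y. ennreal (exp 2) ^ length y) = ennreal (exp ((exp 2 - 1) * enn2real (\<integral>\<^sup>+x. f1 x \<partial>\<Lambda>)))"
        by (rule pois_power_length) (use fin1 in auto)
      also have "\<dots> \<le> ennreal (exp ((exp 2 - 1) * K))"
        using deg by (intro ennreal_leI) (simp add: mult_left_mono)
      finally show "pois f1 (\<lambda>y. ennreal (exp 2) ^ length y) \<le> ennreal (exp ((exp 2 - 1) * K))" .
    qed simp_all
    also have "\<dots> = ennreal (exp \<delta> * (exp (\<epsilon> * enn2real w0) * (1 + \<epsilon> * x0 + \<epsilon>\<^sup>2 * C)))"
    proof -
      have "\<epsilon>\<^sup>2 * C = 2 * (\<epsilon> * K)\<^sup>2 * exp ((exp 2 - 1) * K)"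
        by (simp add: C power_mult_distrib)
      moreover have "0 \<le> x0" by (simp add: x0_def)
      ultimately show ?thesis
        using pos by (simp add: ennreal_mult ennreal_plus flip: ennreal_1)
    qed
    \<comment> \<open>The supermartingale inequality: the summand 1 in \<open>w1\<close>, from the
      counted root, pays for both \<open>\<delta>\<close> and the second-order error.\<close>
    also have "\<dots> \<le> ennreal (exp (\<epsilon> * enn2real w1))"
    proof (rule ennreal_leI)
      have "1 + (w0 + pois f1 X) \<le> w1" unfolding w1_eq by (intro add_left_mono sum_X)
      then have "1 + (enn2real w0 + x0) \<le> enn2real w1"
        using w0_fin w1_fin pX_fin unfolding x0_def
        by (cases w0; cases w1; cases "pois f1 X") (auto simp flip: ennreal_plus ennreal_1)
      then have *: "\<epsilon> * (1 + (enn2real w0 + x0)) \<le> \<epsilon> * enn2real w1"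
        using pos by (intro mult_left_mono) auto
      have "1 + \<epsilon> * x0 + \<epsilon>\<^sup>2 * C \<le> exp (\<epsilon> * x0 + \<epsilon>\<^sup>2 * C)"
        using exp_ge_add_one_self[of "\<epsilon> * x0 + \<epsilon>\<^sup>2 * C"] by linarith
      then have "exp \<delta> * (exp (\<epsilon> * enn2real w0) * (1 + \<epsilon> * x0 + \<epsilon>\<^sup>2 * C))
          \<le> exp \<delta> * (exp (\<epsilon> * enn2real w0) * exp (\<epsilon> * x0 + \<epsilon>\<^sup>2 * C))"
        by (intro mult_left_mono) auto
      also have "\<dots> = exp (\<epsilon> * (1 + (enn2real w0 + x0)))"
        by (simp add: \<delta> algebra_simps flip: exp_add)
      also have "\<dots> \<le> exp (\<epsilon> * enn2real w1)" using * by simp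
      finally show "exp \<delta> * (exp (\<epsilon> * enn2real w0) * (1 + \<epsilon> * x0 + \<epsilon>\<^sup>2 * C)) \<le> exp (\<epsilon> * enn2real w1)" .
    qed
    finally show ?thesis by (simp add: w1_def f_def)
  qed
qed

end

section \<open>Void probabilities determine a simple point process\<close>

lemma num_points_finite: "finite A \<Longrightarrow> num_points A = of_nat (card A)"
  by (simp add: num_points_def)

lemma num_points_infinite: "infinite A \<Longrightarrow> num_points A = top"
  by (simp add: num_points_def)

lemma num_points_eq_0_iff: "num_points A = 0 \<longleftrightarrow> A = {}"
  by (cases "finite A") (auto simp: num_points_finite num_points_infinite)

lemma of_nat_le_num_points_iff:
  "of_nat k \<le> num_points A \<longleftrightarrow> (\<exists>F\<subseteq>A. finite F \<and> card F = k)"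
proof (cases "finite A")
  case True
  then show ?thesis
    by (auto simp: num_points_finite card_mono intro: obtain_subset_with_card_n)
next
  case False
  then show ?thesis using infinite_arbitrarily_large[OF False, of k]
    by (auto simp: num_points_infinite)
qed

text \<open>Expresses a count through threshold events, so that its measurability follows from that
  of the events of having at least \<open>k\<close> points.\<close>

lemma num_points_eq_SUP:
  "num_points A = (SUP k. if of_nat k \<le> num_points A then of_nat k else 0)"
proof (cases "finite A")
  case True
  have "num_points A \<le> (SUP k. if of_nat k \<le> num_points A then of_nat k else 0)"
    by (rule SUP_upper2[of "card A"]) (simp_all add: num_points_finite True)
  then show ?thesis by (intro antisym SUP_least) auto
qed (simp add: num_points_infinite ennreal_SUP_of_nat_eq_top)

lemma locally_finite_set_subset: "locally_finite_set C \<Longrightarrow> D \<subseteq> C \<Longrightarrow> locally_finite_set D"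
  unfolding locally_finite_set_def by (meson Int_mono finite_subset order_refl)

lemma finite_imp_locally_finite_set: "finite C \<Longrightarrow> locally_finite_set C"
  by (simp add: locally_finite_set_def)

lemma space_configurations: "space configurations = {C. locally_finite_set C}"
  unfolding configurations_def by (rule space_measure_of) auto

definition void_events :: "'a::metric_space set set set" where
  "void_events = {{C. locally_finite_set C \<and> C \<inter> B = {}} | B. B \<in> sets borel}"

lemma void_events_subset: "void_events \<subseteq> Pow {C. locally_finite_set C}"
  by (auto simp: void_events_def)

lemma Int_stable_void_events: "Int_stable void_events"
proof (rule Int_stableI)
  fix X Y :: "'a set set" assume "X \<in> void_events" "Y \<in> void_events"
  then obtain B B' where "X = {C. locally_finite_set C \<and> C \<inter> B = {}}" "B \<in> sets borel"
    "Y = {C. locally_finite_set C \<and> C \<inter> B' = {}}" "B' \<in> sets borel"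
    by (auto simp: void_events_def)
  moreover from this have "X \<inter> Y = {C. locally_finite_set C \<and> C \<inter> (B \<union> B') = {}}"
    by auto
  ultimately show "X \<inter> Y \<in> void_events"
    unfolding void_events_def by blast
qed

lemma countable_separating_open_sets:
  obtains U :: "nat \<Rightarrow> 'a::{second_countable_topology, t1_space} set"
  where "\<And>i. open (U i)" "\<And>x y. x \<noteq> y \<Longrightarrow> \<exists>i. x \<in> U i \<and> y \<notin> U i"
proof -
  obtain \<B> :: "'a set set" where \<B>: "countable \<B>" "topological_basis \<B>"
    using ex_countable_basis by blast
  have sep: "\<exists>V\<in>\<B>. x \<in> V \<and> y \<notin> V" if xy: "x \<noteq> y" for x y
  proof -
    obtain T where "open T" "x \<in> T" "y \<notin> T" using t1_space[OF xy] by blast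
    then show ?thesis using topological_basisE[OF \<B>(2)] by (metis subsetD)
  qed
  show ?thesis
  proof (cases "\<B> = {}")
    case True
    show ?thesis by (rule that[of "\<lambda>_. {}"]) (use sep True in auto)
  next
    case False
    show ?thesis
    proof (rule that[of "from_nat_into \<B>"])
      show "open (from_nat_into \<B> i)" for i
        using from_nat_into[OF False] topological_basis_open[OF \<B>(2)] by blast
      show "\<exists>i. x \<in> from_nat_into \<B> i \<and> y \<notin> from_nat_into \<B> i" if "x \<noteq> y" for x y
        using sep[OF that] from_nat_into_surj[OF \<B>(1)] by metis
    qed
  qed
qed

text \<open>Renyi's observation: a locally finite set is determined, measurably, by the events of
  missing a Borel set, since \<open>k \<ge> 2\<close> points of \<open>B\<close> can be split by a countable separating family
  into two smaller nonempty groups.\<close>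

lemma at_least_points_mem_sigma_void:
  fixes B :: "'a::polish_space set"
  assumes "B \<in> sets borel"
  shows "{C. locally_finite_set C \<and> of_nat k \<le> num_points (C \<inter> B)}
    \<in> sigma_sets {C. locally_finite_set C} void_events"
    (is "?T k B \<in> _")
  using assms
proof (induction k arbitrary: B rule: less_induct)
  case (less k)
  let ?S = "sigma_sets {C. locally_finite_set C} (void_events :: 'a set set set)"
  interpret S: sigma_algebra "{C. locally_finite_set C}" ?S
    by (rule sigma_algebra_sigma_sets) (rule void_events_subset)
  obtain U :: "nat \<Rightarrow> 'a set" where U: "\<And>i. open (U i)"
      and sep: "\<And>x y. x \<noteq> y \<Longrightarrow> \<exists>i. x \<in> U i \<and> y \<notin> U i"
    using countable_separating_open_sets by blast
  consider "k = 0" | "k = 1" | "2 \<le> k" by linarith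
  then show ?case
  proof cases
    case 1
    then show ?thesis using S.top by simp
  next
    case 2
    have "{C. locally_finite_set C \<and> C \<inter> B = {}} \<in> void_events"
      using less.prems by (auto simp: void_events_def)
    then have "{C. locally_finite_set C} - {C. locally_finite_set C \<and> C \<inter> B = {}} \<in> ?S"
      by (intro S.compl_sets sigma_sets.Basic)
    also have "{C. locally_finite_set C} - {C. locally_finite_set C \<and> C \<inter> B = {}} = ?T k B"
      using 2 by (auto simp: of_nat_le_num_points_iff[of "Suc 0", simplified] card_1_singleton_iff)
    finally show ?thesis .
  next
    case 3
    have "?T k B = (\<Union>i. \<Union>a\<in>{1..<k}. ?T a (B \<inter> U i) \<inter> ?T (k - a) (B - U i))"
    proof (intro equalityI subsetI)
      fix C assume "C \<in> ?T k B"
      then obtain F where F: "F \<subseteq> C \<inter> B" "finite F" "card F = k" and C: "locally_finite_set C"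
        by (auto simp: of_nat_le_num_points_iff)
      obtain x y where xy: "x \<in> F" "y \<in> F" "x \<noteq> y"
        using F 3 by (metis card_le_Suc0_iff_eq not_less_eq_eq numeral_2_eq_2)
      obtain i where i: "x \<in> U i" "y \<notin> U i" using sep[OF xy(3)] by blast
      define a where "a = card (F \<inter> U i)"
      have card: "card (F - U i) = k - a" "a \<le> k"
        using F by (auto simp: a_def card_Diff_subset_Int card_mono)
      have "1 \<le> a" unfolding a_def using xy i F by (auto simp: Suc_le_eq card_gt_0_iff)
      moreover have "1 \<le> card (F - U i)" using xy i F by (auto simp: Suc_le_eq card_gt_0_iff)
      ultimately have a: "a \<in> {1..<k}" using card by auto
      have "of_nat a \<le> num_points (C \<inter> (B \<inter> U i))"
        unfolding of_nat_le_num_points_iff a_def using F by (intro exI[of _ "F \<inter> U i"]) auto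
      moreover have "of_nat (k - a) \<le> num_points (C \<inter> (B - U i))"
        unfolding of_nat_le_num_points_iff card(1)[symmetric] using F by (intro exI[of _ "F - U i"]) auto
      ultimately show "C \<in> (\<Union>i. \<Union>a\<in>{1..<k}. ?T a (B \<inter> U i) \<inter> ?T (k - a) (B - U i))"
        using C a by blast
    next
      fix C assume "C \<in> (\<Union>i. \<Union>a\<in>{1..<k}. ?T a (B \<inter> U i) \<inter> ?T (k - a) (B - U i))"
      then obtain i a where a: "a \<in> {1..<k}" and C: "locally_finite_set C"
        and "of_nat a \<le> num_points (C \<inter> (B \<inter> U i))" "of_nat (k - a) \<le> num_points (C \<inter> (B - U i))"
        by blast
      then obtain F F' where F: "F \<subseteq> C \<inter> (B \<inter> U i)" "finite F" "card F = a"
          "F' \<subseteq> C \<inter> (B - U i)" "finite F'" "card F' = k - a"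
        unfolding of_nat_le_num_points_iff by blast
      then have "F \<inter> F' = {}" by auto
      then have "card (F \<union> F') = k" using F a by (simp add: card_Un_disjoint)
      then have "of_nat k \<le> num_points (C \<inter> B)"
        unfolding of_nat_le_num_points_iff using F by (intro exI[of _ "F \<union> F'"]) auto
      then show "C \<in> ?T k B" using C by simp
    qed
    also have "\<dots> \<in> ?S"
    proof -
      have "?T a (B \<inter> U i) \<inter> ?T (k - a) (B - U i) \<in> ?S" if "a \<in> {1..<k}" for i a
        by (intro S.Int less.IH) (use U[of i] less.prems that in auto)
      then have "(\<Union>a\<in>{1..<k}. ?T a (B \<inter> U i) \<inter> ?T (k - a) (B - U i)) \<in> ?S" for i
        by (rule S.finite_UN[OF finite_atLeastLessThan])
      then show ?thesis by (rule S.countable_UN[OF image_subsetI])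
    qed
    finally show ?thesis .
  qed
qed

text \<open>Void events form an intersection-stable generator. Hence they suffice both for checking
  measurability of random sets and for identifying a distribution by Dynkin's lemma.\<close>

lemma sets_configurations:
  "sets (configurations :: 'a::polish_space set measure) = sigma_sets {C. locally_finite_set C} void_events"
proof -
  let ?\<Omega> = "{C::'a set. locally_finite_set C}"
  let ?G = "{{C::'a set. locally_finite_set C \<and> num_points (C \<inter> B) \<in> S} | B S.
          B \<in> sets borel \<and> S \<in> sets borel}"
  have G: "?G \<subseteq> Pow ?\<Omega>" by auto
  have s: "sets (configurations :: 'a set measure) = sigma_sets ?\<Omega> ?G"
    unfolding configurations_def by (rule sets_measure_of[OF G])
  have V: "void_events \<subseteq> ?G"
  proof
    fix X assume "X \<in> (void_events :: 'a set set set)"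
    then obtain B where B: "X = {C. locally_finite_set C \<and> C \<inter> B = {}}" "B \<in> sets borel"
      by (auto simp: void_events_def)
    then have "X = {C. locally_finite_set C \<and> num_points (C \<inter> B) \<in> {0}}"
      by (simp add: num_points_eq_0_iff)
    then show "X \<in> ?G" using B(2) by (intro CollectI exI[of _ B] exI[of _ "{0}"] conjI) simp_all
  qed
  define N :: "'a set measure" where "N = sigma ?\<Omega> void_events"
  have N: "space N = ?\<Omega>" "sets N = sigma_sets ?\<Omega> void_events"
    unfolding N_def by (simp_all add: space_measure_of sets_measure_of void_events_subset)
  have "?G \<subseteq> sigma_sets ?\<Omega> void_events"
  proof
    fix X assume "X \<in> ?G"
    then obtain B S where X: "X = {C. locally_finite_set C \<and> num_points (C \<inter> B) \<in> S}"
      and B: "B \<in> sets borel" and S: "S \<in> sets borel" by blast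
    have "{C \<in> space N. of_nat k \<le> num_points (C \<inter> B)} \<in> sets N" for k
      using at_least_points_mem_sigma_void[OF B, of k] by (simp add: N)
    then have "(\<lambda>C. SUP k. if of_nat k \<le> num_points (C \<inter> B) then of_nat k else (0::ennreal)) \<in> borel_measurable N"
      by (intro borel_measurable_SUP measurable_If_set[of _ N _ "\<lambda>_. _"] measurable_If) auto
    then have "(\<lambda>C. num_points (C \<inter> B)) \<in> borel_measurable N"
      unfolding num_points_eq_SUP[symmetric] .
    then have "(\<lambda>C. num_points (C \<inter> B)) -` S \<inter> space N \<in> sets N"
      using S by (rule measurable_sets)
    also have "(\<lambda>C. num_points (C \<inter> B)) -` S \<inter> space N = X" by (auto simp: X N)
    finally show "X \<in> sigma_sets ?\<Omega> void_events" by (simp add: N)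
  qed
  then have "sigma_sets ?\<Omega> ?G \<subseteq> sigma_sets ?\<Omega> void_events" by (rule sigma_sets_mono)
  moreover have "sigma_sets ?\<Omega> void_events \<subseteq> sigma_sets ?\<Omega> ?G" by (rule sigma_sets_mono'[OF V])
  ultimately show ?thesis unfolding s by (rule antisym)
qed

lemma measurable_configurationsI:
  fixes X :: "'w \<Rightarrow> 'a::polish_space set"
  assumes "\<And>\<omega>. \<omega> \<in> space M \<Longrightarrow> locally_finite_set (X \<omega>)"
    and "\<And>B. B \<in> sets borel \<Longrightarrow> {\<omega> \<in> space M. X \<omega> \<inter> B = {}} \<in> sets M"
  shows "X \<in> M \<rightarrow>\<^sub>M configurations"
proof (rule measurable_sigma_sets[OF sets_configurations void_events_subset])
  show "X \<in> space M \<rightarrow> {C. locally_finite_set C}" using assms(1) by auto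
  fix Y :: "'a set set" assume "Y \<in> void_events"
  then obtain B where B: "Y = {C. locally_finite_set C \<and> C \<inter> B = {}}" "B \<in> sets borel"
    by (auto simp: void_events_def)
  have "X -` Y \<inter> space M = {\<omega> \<in> space M. X \<omega> \<inter> B = {}}" using assms(1) by (auto simp: B)
  then show "X -` Y \<inter> space M \<in> sets M" using assms(2)[OF B(2)] by simp
qed

lemma void_event_measurable:
  fixes B :: "'a::polish_space set"
  assumes "B \<in> sets borel"
  shows "{C \<in> space configurations. C \<inter> B = {}} \<in> sets configurations"
  unfolding sets_configurations space_configurations
  using assms by (auto intro!: sigma_sets.Basic simp: void_events_def)

lemma measurable_num_points:
  fixes B :: "'a::metric_space set"
  assumes "B \<in> sets borel"
  shows "(\<lambda>C. num_points (C \<inter> B)) \<in> borel_measurable configurations"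
proof (rule measurableI)
  fix S :: "ennreal set" assume S: "S \<in> sets borel"
  have "(\<lambda>C. num_points (C \<inter> B)) -` S \<inter> space configurations
      = {C. locally_finite_set C \<and> num_points (C \<inter> B) \<in> S}"
    by (auto simp: space_configurations)
  also have "\<dots> \<in> sets configurations"
    unfolding configurations_def using assms S
    by (subst sets_measure_of) (auto intro!: sigma_sets.Basic)
  finally show "(\<lambda>C. num_points (C \<inter> B)) -` S \<inter> space configurations \<in> sets configurations" .
qed simp

lemma measurable_window [measurable]:
  fixes W :: "'a::polish_space set"
  assumes "W \<in> sets borel"
  shows "(\<lambda>C. C \<inter> W) \<in> configurations \<rightarrow>\<^sub>M configurations"
proof (rule measurable_configurationsI)
  fix C :: "'a set" assume "C \<in> space configurations"
  then show "locally_finite_set (C \<inter> W)"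
    by (auto simp: space_configurations intro: locally_finite_set_subset)
next
  fix B :: "'a set" assume "B \<in> sets borel"
  then show "{C \<in> space configurations. C \<inter> W \<inter> B = {}} \<in> sets configurations"
    using void_event_measurable[of "W \<inter> B"] assms by (simp add: Int_assoc)
qed

lemma list_measurable_set:
  fixes F :: "'a::polish_space set \<Rightarrow> ennreal"
  assumes "F \<in> borel_measurable configurations"
  shows "list_measurable (\<lambda>l. F (set l))"
  unfolding list_measurable_def
proof
  fix "is" :: "nat list"
  let ?P = "Pi\<^sub>M UNIV (\<lambda>_::nat. borel) :: (nat \<Rightarrow> 'a) measure"
  have "(\<lambda>x. set (map x is)) \<in> ?P \<rightarrow>\<^sub>M configurations"
  proof (rule measurable_configurationsI)
    fix B :: "'a set" assume [measurable]: "B \<in> sets borel"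
    have "{x \<in> space ?P. \<forall>i\<in>set is. x i \<notin> B} \<in> sets ?P" by measurable
    also have "{x \<in> space ?P. \<forall>i\<in>set is. x i \<notin> B} = {x \<in> space ?P. set (map x is) \<inter> B = {}}" by auto
    finally show "{x \<in> space ?P. set (map x is) \<inter> B = {}} \<in> sets ?P" .
  qed (simp add: finite_imp_locally_finite_set)
  from measurable_compose[OF this assms] show "(\<lambda>x. F (set (map x is))) \<in> borel_measurable ?P" .
qed

section \<open>The Poisson integral as the law of a random set\<close>

context diffuse_measure
begin

lemma itg_SUP:
  assumes [measurable]: "f \<in> borel_measurable borel"
  shows "(\<And>i. list_measurable (F i)) \<Longrightarrow> incseq F \<Longrightarrow> itg f n (\<lambda>l. SUP i. F i l) = (SUP i. itg f n (F i))"
proof (induction n arbitrary: F)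
  case (Suc n)
  have [measurable]: "(\<lambda>x. itg f n (\<lambda>l. F i (x # l))) \<in> borel_measurable borel" for i
    by (rule measurable_itg_Cons[OF assms Suc.prems(1)])
  have inc: "incseq (\<lambda>i. \<lambda>l. F i (x # l))" for x
    by (intro monoI le_funI) (rule le_funD[OF monoD[OF Suc.prems(2)]])
  have mono: "itg f n (\<lambda>l. F i (x # l)) \<le> itg f n (\<lambda>l. F j (x # l))" if "i \<le> j" for i j x
    using le_funD[OF monoD[OF Suc.prems(2) that]] by (intro itg_mono_AE[of "\<lambda>_. True" "{}"]) auto
  have "itg f (Suc n) (\<lambda>l. SUP i. F i l) = (\<integral>\<^sup>+x. (SUP i. f x * itg f n (\<lambda>l. F i (x # l))) \<partial>\<Lambda>)"
    by (simp add: Suc.IH[OF _ inc] Suc.prems list_measurable_Cons SUP_mult_left_ennreal)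
  also have "\<dots> = (SUP i. \<integral>\<^sup>+x. f x * itg f n (\<lambda>l. F i (x # l)) \<partial>\<Lambda>)"
    by (rule nn_integral_monotone_convergence_SUP)
       (auto simp: incseq_def le_fun_def intro!: mult_left_mono mono)
  finally show ?case by simp
qed simp

lemma pois_SUP:
  assumes "f \<in> borel_measurable borel" "\<And>i. list_measurable (F i)" "incseq F"
  shows "pois f (\<lambda>l. SUP i. F i l) = (SUP i. pois f (F i))"
proof -
  have mono: "itg f n (F i) \<le> itg f n (F j)" if "i \<le> j" for i j n
    using le_funD[OF monoD[OF assms(3) that]] by (intro itg_mono_AE[of "\<lambda>_. True" "{}"]) auto
  have "(\<Sum>n. itg f n (\<lambda>l. SUP i. F i l) / ennreal (fact n))
      = (\<Sum>n. SUP i. itg f n (F i) / ennreal (fact n))"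
    by (simp add: itg_SUP assms divide_ennreal_def SUP_mult_right_ennreal)
  also have "\<dots> = (SUP i. \<Sum>n. itg f n (F i) / ennreal (fact n))"
    by (rule ennreal_suminf_SUP_eq) (auto simp: incseq_def intro!: divide_right_mono_ennreal mono)
  finally show ?thesis by (simp add: poisson_integral_def SUP_mult_left_ennreal)
qed

lemma pois_suminf:
  assumes "f \<in> borel_measurable borel" "\<And>i. list_measurable (F i)"
  shows "pois f (\<lambda>l. \<Sum>i. F i l) = (\<Sum>i. pois f (F i))"
proof -
  have *: "pois f (\<lambda>l. \<Sum>i<n. F i l) = (\<Sum>i<n. pois f (F i))" for n
  proof (induction n)
    case 0
    show ?case using pois_cmult[OF assms(1) list_measurable_const, of 0 0] by simp
  next
    case (Suc n)
    then show ?case using assms by (simp add: pois_add list_measurable_sum)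
  qed
  have "pois f (\<lambda>l. \<Sum>i. F i l) = (SUP n. pois f (\<lambda>l. \<Sum>i<n. F i l))"
    unfolding suminf_eq_SUP
    by (rule pois_SUP) (auto simp: incseq_def le_fun_def assms list_measurable_sum intro!: sum_mono2)
  then show ?thesis by (simp add: * suminf_eq_SUP)
qed

text \<open>The indicator of missing \<open>B\<close> is a product over the points, so it replaces
  \<open>f\<close> by its restriction to the complement of \<open>B\<close> in every iterated
  integral; the series is then an exponential.\<close>

lemma pois_void:
  assumes [measurable]: "f \<in> borel_measurable borel" "B \<in> sets borel" and fin: "(\<integral>\<^sup>+x. f x \<partial>\<Lambda>) < \<infinity>"
  shows "pois f (\<lambda>l. indicator {C. locally_finite_set C \<and> C \<inter> B = {}} (set l))
    = ennreal (exp (- enn2real (\<integral>\<^sup>+x. f x * indicator B x \<partial>\<Lambda>)))"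
proof -
  let ?I = "\<lambda>l::'a list. indicator {C. locally_finite_set C \<and> C \<inter> B = {}} (set l) :: ennreal"
  let ?m = "\<integral>\<^sup>+x. f x * indicator (-B) x \<partial>\<Lambda>" and ?b = "\<integral>\<^sup>+x. f x * indicator B x \<partial>\<Lambda>"
  have I: "indicator {C. locally_finite_set C \<and> C \<inter> B = {}} (insert x (set l)) = indicator (-B) x * ?I l" for x l
    by (auto simp: finite_imp_locally_finite_set split: split_indicator)
  have lm: "list_measurable ?I"
  proof (rule list_measurable_set[of "indicator {C. locally_finite_set C \<and> C \<inter> B = {}}"])
    show "indicator {C. locally_finite_set C \<and> C \<inter> B = {}} \<in> borel_measurable configurations"
      using void_event_measurable[of B] by (simp add: space_configurations borel_measurable_indicator)
  qed
  have itg: "itg f n ?I = ?m ^ n" for n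
  proof (induction n)
    case 0
    then show ?case by (simp add: finite_imp_locally_finite_set)
  next
    case (Suc n)
    have "itg f (Suc n) ?I = (\<integral>\<^sup>+x. f x * (indicator (-B) x * itg f n ?I) \<partial>\<Lambda>)"
      by (simp add: I itg_cmult lm)
    also have "\<dots> = ?m * itg f n ?I"
      by (subst nn_integral_multc[symmetric]) (auto simp: mult.assoc)
    finally show ?case using Suc by simp
  qed
  have "?b + ?m = (\<integral>\<^sup>+x. f x \<partial>\<Lambda>)"
    by (subst nn_integral_add[symmetric]) (auto intro!: nn_integral_cong split: split_indicator)
  moreover from this have "?b < top" "?m < top" using fin by (metis ennreal_add_eq_top infinity_ennreal_def less_top)+
  ultimately have e: "enn2real (\<integral>\<^sup>+x. f x \<partial>\<Lambda>) = enn2real ?b + enn2real ?m" and m: "?m = ennreal (enn2real ?m)"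
    by (auto simp flip: enn2real_plus)
  have "pois f ?I = ennreal (exp (- enn2real ?b - enn2real ?m)) * (\<Sum>n. ennreal (enn2real ?m) ^ n / ennreal (fact n))"
    unfolding poisson_integral_def itg e m[symmetric] by simp
  also have "\<dots> = ennreal (exp (- enn2real ?b))"
    by (simp add: exp_series_ennreal flip: ennreal_mult exp_add)
  finally show ?thesis .
qed

text \<open>Both sides agree on void events by assumption, hence on all measurable events by
  Dynkin's lemma, hence on nonnegative functions by the usual approximation. It turns expectations
  over the abstract process into explicit integrals.\<close>

lemma nn_integral_eq_pois:
  assumes f: "f \<in> borel_measurable borel" and fin: "(\<integral>\<^sup>+x. f x \<partial>\<Lambda>) < \<infinity>"
    and "prob_space M" and N [measurable]: "N \<in> M \<rightarrow>\<^sub>M configurations"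
    and void: "\<And>B. B \<in> sets borel \<Longrightarrow> measure M {\<omega> \<in> space M. N \<omega> \<inter> B = {}}
      = exp (- enn2real (\<integral>\<^sup>+x. f x * indicator B x \<partial>\<Lambda>))"
    and F: "F \<in> borel_measurable configurations"
  shows "(\<integral>\<^sup>+\<omega>. F (N \<omega>) \<partial>M) = pois f (\<lambda>l. F (set l))"
proof -
  interpret prob_space M by fact
  let ?\<Omega> = "{C::'a set. locally_finite_set C}"
  have lm: "list_measurable (\<lambda>l. indicator A (set l))" if "A \<in> sets configurations" for A :: "'a set set"
    using that by (intro list_measurable_set[of "indicator A"] borel_measurable_indicator)
  have ind: "(\<integral>\<^sup>+\<omega>. indicator A (N \<omega>) \<partial>M) = pois f (\<lambda>l. indicator A (set l))"
    if "A \<in> sets configurations" for A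
    using Int_stable_void_events void_events_subset that[unfolded sets_configurations]
  proof (induction A rule: sigma_sets_induct_disjoint)
    case (basic A)
    then obtain B where B: "A = {C. locally_finite_set C \<and> C \<inter> B = {}}" "B \<in> sets borel"
      by (auto simp: void_events_def)
    have A: "A \<in> sets configurations" using basic by (simp add: sets_configurations sigma_sets.Basic)
    have "(\<integral>\<^sup>+\<omega>. indicator A (N \<omega>) \<partial>M) = (\<integral>\<^sup>+\<omega>. indicator (N -` A \<inter> space M) \<omega> \<partial>M)"
      by (intro nn_integral_cong) (simp split: split_indicator)
    also have "\<dots> = emeasure M (N -` A \<inter> space M)"
      by (rule nn_integral_indicator[OF measurable_sets[OF N A]])
    also have "N -` A \<inter> space M = {\<omega> \<in> space M. N \<omega> \<inter> B = {}}"
      using measurable_space[OF N] by (auto simp: B space_configurations)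
    also have "emeasure M \<dots> = pois f (\<lambda>l. indicator A (set l))"
      using void[OF B(2)] pois_void[OF f B(2) fin] by (simp add: B emeasure_eq_measure)
    finally show ?case .
  next
    case empty
    show ?case using pois_const[OF f fin, of 0] by simp
  next
    case (compl A)
    then have A: "A \<in> sets configurations" by (simp add: sets_configurations)
    then have A': "?\<Omega> - A \<in> sets configurations"
      using sets.compl_sets[OF A] by (simp add: space_configurations)
    have "(\<integral>\<^sup>+\<omega>. indicator A (N \<omega>) \<partial>M) + (\<integral>\<^sup>+\<omega>. indicator (?\<Omega> - A) (N \<omega>) \<partial>M) = (\<integral>\<^sup>+\<omega>. 1 \<partial>M)"
    proof -
      have "(\<integral>\<^sup>+\<omega>. indicator A (N \<omega>) \<partial>M) + (\<integral>\<^sup>+\<omega>. indicator (?\<Omega> - A) (N \<omega>) \<partial>M)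
          = (\<integral>\<^sup>+\<omega>. indicator A (N \<omega>) + indicator (?\<Omega> - A) (N \<omega>) \<partial>M)"
        using A A' by (subst nn_integral_add) auto
      also have "\<dots> = (\<integral>\<^sup>+\<omega>. 1 \<partial>M)"
        using measurable_space[OF N]
        by (intro nn_integral_cong) (auto simp: space_configurations split: split_indicator)
      finally show ?thesis .
    qed
    also have "\<dots> = 1" by (simp add: emeasure_space_1)
    also have "\<dots> = pois f (\<lambda>_. 1)" using fin by (simp add: pois_const[OF f])
    also have "\<dots> = pois f (\<lambda>l. indicator A (set l) + indicator (?\<Omega> - A) (set l))"
      by (rule arg_cong[where f = "pois f"])
         (auto simp: finite_imp_locally_finite_set fun_eq_iff split: split_indicator)
    also have "\<dots> = pois f (\<lambda>l. indicator A (set l)) + pois f (\<lambda>l. indicator (?\<Omega> - A) (set l))"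
      by (intro pois_add f lm A A')
    finally have eq: "(\<integral>\<^sup>+\<omega>. indicator A (N \<omega>) \<partial>M) + (\<integral>\<^sup>+\<omega>. indicator (?\<Omega> - A) (N \<omega>) \<partial>M)
      = (\<integral>\<^sup>+\<omega>. indicator A (N \<omega>) \<partial>M) + pois f (\<lambda>l. indicator (?\<Omega> - A) (set l))"
      by (simp only: compl.IH)
    have "(\<integral>\<^sup>+\<omega>. indicator A (N \<omega>) \<partial>M) \<le> (\<integral>\<^sup>+\<omega>. 1 \<partial>M)"
      by (intro nn_integral_mono) (auto split: split_indicator)
    then have "(\<integral>\<^sup>+\<omega>. indicator A (N \<omega>) \<partial>M) \<noteq> top"
      by (auto simp: emeasure_space_1 top_unique)
    then show ?case using eq by (simp add: ennreal_add_left_cancel)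
  next
    case (union A)
    then have A: "A i \<in> sets configurations" for i by (auto simp: sets_configurations)
    have i: "indicator (\<Union>i. A i) C = (\<Sum>i. indicator (A i) C :: ennreal)" for C
      by (rule suminf_indicator[OF union(1), symmetric])
    show ?case unfolding i using A
      by (subst nn_integral_suminf) (auto simp: pois_suminf[OF f lm] union.IH)
  qed
  show ?thesis using F
  proof (induction F rule: borel_measurable_induct)
    case (cong F G)
    have "(\<integral>\<^sup>+\<omega>. F (N \<omega>) \<partial>M) = (\<integral>\<^sup>+\<omega>. G (N \<omega>) \<partial>M)"
      using cong(3) measurable_space[OF N] by (intro nn_integral_cong) auto
    moreover have "F (set l) = G (set l)" for l :: "'a list"
      using cong(3) by (simp add: space_configurations finite_imp_locally_finite_set)
    ultimately show ?case using cong by simp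
  next
    case (set A)
    then show ?case by (rule ind)
  next
    case (mult F c)
    note [measurable] = mult(2)
    show ?case using mult by (simp add: nn_integral_cmult pois_cmult f list_measurable_set)
  next
    case (add F G)
    note [measurable] = add(1,4)
    show ?case using add by (simp add: nn_integral_add pois_add f list_measurable_set)
  next
    case (seq U)
    note [measurable] = seq(1)
    have "(\<integral>\<^sup>+\<omega>. (SUP i. U i (N \<omega>)) \<partial>M) = (SUP i. \<integral>\<^sup>+\<omega>. U i (N \<omega>) \<partial>M)"
      using seq(3) by (intro nn_integral_monotone_convergence_SUP) (auto simp: incseq_def le_fun_def)
    also have "\<dots> = (SUP i. pois f (\<lambda>l. U i (set l)))" using seq by simp
    also have "\<dots> = pois f (\<lambda>l. SUP i. U i (set l))"
      using seq(3) by (intro pois_SUP[symmetric] f list_measurable_set seq(1)) (auto simp: incseq_def le_fun_def)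
    finally show ?case by (simp add: SUP_apply image_comp)
  qed
qed

end

section \<open>From random connection models to finite random graphs\<close>

text \<open>For cutting along countably many values of a random index set. Measurability of
  \<open>h\<close> is a conclusion, because for cluster sizes it is only known piece by
  piece.\<close>

lemma nn_integral_countable_partition:
  fixes h :: "'w \<Rightarrow> ennreal" and A :: "nat \<Rightarrow> 'w set"
  assumes "disjoint_family A"
    and out: "\<And>\<omega>. \<omega> \<in> space M \<Longrightarrow> \<omega> \<notin> (\<Union>k. A k) \<Longrightarrow> h \<omega> = 0"
    and meas: "\<And>k. (\<lambda>\<omega>. h \<omega> * indicator (A k) \<omega>) \<in> borel_measurable M"
  shows borel_measurable_countable_partition: "h \<in> borel_measurable M"
    and "(\<integral>\<^sup>+\<omega>. h \<omega> \<partial>M) = (\<Sum>k. \<integral>\<^sup>+\<omega>. h \<omega> * indicator (A k) \<omega> \<partial>M)"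
proof -
  have eq: "h \<omega> = (\<Sum>k. h \<omega> * indicator (A k) \<omega>)" if "\<omega> \<in> space M" for \<omega>
  proof -
    have "(\<Sum>k. indicator (A k) \<omega>) = (indicator (\<Union>k. A k) \<omega> :: ennreal)"
      by (rule suminf_indicator) fact
    then show ?thesis using out[OF that] by (simp split: split_indicator_asm add: ennreal_suminf_cmult)
  qed
  have "(\<lambda>\<omega>. \<Sum>k. h \<omega> * indicator (A k) \<omega>) \<in> borel_measurable M"
    using meas by (rule borel_measurable_suminf_order)
  then show "h \<in> borel_measurable M"
    by (rule measurable_cong[THEN iffD2, rotated]) (rule eq)
  have "(\<integral>\<^sup>+\<omega>. h \<omega> \<partial>M) = (\<integral>\<^sup>+\<omega>. (\<Sum>k. h \<omega> * indicator (A k) \<omega>) \<partial>M)"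
    by (intro nn_integral_cong eq)
  also have "\<dots> = (\<Sum>k. \<integral>\<^sup>+\<omega>. h \<omega> * indicator (A k) \<omega> \<partial>M)"
    using meas by (rule nn_integral_suminf)
  finally show "(\<integral>\<^sup>+\<omega>. h \<omega> \<partial>M) = (\<Sum>k. \<integral>\<^sup>+\<omega>. h \<omega> * indicator (A k) \<omega> \<partial>M)" .
qed

text \<open>The model prescribes conditional probabilities for edges being present. Absent edges are
  added one at a time: the pattern without \<open>e\<close> is the pattern ignoring \<open>e\<close>
  minus the pattern containing \<open>e\<close>.\<close>

lemma pattern_probability:
  fixes J :: "'e \<Rightarrow> 'w set" and p :: "'e \<Rightarrow> 'w \<Rightarrow> real"
  assumes "prob_space M" and sub: "subalgebra M F"
    and J: "\<And>e. e \<in> D \<Longrightarrow> J e \<in> sets M"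
    and p [measurable]: "\<And>e. e \<in> D \<Longrightarrow> p e \<in> borel_measurable M" and p01: "\<And>e \<omega>. 0 \<le> p e \<omega> \<and> p e \<omega> \<le> 1"
    and cond: "\<And>S. finite S \<Longrightarrow> S \<subseteq> D \<Longrightarrow>
      AE \<omega> in M. real_cond_exp M F (indicator (space M \<inter> (\<Inter>e\<in>S. J e))) \<omega> = (\<Prod>e\<in>S. p e \<omega>)"
    and A: "A \<in> sets F"
  shows "finite N \<Longrightarrow> finite S \<Longrightarrow> S \<inter> N = {} \<Longrightarrow> S \<union> N \<subseteq> D \<Longrightarrow>
    measure M {\<omega> \<in> A. (\<forall>e\<in>S. \<omega> \<in> J e) \<and> (\<forall>e\<in>N. \<omega> \<notin> J e)}
      = (\<integral>\<omega>. indicator A \<omega> * ((\<Prod>e\<in>S. p e \<omega>) * (\<Prod>e\<in>N. 1 - p e \<omega>)) \<partial>M)"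
proof (induction N arbitrary: S rule: finite_induct)
  case empty
  interpret prob_space M by fact
  interpret finite_measure_subalgebra M F
    using sub by unfold_locales
  have AM: "A \<in> sets M" using A sub by (auto simp: subalgebra_def)
  have [measurable]: "space M \<inter> (\<Inter>e\<in>S. J e) \<in> sets M"
  proof (cases "S = {}")
    case False
    then show ?thesis using empty J by (intro sets.Int sets.finite_INT) auto
  qed simp
  have int: "integrable M (indicator (space M \<inter> (\<Inter>e\<in>S. J e)) :: 'w \<Rightarrow> real)"
    by (rule integrable_real_indicator) (auto simp: emeasure_eq_measure)
  have "measure M {\<omega> \<in> A. (\<forall>e\<in>S. \<omega> \<in> J e) \<and> (\<forall>e\<in>{}. \<omega> \<notin> J e)}
      = measure M (A \<inter> (space M \<inter> (\<Inter>e\<in>S. J e)))"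
    using sets.sets_into_space[OF AM] by (intro arg_cong[where f = "measure M"]) auto
  also have "\<dots> = (\<integral>\<omega>\<in>A. indicator (space M \<inter> (\<Inter>e\<in>S. J e)) \<omega> \<partial>M)"
    using AM by (simp add: set_lebesgue_integral_def flip: indicator_inter_arith)
  also have "\<dots> = (\<integral>\<omega>\<in>A. real_cond_exp M F (indicator (space M \<inter> (\<Inter>e\<in>S. J e))) \<omega> \<partial>M)"
    by (rule real_cond_exp_intA[OF int A])
  also have "\<dots> = (\<integral>\<omega>\<in>A. (\<Prod>e\<in>S. p e \<omega>) \<partial>M)"
  proof -
    have [measurable]: "(\<lambda>\<omega>. \<Prod>e\<in>S. p e \<omega>) \<in> borel_measurable M"
      using empty p by (intro borel_measurable_prod) auto
    have "AE \<omega> in M. real_cond_exp M F (indicator (space M \<inter> (\<Inter>e\<in>S. J e))) \<omega> = (\<Prod>e\<in>S. p e \<omega>)"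
      using empty cond by auto
    then show ?thesis unfolding set_lebesgue_integral_def
      using AM by (intro integral_cong_AE) auto
  qed
  finally show ?case by (simp add: set_lebesgue_integral_def)
next
  case (insert e N)
  interpret prob_space M by fact
  have AM [measurable]: "A \<in> sets M" using A sub by (auto simp: subalgebra_def)
  let ?E = "\<lambda>S N. {\<omega> \<in> A. (\<forall>e\<in>S. \<omega> \<in> J e) \<and> (\<forall>e\<in>N. \<omega> \<notin> J e)}"
  let ?w = "\<lambda>S N \<omega>. indicator A \<omega> * ((\<Prod>e\<in>S. p e \<omega>) * (\<Prod>e\<in>N. 1 - p e \<omega>))"
  have ev: "?E S N \<in> sets M" if "finite S" "finite N" "S \<union> N \<subseteq> D" for S N
  proof -
    have "?E S N = A - ((\<Union>e\<in>S. A - J e) \<union> (\<Union>e\<in>N. J e))" by auto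
    moreover have "A - ((\<Union>e\<in>S. A - J e) \<union> (\<Union>e\<in>N. J e)) \<in> sets M"
      using that J by (intro sets.Diff sets.Un sets.finite_UN AM) auto
    ultimately show ?thesis by simp
  qed
  have int: "integrable M (?w S N)" if "finite S" "finite N" "S \<union> N \<subseteq> D" for S N
  proof (rule integrable_const_bound[where B = 1])
    have "0 \<le> (\<Prod>e\<in>S. p e \<omega>)" "(\<Prod>e\<in>S. p e \<omega>) \<le> 1"
      "0 \<le> (\<Prod>e\<in>N. 1 - p e \<omega>)" "(\<Prod>e\<in>N. 1 - p e \<omega>) \<le> 1" for \<omega>
      using p01 by (auto intro!: prod_nonneg prod_le_1)
    then have "0 \<le> (\<Prod>e\<in>S. p e \<omega>) * (\<Prod>e\<in>N. 1 - p e \<omega>) \<and> (\<Prod>e\<in>S. p e \<omega>) * (\<Prod>e\<in>N. 1 - p e \<omega>) \<le> 1" for \<omega>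
      by (intro conjI mult_nonneg_nonneg mult_le_one) auto
    then show "AE \<omega> in M. norm (?w S N \<omega>) \<le> 1"
      by (intro AE_I2) (auto split: split_indicator)
    show "?w S N \<in> borel_measurable M"
      using that p by (intro borel_measurable_times borel_measurable_prod borel_measurable_diff
          borel_measurable_indicator AM) auto
  qed
  have e: "e \<notin> S" "e \<in> D" using insert by auto
  have "measure M (?E S (insert e N)) = measure M (?E S N - ?E (insert e S) N)"
    by (rule arg_cong[where f = "measure M"]) auto
  also have "\<dots> = measure M (?E S N) - measure M (?E (insert e S) N)"
    using insert e by (intro finite_measure_Diff ev) auto
  also have "\<dots> = (\<integral>\<omega>. ?w S N \<omega> \<partial>M) - (\<integral>\<omega>. ?w (insert e S) N \<omega> \<partial>M)"
    using insert e by (intro arg_cong2[where f = "(-)"] insert.IH) auto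
  also have "\<dots> = (\<integral>\<omega>. ?w S N \<omega> - ?w (insert e S) N \<omega> \<partial>M)"
    using insert e by (intro Bochner_Integration.integral_diff[symmetric] int) auto
  also have "\<dots> = (\<integral>\<omega>. ?w S (insert e N) \<omega> \<partial>M)"
    using insert e by (intro Bochner_Integration.integral_cong refl) (simp add: algebra_simps)
  finally show ?case .
qed

text \<open>Invariance under relabelling of the vertices, used to pass between points and their
  indices in the enumeration.\<close>

lemma cluster_image:
  assumes inj: "inj_on h I" and T: "T \<subseteq> vertex_pairs I" and i: "i \<in> I"
  shows "cluster ((\<lambda>e. h ` e) ` T) (h i) = h ` cluster T i"
proof -
  have sub: "reach T {i} \<subseteq> I" by (rule reach_subset[OF T]) (use i in simp)
  have "y \<in> h ` reach T {i}" if "y \<in> reach ((\<lambda>e. h ` e) ` T) {h i}" for y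
    using that
  proof (induction rule: reach_induct)
    case (base x)
    have "i \<in> reach T {i}" by (rule reach_base) simp
    then show ?case using base by blast
  next
    case (step x y)
    obtain a where a: "x = h a" "a \<in> reach T {i}" using step.IH by auto
    obtain e where e: "{x, y} = h ` e" "e \<in> T" using step.hyps by auto
    then have eI: "e \<subseteq> I" using T by (auto simp: vertex_pairs_def)
    obtain a' where "a' \<in> e" "x = h a'" using e by (metis imageE insertI1)
    then have ae: "a \<in> e" using inj eI sub a by (metis inj_onD subsetD)
    have "card e = 2" using e T by (auto simp: vertex_pairs_def)
    then obtain b where b: "e = {a, b}" using ae by (auto simp: card_2_iff)
    then have "y = h b" using e(1) a(1) by (auto simp: doubleton_eq_iff)
    moreover have "b \<in> reach T {i}" using reach_step[OF a(2)] e(2) b by simp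
    ultimately show ?case by simp
  qed
  moreover have "h a \<in> reach ((\<lambda>e. h ` e) ` T) {h i}" if "a \<in> reach T {i}" for a
    using that
  proof (induction rule: reach_induct)
    case (base x)
    then show ?case by (intro reach_base) simp
  next
    case (step x y)
    have "h ` {x, y} \<in> (\<lambda>e. h ` e) ` T" using step.hyps(2) by (rule imageI)
    then show ?case using reach_step[OF step.IH] by simp
  qed
  ultimately have "reach ((\<lambda>e. h ` e) ` T) {h i} = h ` reach T {i}" by blast
  then show ?thesis by simp
qed

lemma vertex_pairs_image:
  assumes "inj_on h I"
  shows "vertex_pairs (h ` I) = (\<lambda>e. h ` e) ` vertex_pairs I"
proof (intro equalityI subsetI)
  fix e assume e: "e \<in> vertex_pairs (h ` I)"
  then obtain d where d: "d \<subseteq> I" "e = h ` d" by (auto simp: vertex_pairs_def subset_image_iff)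
  then have "card d = 2" using e card_image[of h d] inj_on_subset[OF assms] by (auto simp: vertex_pairs_def)
  then show "e \<in> (\<lambda>e. h ` e) ` vertex_pairs I" using d by (auto simp: vertex_pairs_def)
next
  fix e assume "e \<in> (\<lambda>e. h ` e) ` vertex_pairs I"
  then obtain d where "d \<in> vertex_pairs I" "e = h ` d" by auto
  then show "e \<in> vertex_pairs (h ` I)"
    using card_image[of h d] inj_on_subset[OF assms, of d] by (auto simp: vertex_pairs_def)
qed

lemma inj_on_image_vertex_pairs: "inj_on h I \<Longrightarrow> inj_on (\<lambda>e. h ` e) (vertex_pairs I)"
  by (rule inj_on_subset[OF inj_on_image_Pow]) (auto simp: vertex_pairs_def)

lemma measurable_enumerationD:
  assumes "measurable_enumeration \<pi>"
  shows "\<pi> i \<in> configurations \<rightarrow>\<^sub>M borel"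
    and "C \<in> space configurations \<Longrightarrow> bij_betw (\<lambda>i. \<pi> i C) {i. of_nat i < num_points C} C"
  using assms by (auto simp: measurable_enumeration_def)

lemma measurable_num_points_configurations [measurable]:
  "num_points \<in> borel_measurable configurations"
  using measurable_num_points[of UNIV] by simp

text \<open>On configurations with a fixed set of relevant indices, the graph mean is
  \<open>explore\<close> along fixed enumeration maps, whose measurability is known. There are only
  countably many finite index sets.\<close>

lemma bernoulli_sum_measurable:
  fixes \<phi> :: "'a::polish_space \<Rightarrow> 'a \<Rightarrow> ennreal"
  assumes \<phi>: "(\<lambda>(x, y). \<phi> x y) \<in> borel_measurable (borel \<Otimes>\<^sub>M borel)"
    and sym: "\<And>x y. \<phi> x y = \<phi> y x" and le1: "\<And>x y. \<phi> x y \<le> 1"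
    and \<pi>: "measurable_enumeration (\<pi> :: nat \<Rightarrow> 'a set \<Rightarrow> 'a)"
  shows "(\<lambda>C. if finite C then bernoulli_sum (edge_weight \<phi>) (vertex_pairs (insert v C))
      (\<lambda>E. g (min n (card (cluster E v)))) else 0) \<in> borel_measurable configurations"
    (is "?F \<in> _")
proof (rule borel_measurable_countable_partition)
  note \<pi>m [measurable] = measurable_enumerationD(1)[OF \<pi>]
  \<comment> \<open>\<open>set_decode\<close> runs through the finite sets of indices. The index of
    \<open>v\<close>, if there is one, is left out because \<open>v\<close> is already the
    root.\<close>
  define A where "A = (\<lambda>k. {C \<in> space (configurations :: 'a set measure). num_points C < top \<and>
      (\<forall>i. of_nat i < num_points C \<and> \<pi> i C \<noteq> v \<longleftrightarrow> i \<in> set_decode k)})"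
  have "set_decode k = set_decode l" if "C \<in> A k" "C \<in> A l" for C k l
    using that by (auto simp: A_def)
  then show "disjoint_family A"
    unfolding disjoint_family_on_def by (metis disjoint_iff set_decode_inverse)
  have index: "set (map (\<lambda>i. \<pi> i C) (sorted_list_of_set (set_decode k))) = C - {v}"
      "distinct (map (\<lambda>i. \<pi> i C) (sorted_list_of_set (set_decode k)))" "finite C"
    if "C \<in> A k" for C k
  proof -
    have bij: "bij_betw (\<lambda>i. \<pi> i C) {i. of_nat i < num_points C} C"
      using that by (intro measurable_enumerationD(2)[OF \<pi>]) (simp add: A_def)
    have k: "set_decode k = {i. of_nat i < num_points C \<and> \<pi> i C \<noteq> v}"
      using that by (auto simp: A_def)
    show "set (map (\<lambda>i. \<pi> i C) (sorted_list_of_set (set_decode k))) = C - {v}"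
      using bij by (auto simp: k[symmetric] finite_set_decode) (auto simp: k bij_betw_def)
    have "inj_on (\<lambda>i. \<pi> i C) (set_decode k)"
      using bij by (auto simp: k bij_betw_def intro: inj_on_subset)
    then show "distinct (map (\<lambda>i. \<pi> i C) (sorted_list_of_set (set_decode k)))"
      by (simp add: distinct_map finite_set_decode)
    show "finite C" using that by (cases "finite C") (auto simp: A_def num_points_infinite)
  qed
  show "?F C = 0" if "C \<in> space configurations" "C \<notin> (\<Union>k. A k)" for C
  proof (rule ccontr)
    assume "?F C \<noteq> 0"
    then have "finite C" by (auto split: if_splits)
    then have "num_points C < top" by (simp add: num_points_finite ennreal_of_nat_eq_real_of_nat)
    moreover have "finite {i. of_nat i < num_points C \<and> \<pi> i C \<noteq> v}"
      by (rule finite_subset[of _ "{..<card C}"]) (auto simp: num_points_finite \<open>finite C\<close>)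
    ultimately have "C \<in> A (set_encode {i. of_nat i < num_points C \<and> \<pi> i C \<noteq> v})"
      using that(1) by (simp add: A_def set_encode_inverse)
    with that(2) show False by blast
  qed
  show "(\<lambda>C. ?F C * indicator (A k) C) \<in> borel_measurable configurations" for k
  proof -
    let ?xs = "map \<pi> (sorted_list_of_set (set_decode k))"
    have [measurable]: "A k \<in> sets configurations"
      unfolding A_def by measurable
    have [measurable]: "(\<lambda>C. explore \<phi> n g (map (\<lambda>r. r C) [\<lambda>_. v]) (map (\<lambda>r. r C) ?xs))
        \<in> borel_measurable configurations"
      by (intro explore_measurable \<phi>) auto
    have "?F C * indicator (A k) C
        = explore \<phi> n g (map (\<lambda>r. r C) [\<lambda>_. v]) (map (\<lambda>r. r C) ?xs) * indicator (A k) C" for C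
    proof (cases "C \<in> A k")
      case True
      have "explore \<phi> n g [v] (map (\<lambda>i. \<pi> i C) (sorted_list_of_set (set_decode k)))
        = bernoulli_sum (edge_weight \<phi>) (vertex_pairs (set [v] \<union> set (map (\<lambda>i. \<pi> i C) (sorted_list_of_set (set_decode k)))))
          (\<lambda>E. g (min n (card (reach E (set [v])))))"
        by (rule explore_eq_bernoulli_sum[OF sym le1]) (use index[OF True] in auto)
      also have "set [v] \<union> set (map (\<lambda>i. \<pi> i C) (sorted_list_of_set (set_decode k))) = insert v C"
        unfolding index(1)[OF True] by auto
      finally show ?thesis using index(3)[OF True] by (simp add: comp_def)
    qed simp
    then show ?thesis
      by (subst measurable_cong) (assumption, measurable)
  qed
qed

lemma random_connection_modelE:
  assumes "random_connection_model M \<phi> X \<xi>"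
  obtains \<pi> where "measurable_enumeration \<pi>"
    and "\<And>i j. i < j \<Longrightarrow> {\<omega> \<in> space M. of_nat j < num_points (X \<omega>) \<and> {\<pi> i (X \<omega>), \<pi> j (X \<omega>)} \<in> \<xi> \<omega>} \<in> sets M"
    and "\<And>S. finite S \<Longrightarrow> S \<subseteq> {(i, j). i < j} \<Longrightarrow> AE \<omega> in M.
      real_cond_exp M (vimage_algebra (space M) X configurations)
        (indicator (space M \<inter> (\<Inter>(i, j)\<in>S. {\<omega> \<in> space M. of_nat j < num_points (X \<omega>) \<and> {\<pi> i (X \<omega>), \<pi> j (X \<omega>)} \<in> \<xi> \<omega>}))) \<omega>
      = (\<Prod>(i, j)\<in>S. if of_nat j < num_points (X \<omega>) then \<phi> (\<pi> i (X \<omega>)) (\<pi> j (X \<omega>)) else 0)"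
  using assms unfolding random_connection_model_def Let_def
  by (auto simp: case_prod_beta')

text \<open>The model indexes potential edges by pairs \<open>i < j\<close>, the finite graphs by
  two-element sets; \<open>Min\<close> and \<open>Max\<close> translate between the two.\<close>

lemma vertex_pairs_nat:
  fixes I :: "nat set"
  assumes "e \<in> vertex_pairs I"
  shows "Min e < Max e" "e = {Min e, Max e}" "Min e \<in> I" "Max e \<in> I"
proof -
  obtain i j where e: "e = {i, j}" "i \<noteq> j" "i \<in> I" "j \<in> I"
    using assms by (auto simp: vertex_pairs_def card_2_iff)
  then have "Min e = min i j" "Max e = max i j" by auto
  then show "Min e < Max e" "e = {Min e, Max e}" "Min e \<in> I" "Max e \<in> I"
    using e by (auto simp: min_def max_def)
qed

text \<open>Given the points, the edges inside a bounded window are independent coins. The space is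
  cut into events determined by \<open>X\<close> on which the indices of the window points are
  constant; on each of them a finite sum over edge patterns remains.\<close>

lemma random_connection_model_window:
  fixes \<phi> :: "'a::polish_space \<Rightarrow> 'a \<Rightarrow> real" and W :: "'a set"
  assumes "prob_space M"
    and phi_measurable: "(\<lambda>(x, y). \<phi> x y) \<in> borel_measurable (borel \<Otimes>\<^sub>M borel)"
    and phi_range: "\<And>x y. 0 \<le> \<phi> x y \<and> \<phi> x y \<le> 1"
    and phi_sym: "\<And>x y. \<phi> x y = \<phi> y x"
    and rcm: "random_connection_model M \<phi> X \<xi>"
    and W [measurable]: "W \<in> sets borel" and bW: "bounded W"
    and v: "v \<in> W" "\<And>\<omega>. \<omega> \<in> space M \<Longrightarrow> v \<in> X \<omega>"
  shows "(\<lambda>\<omega>. g (card (cluster (\<xi> \<omega> \<inter> vertex_pairs (X \<omega> \<inter> W)) v))) \<in> borel_measurable M"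
    and "(\<integral>\<^sup>+\<omega>. g (card (cluster (\<xi> \<omega> \<inter> vertex_pairs (X \<omega> \<inter> W)) v)) \<partial>M)
      = (\<integral>\<^sup>+\<omega>. bernoulli_sum (edge_weight (\<lambda>x y. ennreal (\<phi> x y))) (vertex_pairs (X \<omega> \<inter> W))
          (\<lambda>E. g (card (cluster E v))) \<partial>M)"
proof -
  interpret prob_space M by fact
  let ?\<psi> = "\<lambda>x y. ennreal (\<phi> x y)"
  have X [measurable]: "X \<in> M \<rightarrow>\<^sub>M configurations"
    using rcm by (simp add: random_connection_model_def simple_point_process_def)
  have \<xi>_sub: "\<xi> \<omega> \<subseteq> {{x, y} | x y. x \<in> X \<omega> \<and> y \<in> X \<omega> \<and> x \<noteq> y}" if "\<omega> \<in> space M" for \<omega>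
    using rcm that by (simp add: random_connection_model_def)
  define F where "F = vimage_algebra (space M) X configurations"
  have sub: "subalgebra M F"
    unfolding F_def subalgebra_def using sets_image_in_sets[OF refl X] by simp
  obtain \<pi> where \<pi>: "measurable_enumeration \<pi>"
    and joined: "\<And>i j. i < j \<Longrightarrow> {\<omega> \<in> space M. of_nat j < num_points (X \<omega>) \<and> {\<pi> i (X \<omega>), \<pi> j (X \<omega>)} \<in> \<xi> \<omega>} \<in> sets M"
    and cond: "\<And>S. finite S \<Longrightarrow> S \<subseteq> {(i, j). i < j} \<Longrightarrow> AE \<omega> in M.
      real_cond_exp M F
        (indicator (space M \<inter> (\<Inter>(i, j)\<in>S. {\<omega> \<in> space M. of_nat j < num_points (X \<omega>) \<and> {\<pi> i (X \<omega>), \<pi> j (X \<omega>)} \<in> \<xi> \<omega>}))) \<omega>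
      = (\<Prod>(i, j)\<in>S. if of_nat j < num_points (X \<omega>) then \<phi> (\<pi> i (X \<omega>)) (\<pi> j (X \<omega>)) else 0)"
    by (rule random_connection_modelE[OF rcm, folded F_def]) (rule that)
  note \<pi>m [measurable] = measurable_enumerationD(1)[OF \<pi>]
  define J where "J = (\<lambda>e. {\<omega> \<in> space M. of_nat (Max e) < num_points (X \<omega>) \<and>
      {\<pi> (Min e) (X \<omega>), \<pi> (Max e) (X \<omega>)} \<in> \<xi> \<omega>})"
  define p where "p = (\<lambda>e \<omega>. if of_nat (Max e) < num_points (X \<omega>)
      then \<phi> (\<pi> (Min e) (X \<omega>)) (\<pi> (Max e) (X \<omega>)) else 0)"
  define D where "D = vertex_pairs (UNIV :: nat set)"
  have J_sets: "J e \<in> sets M" if "e \<in> D" for e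
    unfolding J_def using joined vertex_pairs_nat(1)[of e UNIV] that by (auto simp: D_def)
  have p_meas: "p e \<in> borel_measurable M" for e
  proof -
    have "(\<lambda>\<omega>. (\<pi> (Min e) (X \<omega>), \<pi> (Max e) (X \<omega>))) \<in> M \<rightarrow>\<^sub>M borel \<Otimes>\<^sub>M borel" by measurable
    from measurable_compose[OF this phi_measurable] show ?thesis
      unfolding p_def by (intro measurable_If) (auto)
  qed
  have p01: "0 \<le> p e \<omega> \<and> p e \<omega> \<le> 1" for e \<omega>
    using phi_range by (simp add: p_def)
  have condJ: "AE \<omega> in M. real_cond_exp M F (indicator (space M \<inter> (\<Inter>e\<in>S. J e))) \<omega> = (\<Prod>e\<in>S. p e \<omega>)"
    if S: "finite S" "S \<subseteq> D" for S
  proof -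
    let ?m = "\<lambda>e::nat set. (Min e, Max e)"
    have "inj_on ?m S"
      using S(2) vertex_pairs_nat(2)[of _ UNIV] unfolding D_def inj_on_def by (metis prod.inject subsetD)
    moreover have "finite (?m ` S)" "?m ` S \<subseteq> {(i, j). i < j}"
      using S vertex_pairs_nat(1)[of _ UNIV] by (auto simp: D_def)
    ultimately show ?thesis
      using cond[of "?m ` S"] by (simp add: J_def p_def prod.reindex comp_def image_comp)
  qed
  \<comment> \<open>\<open>k\<close> encodes the set of indices of the points in \<open>W\<close> and, among them, the index of \<open>v\<close>.\<close>
  define I where "I = (\<lambda>\<omega>. {i. of_nat i < num_points (X \<omega>) \<and> \<pi> i (X \<omega>) \<in> W})"
  define dI where "dI = (\<lambda>k. set_decode (fst (prod_decode k)))"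
  define d0 where "d0 = (\<lambda>k. snd (prod_decode k))"
  define A where "A = (\<lambda>k. {\<omega> \<in> space M. I \<omega> = dI k \<and> d0 k \<in> dI k \<and> \<pi> (d0 k) (X \<omega>) = v})"
  have bij: "bij_betw (\<lambda>i. \<pi> i (X \<omega>)) {i. of_nat i < num_points (X \<omega>)} (X \<omega>)" if "\<omega> \<in> space M" for \<omega>
    using measurable_space[OF X that] by (rule measurable_enumerationD(2)[OF \<pi>])
  have inj: "inj_on (\<lambda>i. \<pi> i (X \<omega>)) (I \<omega>)" if "\<omega> \<in> space M" for \<omega>
    using bij[OF that] by (auto simp: I_def bij_betw_def intro: inj_on_subset)
  have img: "(\<lambda>i. \<pi> i (X \<omega>)) ` I \<omega> = X \<omega> \<inter> W" if "\<omega> \<in> space M" for \<omega>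
    using bij[OF that] unfolding I_def bij_betw_def by force
  have disj: "disjoint_family A"
    unfolding disjoint_family_on_def
  proof (intro ballI impI, rule ccontr)
    fix k l assume "k \<noteq> l" "A k \<inter> A l \<noteq> {}"
    then obtain \<omega> where \<omega>: "\<omega> \<in> space M" "I \<omega> = dI k" "d0 k \<in> I \<omega>" "\<pi> (d0 k) (X \<omega>) = v"
      "I \<omega> = dI l" "d0 l \<in> I \<omega>" "\<pi> (d0 l) (X \<omega>) = v" by (auto simp: A_def)
    then have "d0 k = d0 l" using inj[OF \<omega>(1)] by (simp add: inj_on_def)
    moreover have "fst (prod_decode k) = fst (prod_decode l)"
      using \<omega> unfolding dI_def by (metis set_decode_inverse)
    ultimately have "prod_decode k = prod_decode l" by (simp add: d0_def prod_eq_iff)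
    then show False using \<open>k \<noteq> l\<close> by (metis prod_decode_inverse)
  qed
  have cover: "\<omega> \<in> (\<Union>k. A k)" if \<omega>: "\<omega> \<in> space M" for \<omega>
  proof -
    have "finite (X \<omega> \<inter> W)"
      using measurable_space[OF X \<omega>] bW by (simp add: space_configurations locally_finite_set_def)
    then have fin: "finite (I \<omega>)" using inj[OF \<omega>] img[OF \<omega>] by (metis finite_imageD)
    have "v \<in> (\<lambda>i. \<pi> i (X \<omega>)) ` I \<omega>" unfolding img[OF \<omega>] using v \<omega> by simp
    then obtain i where "i \<in> I \<omega>" "\<pi> i (X \<omega>) = v" by auto
    then have "\<omega> \<in> A (prod_encode (set_encode (I \<omega>), i))"
      using \<omega> fin by (simp add: A_def dI_def d0_def set_encode_inverse)
    then show ?thesis by blast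
  qed
  \<comment> \<open>The pieces are events of the conditioning field, so the conditional edge
    probabilities may be integrated over them.\<close>
  have A_F: "A k \<in> sets F" for k
  proof -
    let ?A = "{C \<in> space configurations. (\<forall>i. of_nat i < num_points C \<and> \<pi> i C \<in> W \<longleftrightarrow> i \<in> dI k)
        \<and> d0 k \<in> dI k \<and> \<pi> (d0 k) C = v}"
    have "?A \<in> sets configurations" by measurable
    moreover have "A k = X -` ?A \<inter> space M"
      using measurable_space[OF X] by (auto simp: A_def I_def set_eq_iff)
    ultimately show ?thesis unfolding F_def by (simp only: in_vimage_algebra)
  qed
  then have A_M [measurable]: "A k \<in> sets M" for k using sub by (auto simp: subalgebra_def)
  define G where "G = (\<lambda>k T. g (card (cluster T (d0 k))))"
  \<comment> \<open>The event that \<open>T\<close> is exactly the set of index pairs joined in the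
    window.\<close>
  define B where "B = (\<lambda>k T. {\<omega> \<in> A k. (\<forall>e\<in>T. \<omega> \<in> J e) \<and> (\<forall>e\<in>vertex_pairs (dI k) - T. \<omega> \<notin> J e)})"
  have fin_dI: "finite (dI k)" for k by (simp add: dI_def finite_set_decode)
  have P_D: "vertex_pairs (dI k) \<subseteq> D" for k unfolding D_def by (rule vertex_pairs_mono) simp
  have B_M [measurable]: "B k T \<in> sets M" if "T \<subseteq> vertex_pairs (dI k)" for k T
  proof -
    have "finite (vertex_pairs (dI k))" by (intro finite_vertex_pairs fin_dI)
    then have "finite T" "finite (vertex_pairs (dI k) - T)" using that finite_subset by auto
    moreover have "B k T = A k - ((\<Union>e\<in>T. A k - J e) \<union> (\<Union>e\<in>vertex_pairs (dI k) - T. J e))"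
      by (auto simp: B_def)
    moreover have "J e \<in> sets M" if "e \<in> vertex_pairs (dI k)" for e
      using that P_D by (blast intro: J_sets)
    ultimately show ?thesis
      using that by (simp only:) (intro sets.Diff sets.Un sets.finite_UN A_M, auto)
  qed
  let ?h1 = "\<lambda>\<omega>. g (card (cluster (\<xi> \<omega> \<inter> vertex_pairs (X \<omega> \<inter> W)) v))"
  let ?h2 = "\<lambda>\<omega>. bernoulli_sum (edge_weight ?\<psi>) (vertex_pairs (X \<omega> \<inter> W)) (\<lambda>E. g (card (cluster E v)))"
  have h1: "?h1 \<omega> * indicator (A k) \<omega> = (\<Sum>T\<in>Pow (vertex_pairs (dI k)). G k T * indicator (B k T) \<omega>)"
    for k \<omega>
  proof (cases "\<omega> \<in> A k")
    case False
    then have "\<omega> \<notin> B k T" for T by (simp add: B_def)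
    then show ?thesis using False by simp
  next
    case True
    let ?f = "\<lambda>i. \<pi> i (X \<omega>)" and ?P = "vertex_pairs (dI k)"
    have \<omega>: "\<omega> \<in> space M" "I \<omega> = dI k" "d0 k \<in> dI k" "?f (d0 k) = v" using True by (auto simp: A_def)
    note inj' = inj[OF \<omega>(1), unfolded \<omega>(2)] and img' = img[OF \<omega>(1), unfolded \<omega>(2)]
    \<comment> \<open>The pattern realised at \<open>\<omega>\<close>; all other terms of the sum
      vanish.\<close>
    define T0 where "T0 = {e \<in> ?P. \<omega> \<in> J e}"
    have "\<omega> \<in> B k T \<longleftrightarrow> T = T0" if "T \<subseteq> ?P" for T
      using that True by (auto simp: B_def T0_def)
    then have "(\<Sum>T\<in>Pow ?P. G k T * indicator (B k T) \<omega>) = (\<Sum>T\<in>Pow ?P. if T = T0 then G k T else 0)"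
      by (intro sum.cong) (auto split: split_indicator)
    also have "\<dots> = G k T0"
      using finite_vertex_pairs[OF fin_dI, of k] by (simp add: T0_def)
    also have "\<dots> = ?h1 \<omega>"
    proof -
      have mem: "e \<in> T0 \<longleftrightarrow> ?f ` e \<in> \<xi> \<omega>" if e: "e \<in> ?P" for e
      proof -
        have "?f ` e = {?f (Min e), ?f (Max e)}" by (subst vertex_pairs_nat(2)[OF e]) simp
        moreover have "of_nat (Max e) < num_points (X \<omega>)"
          using vertex_pairs_nat(4)[OF e] \<omega>(2) by (auto simp: I_def)
        ultimately show ?thesis using e \<omega>(1) by (simp add: T0_def J_def)
      qed
      have "\<xi> \<omega> \<inter> vertex_pairs (X \<omega> \<inter> W) = (\<lambda>e. ?f ` e) ` T0"
        unfolding img'[symmetric] vertex_pairs_image[OF inj'] using mem by (auto simp: T0_def)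
      then have "cluster (\<xi> \<omega> \<inter> vertex_pairs (X \<omega> \<inter> W)) v = ?f ` cluster T0 (d0 k)"
        using cluster_image[OF inj', of T0 "d0 k"] \<omega> by (auto simp: T0_def)
      moreover have "cluster T0 (d0 k) \<subseteq> dI k"
        using reach_subset[of T0 "dI k" "{d0 k}"] \<omega> by (auto simp: T0_def)
      ultimately have "card (cluster (\<xi> \<omega> \<inter> vertex_pairs (X \<omega> \<inter> W)) v) = card (cluster T0 (d0 k))"
        using inj' by (simp add: card_image inj_on_subset)
      then show ?thesis by (simp add: G_def)
    qed
    finally show ?thesis using True by simp
  qed
  have h2: "?h2 \<omega> * indicator (A k) \<omega> = (\<Sum>T\<in>Pow (vertex_pairs (dI k)). G k T *
      ennreal (indicator (A k) \<omega> * ((\<Prod>e\<in>T. p e \<omega>) * (\<Prod>e\<in>vertex_pairs (dI k) - T. 1 - p e \<omega>))))"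
    for k \<omega>
  proof (cases "\<omega> \<in> A k")
    case True
    let ?f = "\<lambda>i. \<pi> i (X \<omega>)" and ?P = "vertex_pairs (dI k)"
    have \<omega>: "\<omega> \<in> space M" "I \<omega> = dI k" "d0 k \<in> dI k" "?f (d0 k) = v" using True by (auto simp: A_def)
    note inj' = inj[OF \<omega>(1), unfolded \<omega>(2)] and img' = img[OF \<omega>(1), unfolded \<omega>(2)]
    have "?h2 \<omega> = bernoulli_sum (edge_weight ?\<psi> \<circ> (\<lambda>e. ?f ` e)) ?P (\<lambda>T. g (card (cluster ((\<lambda>e. ?f ` e) ` T) v)))"
      unfolding img'[symmetric] vertex_pairs_image[OF inj']
      by (rule bernoulli_sum_image[OF finite_vertex_pairs[OF fin_dI] inj_on_image_vertex_pairs[OF inj']])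
    also have "\<dots> = bernoulli_sum (\<lambda>e. ennreal (p e \<omega>)) ?P (G k)"
    proof (intro bernoulli_sum_cong refl)
      fix e assume e: "e \<in> ?P"
      have "?f ` e = {?f (Min e), ?f (Max e)}" by (subst vertex_pairs_nat(2)[OF e]) simp
      moreover have "of_nat (Max e) < num_points (X \<omega>)"
        using vertex_pairs_nat(4)[OF e] \<omega>(2) by (auto simp: I_def)
      ultimately show "(edge_weight ?\<psi> \<circ> (\<lambda>e. ?f ` e)) e = ennreal (p e \<omega>)"
        using phi_sym by (simp add: p_def edge_weight_doubleton)
    next
      fix T assume T: "T \<subseteq> ?P"
      have "cluster T (d0 k) \<subseteq> dI k"
        using reach_subset[OF T, of "{d0 k}"] \<omega> by auto
      then show "g (card (cluster ((\<lambda>e. ?f ` e) ` T) v)) = G k T"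
        using cluster_image[OF inj' T \<omega>(3)] inj' \<omega>(4) by (simp add: G_def card_image inj_on_subset)
    qed
    also have "\<dots> = (\<Sum>T\<in>Pow ?P. G k T * ennreal ((\<Prod>e\<in>T. p e \<omega>) * (\<Prod>e\<in>?P - T. 1 - p e \<omega>)))"
      unfolding bernoulli_sum_def
    proof (rule sum.cong[OF refl])
      fix T
      have "(\<Prod>e\<in>T. ennreal (p e \<omega>)) * (\<Prod>e\<in>?P - T. 1 - ennreal (p e \<omega>))
          = ennreal ((\<Prod>e\<in>T. p e \<omega>) * (\<Prod>e\<in>?P - T. 1 - p e \<omega>))"
        using p01 by (simp add: ennreal_mult prod_nonneg prod_ennreal ennreal_minus flip: ennreal_1)
      then show "(\<Prod>e\<in>T. ennreal (p e \<omega>)) * (\<Prod>e\<in>?P - T. 1 - ennreal (p e \<omega>)) * G k T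
          = G k T * ennreal ((\<Prod>e\<in>T. p e \<omega>) * (\<Prod>e\<in>?P - T. 1 - p e \<omega>))"
        by (simp add: mult.commute)
    qed
    finally show ?thesis using True by simp
  qed simp
  have m1: "(\<lambda>\<omega>. ?h1 \<omega> * indicator (A k) \<omega>) \<in> borel_measurable M" for k
    unfolding h1 by (intro borel_measurable_sum borel_measurable_times_ennreal borel_measurable_indicator B_M) auto
  have mw: "(\<lambda>\<omega>. indicator (A k) \<omega> * ((\<Prod>e\<in>T. p e \<omega>) * (\<Prod>e\<in>S. 1 - p e \<omega>))) \<in> borel_measurable M" for k T S
    by (intro borel_measurable_times borel_measurable_prod borel_measurable_diff p_meas
        borel_measurable_indicator A_M) auto
  have m2: "(\<lambda>\<omega>. ?h2 \<omega> * indicator (A k) \<omega>) \<in> borel_measurable M" for k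
    unfolding h2 by (intro borel_measurable_sum borel_measurable_times_ennreal measurable_compose[OF mw measurable_ennreal]) auto
  have eq: "(\<integral>\<^sup>+\<omega>. ?h1 \<omega> * indicator (A k) \<omega> \<partial>M) = (\<integral>\<^sup>+\<omega>. ?h2 \<omega> * indicator (A k) \<omega> \<partial>M)" for k
  proof -
    let ?P = "vertex_pairs (dI k)"
    have finP: "finite ?P" by (intro finite_vertex_pairs fin_dI)
    have "(\<integral>\<^sup>+\<omega>. ?h1 \<omega> * indicator (A k) \<omega> \<partial>M) = (\<Sum>T\<in>Pow ?P. G k T * emeasure M (B k T))"
      unfolding h1 by (subst nn_integral_sum) (auto simp: nn_integral_cmult)
    also have "\<dots> = (\<Sum>T\<in>Pow ?P. G k T * (\<integral>\<^sup>+\<omega>. ennreal (indicator (A k) \<omega> *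
        ((\<Prod>e\<in>T. p e \<omega>) * (\<Prod>e\<in>?P - T. 1 - p e \<omega>))) \<partial>M))"
    proof (intro sum.cong refl arg_cong2[where f = "(*)"])
      fix T assume T: "T \<in> Pow ?P"
      let ?w = "\<lambda>\<omega>. indicator (A k) \<omega> * ((\<Prod>e\<in>T. p e \<omega>) * (\<Prod>e\<in>?P - T. 1 - p e \<omega>))"
      have w: "0 \<le> ?w \<omega>" "?w \<omega> \<le> 1" for \<omega>
        using p01 by (auto intro!: prod_nonneg prod_le_1 mult_le_one mult_nonneg_nonneg split: split_indicator)
      have "measure M (B k T) = (\<integral>\<omega>. ?w \<omega> \<partial>M)" unfolding B_def
        by (rule pattern_probability[OF \<open>prob_space M\<close> sub J_sets p_meas p01 condJ A_F])
           (use T finP finite_subset[of T ?P] in \<open>auto intro: P_D[THEN subsetD]\<close>)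
      moreover have "(\<integral>\<^sup>+\<omega>. ennreal (?w \<omega>) \<partial>M) = ennreal (\<integral>\<omega>. ?w \<omega> \<partial>M)"
        using w mw by (intro nn_integral_eq_integral integrable_const_bound[where B = 1]) auto
      ultimately show "emeasure M (B k T) = (\<integral>\<^sup>+\<omega>. ennreal (?w \<omega>) \<partial>M)"
        by (simp add: emeasure_eq_measure)
    qed
    also have "\<dots> = (\<integral>\<^sup>+\<omega>. ?h2 \<omega> * indicator (A k) \<omega> \<partial>M)"
      unfolding h2 using measurable_compose[OF mw measurable_ennreal]
      by (subst nn_integral_sum) (auto simp: nn_integral_cmult)
    finally show ?thesis .
  qed
  show "?h1 \<in> borel_measurable M"
    by (rule borel_measurable_countable_partition[OF disj _ m1]) (use cover in blast)
  have "(\<integral>\<^sup>+\<omega>. ?h1 \<omega> \<partial>M) = (\<Sum>k. \<integral>\<^sup>+\<omega>. ?h1 \<omega> * indicator (A k) \<omega> \<partial>M)"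
    by (rule nn_integral_countable_partition(2)[OF disj _ m1]) (use cover in blast)
  also have "\<dots> = (\<integral>\<^sup>+\<omega>. ?h2 \<omega> \<partial>M)"
    unfolding eq by (rule nn_integral_countable_partition(2)[OF disj _ m2, symmetric]) (use cover in blast)
  finally show "(\<integral>\<^sup>+\<omega>. ?h1 \<omega> \<partial>M) = (\<integral>\<^sup>+\<omega>. ?h2 \<omega> \<partial>M)" .
qed

section \<open>Exponential moments\<close>

text \<open>One index serves both as cap and as window number. A finite part of the union lies in
  some \<open>C k\<close>, and enlarging the index beyond its size disables the cap.\<close>

lemma SUP_card_increasing:
  fixes C :: "nat \<Rightarrow> 'a set" and g :: "nat \<Rightarrow> ennreal"
  assumes inc: "incseq C" and fin: "\<And>k. finite (C k)" and g: "mono g"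
  shows "(SUP k. g (min k (card (C k)))) = (if finite (\<Union>k. C k) then g (card (\<Union>k. C k)) else (SUP n. g n))"
proof -
  have ge: "g (card F) \<le> (SUP k. g (min k (card (C k))))" if F: "finite F" "F \<subseteq> (\<Union>k. C k)" for F
  proof -
    have "\<exists>k. F \<subseteq> C k"
      using F
    proof (induction F rule: finite_induct)
      case (insert x F)
      then obtain k l where "F \<subseteq> C k" "x \<in> C l" by auto
      then have "insert x F \<subseteq> C (max k l)"
        using incseqD[OF inc, of k "max k l"] incseqD[OF inc, of l "max k l"] by auto
      then show ?case by blast
    qed simp
    then obtain k where "F \<subseteq> C k" by blast
    then have "F \<subseteq> C (max k (card F))" using incseqD[OF inc, of k "max k (card F)"] by auto
    then have "card F \<le> min (max k (card F)) (card (C (max k (card F))))"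
      by (simp add: card_mono fin)
    then have "g (card F) \<le> g (min (max k (card F)) (card (C (max k (card F)))))"
      by (rule monoD[OF g])
    also have "\<dots> \<le> (SUP k. g (min k (card (C k))))" by (rule SUP_upper) simp
    finally show ?thesis .
  qed
  show ?thesis
  proof (cases "finite (\<Union>k. C k)")
    case True
    have "(SUP k. g (min k (card (C k)))) \<le> g (card (\<Union>k. C k))"
      by (intro SUP_least monoD[OF g] min.coboundedI2 card_mono True) auto
    with ge[OF True] True show ?thesis by (simp add: antisym)
  next
    case False
    have "(SUP k. g (min k (card (C k)))) \<le> (SUP n. g n)"
      by (intro SUP_least SUP_upper) simp
    moreover have "(SUP n. g n) \<le> (SUP k. g (min k (card (C k))))"
    proof (rule SUP_least)
      fix n
      obtain F where "finite F" "card F = n" "F \<subseteq> (\<Union>k. C k)"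
        using infinite_arbitrarily_large[OF False] by blast
      then show "g n \<le> (SUP k. g (min k (card (C k))))" using ge by blast
    qed
    ultimately show ?thesis using False by (simp add: antisym)
  qed
qed

text \<open>Matches the value of \<open>exp_size\<close> on infinite clusters with the limit of the
  capped values.\<close>

lemma SUP_exp_eq_top:
  assumes "0 < \<delta>"
  shows "(SUP n. ennreal (exp (\<delta> * real n))) = top"
proof -
  have "(SUP n. of_nat n * ennreal \<delta>) \<le> (SUP n. ennreal (exp (\<delta> * real n)))"
  proof (rule SUP_mono)
    fix n :: nat
    have "\<delta> * real n \<le> exp (\<delta> * real n)"
      using exp_ge_add_one_self[of "\<delta> * real n"] by linarith
    then have "of_nat n * ennreal \<delta> \<le> ennreal (exp (\<delta> * real n))"
      using assms by (simp add: ennreal_of_nat_eq_real_of_nat mult.commute flip: ennreal_mult)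
    then show "\<exists>m\<in>UNIV. of_nat n * ennreal \<delta> \<le> ennreal (exp (\<delta> * real m))" by blast
  qed
  moreover have "(SUP n. of_nat n * ennreal \<delta>) = top"
    using assms by (simp add: ennreal_SUP_of_nat_eq_top ennreal_top_mult flip: SUP_mult_right_ennreal)
  ultimately show ?thesis by (simp add: top_unique)
qed

text \<open>A path has finitely many vertices and so lies in a single window. The root is a vertex
  of every window graph, also while it lies outside \<open>W k\<close>.\<close>

lemma UN_cluster_window:
  assumes E: "E \<subseteq> {{x, y} | x y. x \<in> X \<and> y \<in> X \<and> x \<noteq> y}" and W: "incseq W" "(\<Union>k. W k) = UNIV"
  shows "(\<Union>k. cluster (E \<inter> vertex_pairs (insert v (X \<inter> W k))) v) = cluster E v"
proof (intro equalityI subsetI)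
  fix y assume "y \<in> (\<Union>k. cluster (E \<inter> vertex_pairs (insert v (X \<inter> W k))) v)"
  then show "y \<in> cluster E v"
    using reach_mono[of "{v}" "{v}" "E \<inter> vertex_pairs (insert v (X \<inter> W k))" E for k] by auto
next
  let ?E = "\<lambda>k. E \<inter> vertex_pairs (insert v (X \<inter> W k))"
  have mono: "reach (?E k) {v} \<subseteq> reach (?E l) {v}" if "k \<le> l" for k l
    using incseqD[OF W(1) that] by (intro reach_mono) (auto simp: vertex_pairs_def)
  fix y assume "y \<in> cluster E v"
  then have "y \<in> reach E {v}" by simp
  then have "\<exists>k. y \<in> reach (?E k) {v}"
  proof (induction rule: reach_induct)
    case (base x)
    then have "x \<in> reach (?E 0) {v}" by (rule reach_base)
    then show ?case by blast
  next
    case (step x y)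
    then obtain k where k: "x \<in> reach (?E k) {v}" by blast
    obtain l m where lm: "x \<in> W l" "y \<in> W m" using W(2) by blast
    have xy: "x \<in> X" "y \<in> X" "x \<noteq> y" using E step.hyps(2) by (auto simp: doubleton_eq_iff)
    define n where "n = max k (max l m)"
    have n: "k \<le> n" "l \<le> n" "m \<le> n" by (simp_all add: n_def)
    have "x \<in> W n" "y \<in> W n"
      using incseqD[OF W(1) n(2)] incseqD[OF W(1) n(3)] lm by auto
    then have "{x, y} \<in> ?E n" using xy step.hyps(2) by (simp add: doubleton_mem_vertex_pairs)
    moreover have "x \<in> reach (?E n) {v}" using mono[OF n(1)] k by (rule subsetD)
    ultimately have "y \<in> reach (?E n) {v}" by (rule reach_step[rotated])
    then show ?case by blast
  qed
  then show "y \<in> (\<Union>k. cluster (?E k) v)" by simp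
qed

lemma poisson_process_void:
  fixes \<Lambda> :: "'a::metric_space measure"
  assumes "poisson_process M (scale_measure (ennreal t) \<Lambda>) \<eta>" "0 \<le> t"
    and "B \<in> sets borel" "emeasure \<Lambda> B < \<infinity>"
  shows "measure M {\<omega> \<in> space M. \<eta> \<omega> \<inter> B = {}} = exp (- enn2real (ennreal t * emeasure \<Lambda> B))"
proof -
  have fin: "emeasure (scale_measure (ennreal t) \<Lambda>) B < \<infinity>"
    using assms(4) by (simp add: ennreal_mult_less_top)
  have "\<forall>k::nat. measure M {\<omega> \<in> space M. num_points (\<eta> \<omega> \<inter> B) = of_nat k}
      = measure (scale_measure (ennreal t) \<Lambda>) B ^ k / fact k * exp (- measure (scale_measure (ennreal t) \<Lambda>) B)"
    using assms(1,3) fin unfolding poisson_process_def by blast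
  from this[rule_format, of 0] show ?thesis
    by (simp add: num_points_eq_0_iff measure_def)
qed

context connection_kernel
begin

text \<open>Links the abstract model to the explicit integrals in two stages: conditioning on the
  points replaces the edges by coins, and then the law of the points in \<open>W\<close> is replaced
  by a Poisson integral.\<close>

lemma window_expectation:
  fixes \<phi>' :: "'a \<Rightarrow> 'a \<Rightarrow> real" and t :: real
  defines "f \<equiv> \<lambda>W x. ennreal t * indicator W x"
  assumes "prob_space M" "0 \<le> t"
    and \<phi>': "\<phi> = (\<lambda>x y. ennreal (\<phi>' x y))" "\<And>x y. 0 \<le> \<phi>' x y \<and> \<phi>' x y \<le> 1"
      "(\<lambda>(x, y). \<phi>' x y) \<in> borel_measurable (borel \<Otimes>\<^sub>M borel)" "\<And>x y. \<phi>' x y = \<phi>' y x"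
    and poisson: "poisson_process M (scale_measure (ennreal t) \<Lambda>) \<eta>"
    and rcm: "random_connection_model M \<phi>' (\<lambda>\<omega>. insert v (\<eta> \<omega>)) \<xi>"
    and W [measurable]: "W \<in> sets borel" and bW: "bounded W" and fW: "emeasure \<Lambda> W < \<infinity>"
  shows "(\<lambda>\<omega>. g (min n (card (cluster (\<xi> \<omega> \<inter> vertex_pairs (insert v (\<eta> \<omega> \<inter> W))) v)))) \<in> borel_measurable M"
    and "(\<integral>\<^sup>+\<omega>. g (min n (card (cluster (\<xi> \<omega> \<inter> vertex_pairs (insert v (\<eta> \<omega> \<inter> W))) v))) \<partial>M)
      = cluster_mean n g (f W) [v]"
proof -
  have [measurable]: "f W \<in> borel_measurable borel" by (simp add: f_def)
  have fin: "(\<integral>\<^sup>+x. f W x \<partial>\<Lambda>) < \<infinity>"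
    using fW W unfolding f_def by (simp add: nn_integral_cmult sets_borel ennreal_mult_less_top)
  \<comment> \<open>The window lemma requires the root inside the window, hence the enlarged window
    \<open>insert v W\<close>; no other point is gained.\<close>
  have eqW: "insert v (\<eta> \<omega>) \<inter> insert v W = insert v (\<eta> \<omega> \<inter> W)" for \<omega> by auto
  have bW': "bounded (insert v W)" using bW by simp
  have W': "insert v W \<in> sets borel" by measurable
  note win = random_connection_model_window[OF \<open>prob_space M\<close> \<phi>'(3,2,4) rcm W' bW',
      of v "\<lambda>k. g (min n k)", unfolded eqW, simplified, folded \<phi>'(1)]
  show "(\<lambda>\<omega>. g (min n (card (cluster (\<xi> \<omega> \<inter> vertex_pairs (insert v (\<eta> \<omega> \<inter> W))) v)))) \<in> borel_measurable M"
    by (rule win(1))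
  \<comment> \<open>The model itself supplies the measurable enumeration needed for measurability of
    \<open>F\<close>.\<close>
  obtain \<pi> :: "nat \<Rightarrow> 'a set \<Rightarrow> 'a" where \<pi>: "measurable_enumeration \<pi>"
    by (rule random_connection_modelE[OF rcm]) (rule that)
  define F where "F = (\<lambda>C. if finite C then bernoulli_sum (edge_weight \<phi>) (vertex_pairs (insert v C))
      (\<lambda>E. g (min n (card (cluster E v)))) else 0)"
  have F: "F \<in> borel_measurable configurations"
    unfolding F_def by (rule bernoulli_sum_measurable[OF kernel_measurable kernel_sym kernel_le_1 \<pi>])
  have \<eta>: "\<eta> \<in> M \<rightarrow>\<^sub>M configurations"
    using poisson by (simp add: poisson_process_def simple_point_process_def)
  have N: "(\<lambda>\<omega>. \<eta> \<omega> \<inter> W) \<in> M \<rightarrow>\<^sub>M configurations"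
    using \<eta> measurable_window[OF W] by (rule measurable_compose)
  have finN: "finite (\<eta> \<omega> \<inter> W)" if "\<omega> \<in> space M" for \<omega>
    using measurable_space[OF \<eta> that] bW by (simp add: space_configurations locally_finite_set_def)
  have void: "measure M {\<omega> \<in> space M. \<eta> \<omega> \<inter> W \<inter> B = {}} = exp (- enn2real (\<integral>\<^sup>+x. f W x * indicator B x \<partial>\<Lambda>))"
    if [measurable]: "B \<in> sets borel" for B
  proof -
    have "emeasure \<Lambda> (W \<inter> B) < \<infinity>"
      using fW emeasure_mono[of "W \<inter> B" W \<Lambda>] by (auto simp: sets_borel intro: le_less_trans)
    moreover have "(\<integral>\<^sup>+x. f W x * indicator B x \<partial>\<Lambda>) = ennreal t * emeasure \<Lambda> (W \<inter> B)"
      unfolding f_def mult.assoc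
      by (subst nn_integral_cmult) (auto simp: sets_borel simp flip: indicator_inter_arith)
    ultimately show ?thesis
      using poisson_process_void[OF poisson \<open>0 \<le> t\<close>, of "W \<inter> B"] by (simp add: Int_assoc)
  qed
  have "(\<integral>\<^sup>+\<omega>. g (min n (card (cluster (\<xi> \<omega> \<inter> vertex_pairs (insert v (\<eta> \<omega> \<inter> W))) v))) \<partial>M)
      = (\<integral>\<^sup>+\<omega>. F (\<eta> \<omega> \<inter> W) \<partial>M)"
    unfolding win(2) by (intro nn_integral_cong) (simp add: F_def finN)
  also have "\<dots> = pois (f W) (\<lambda>l. F (set l))"
    by (rule nn_integral_eq_pois[OF \<open>f W \<in> borel_measurable borel\<close> fin \<open>prob_space M\<close> N void F])
  also have "\<dots> = cluster_mean n g (f W) [v]"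
  proof -
    \<comment> \<open>\<open>F\<close> is the graph mean of \<open>explore\<close> only for distinct
      points other than \<open>v\<close>; under the diffuse measure this covers almost every
      list.\<close>
    have eq: "F (set xs) = explore \<phi> n g [v] xs" if "distinct xs" "set xs \<inter> {v} = {}" for xs
      using explore_eq_bernoulli_sum[where \<phi> = \<phi>, OF kernel_sym kernel_le_1, of "[v]" xs n g] that by (simp add: F_def)
    show ?thesis unfolding cluster_mean_def
      by (intro antisym pois_mono_AE[of "\<lambda>_. True" "{v}"]) (auto simp: eq)
  qed
  finally show "(\<integral>\<^sup>+\<omega>. g (min n (card (cluster (\<xi> \<omega> \<inter> vertex_pairs (insert v (\<eta> \<omega> \<inter> W))) v))) \<partial>M)
      = cluster_mean n g (f W) [v]" .
qed

end

theorem theorem1p1: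
  fixes \<Lambda> :: "'a::polish_space measure"
    and \<phi> :: "'a \<Rightarrow> 'a \<Rightarrow> real"
    and P :: "real \<Rightarrow> 'w measure"
    and \<eta> :: "real \<Rightarrow> 'w \<Rightarrow> 'a set"
    and \<xi> :: "real \<Rightarrow> 'a \<Rightarrow> 'w \<Rightarrow> 'a set set"
  assumes borel: "sets \<Lambda> = sets borel"
    and locally_finite: "\<And>B. B \<in> sets borel \<Longrightarrow> bounded B \<Longrightarrow> emeasure \<Lambda> B < \<infinity>"
    and diffuse: "\<And>x. emeasure \<Lambda> {x} = 0"
    and phi_measurable: "(\<lambda>(x, y). \<phi> x y) \<in> borel_measurable (borel \<Otimes>\<^sub>M borel)"
    and phi_range: "\<And>x y. 0 \<le> \<phi> x y \<and> \<phi> x y \<le> 1"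
    and phi_sym: "\<And>x y. \<phi> x y = \<phi> y x"
    and phi_integrable: "AE x in \<Lambda>. (\<integral>\<^sup>+y. ennreal (\<phi> x y) \<partial>\<Lambda>) < \<infinity>"
    and prob: "\<And>t. 0 \<le> t \<Longrightarrow> prob_space (P t)"
    and poisson: "\<And>t. 0 \<le> t \<Longrightarrow> poisson_process (P t) (scale_measure (ennreal t) \<Lambda>) (\<eta> t)"
    and rcm: "\<And>t v. 0 \<le> t \<Longrightarrow>
      random_connection_model (P t) \<phi> (\<lambda>\<omega>. insert v (\<eta> t \<omega>)) (\<xi> t v)"
  shows "\<forall>t\<ge>0. ereal t < t_T \<Lambda> P \<xi> \<longrightarrow>
    (\<exists>\<delta>\<^sub>1>0. esssup \<Lambda> (\<lambda>v. \<integral>\<^sup>+\<omega>. exp_size \<delta>\<^sub>1 (cluster (\<xi> t v \<omega>) v) \<partial>P t) < \<infinity>)"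
proof (intro allI impI)
  fix t :: real assume t: "0 \<le> t" "ereal t < t_T \<Lambda> P \<xi>"
  \<comment> \<open>Balls about an arbitrary centre: bounded, hence of finite measure, and
    exhausting the space.\<close>
  define W where "W = (\<lambda>k. cball (undefined :: 'a) (real k))"
  have W_borel [measurable]: "W k \<in> sets borel" and W_bounded: "bounded (W k)" for k
    by (auto simp: W_def intro: borel_closed)
  have W_inc: "incseq W" by (auto simp: incseq_def W_def)
  have W_UN: "(\<Union>k. W k) = UNIV"
    using real_arch_simple by (fastforce simp: W_def)
  have W_fin: "emeasure \<Lambda> (W k) < \<infinity>" for k by (intro locally_finite W_borel W_bounded)
  interpret connection_kernel \<Lambda> "\<lambda>x y. ennreal (\<phi> x y)"
  proof
    show "\<exists>A. countable A \<and> A \<subseteq> sets \<Lambda> \<and> \<Union> A = space \<Lambda> \<and> (\<forall>a\<in>A. emeasure \<Lambda> a \<noteq> \<infinity>)"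
      using W_UN W_fin sets_eq_imp_space_eq[OF borel]
      by (intro exI[of _ "range W"]) (auto simp: borel less_top)
    show "(\<lambda>(x, y). ennreal (\<phi> x y)) \<in> borel_measurable (borel \<Otimes>\<^sub>M borel)"
      using measurable_compose[OF phi_measurable measurable_ennreal] by (simp add: case_prod_beta')
  qed (use borel diffuse phi_sym phi_range in auto)

  define f where "f = (\<lambda>s k x. ennreal s * indicator (W k) x)"
  define C where "C = (\<lambda>s v k \<omega>. cluster (\<xi> s v \<omega> \<inter> vertex_pairs (insert v (\<eta> s \<omega> \<inter> W k))) v)"
  have f_meas [measurable]: "f s k \<in> borel_measurable borel" for s k by (simp add: f_def)
  have f_fin: "(\<integral>\<^sup>+x. f s k x \<partial>\<Lambda>) < \<infinity>" for s k
    using W_fin[of k] by (simp add: f_def nn_integral_cmult borel ennreal_mult_less_top)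
  have C_meas: "(\<lambda>\<omega>. g (min n (card (C s v k \<omega>)))) \<in> borel_measurable (P s)"
    and C_int: "(\<integral>\<^sup>+\<omega>. g (min n (card (C s v k \<omega>))) \<partial>P s) = cluster_mean n g (f s k) [v]"
    if "0 \<le> s" for s v k n g
    using window_expectation[OF prob[OF that] that refl phi_range phi_measurable phi_sym
        poisson[OF that] rcm[OF that] W_borel W_bounded W_fin]
    by (simp_all add: C_def f_def)
  have C_UN: "(\<Union>k. C s v k \<omega>) = cluster (\<xi> s v \<omega>) v"
    and C_inc: "incseq (\<lambda>k. C s v k \<omega>)"
    and C_fin: "finite (C s v k \<omega>)" if "0 \<le> s" "\<omega> \<in> space (P s)" for s v \<omega> k
  proof -
    have eqW: "insert v (insert v (\<eta> s \<omega>) \<inter> W k) = insert v (\<eta> s \<omega> \<inter> W k)" for k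
      by auto
    have "\<xi> s v \<omega> \<subseteq> {{x, y} | x y. x \<in> insert v (\<eta> s \<omega>) \<and> y \<in> insert v (\<eta> s \<omega>) \<and> x \<noteq> y}"
      using rcm[OF that(1), of v] that(2) unfolding random_connection_model_def by blast
    from UN_cluster_window[OF this W_inc W_UN, of v] show "(\<Union>k. C s v k \<omega>) = cluster (\<xi> s v \<omega>) v"
      by (simp add: C_def eqW)
    have "reach (\<xi> s v \<omega> \<inter> vertex_pairs (insert v (\<eta> s \<omega> \<inter> W k))) {v}
        \<subseteq> reach (\<xi> s v \<omega> \<inter> vertex_pairs (insert v (\<eta> s \<omega> \<inter> W l))) {v}" if "k \<le> l" for k l
      using incseqD[OF W_inc that] by (intro reach_mono Int_mono vertex_pairs_mono) auto
    then show "incseq (\<lambda>k. C s v k \<omega>)" by (simp add: incseq_def C_def)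
    have "\<eta> s \<in> P s \<rightarrow>\<^sub>M configurations"
      using poisson[OF that(1)] by (simp add: poisson_process_def simple_point_process_def)
    from measurable_space[OF this that(2)] have "finite (\<eta> s \<omega> \<inter> W k)"
      using W_bounded by (simp add: space_configurations locally_finite_set_def)
    moreover have "C s v k \<omega> \<subseteq> insert v (\<eta> s \<omega> \<inter> W k)"
      using reach_subset[of "\<xi> s v \<omega> \<inter> vertex_pairs (insert v (\<eta> s \<omega> \<inter> W k))" "insert v (\<eta> s \<omega> \<inter> W k)" "{v}"]
      by (simp add: C_def)
    ultimately show "finite (C s v k \<omega>)" using finite_subset by auto
  qed

  \<comment> \<open>As \<open>t\<close> lies strictly below a supremum, some larger intensity still
    has bounded mean cluster size; at \<open>t\<close> itself this is not yet known.\<close>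
  have "\<exists>s. 0 \<le> s \<and> t < s \<and> esssup \<Lambda> (\<lambda>v. \<integral>\<^sup>+\<omega>. num_points (cluster (\<xi> s v \<omega>) v) \<partial>P s) < \<infinity>"
    using t(2) unfolding t_T_def less_Sup_iff by auto
  then obtain s where s: "0 \<le> s" "t < s"
    and sup: "esssup \<Lambda> (\<lambda>v. \<integral>\<^sup>+\<omega>. num_points (cluster (\<xi> s v \<omega>) v) \<partial>P s) < \<infinity>" by blast
  define c where "c = esssup \<Lambda> (\<lambda>v. \<integral>\<^sup>+\<omega>. num_points (cluster (\<xi> s v \<omega>) v) \<partial>P s)"
  \<comment> \<open>The maximum with 1 keeps \<open>K\<close> positive, so that \<open>1 / K\<close>
    can bound \<open>\<epsilon>\<close> and \<open>D\<close> is positive.\<close>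
  define K where "K = max 1 (enn2real c)"
  have "c = ennreal (enn2real c)" using sup by (simp add: c_def)
  also have "\<dots> \<le> ennreal K" by (intro ennreal_leI) (simp add: K_def)
  finally have K: "c \<le> ennreal K" "1 \<le> K" by (simp_all add: K_def)
  have good: "AE v in \<Lambda>. \<forall>k n. cluster_mean n of_nat (f s k) [v] \<le> ennreal K"
  proof -
    have "AE v in \<Lambda>. (\<integral>\<^sup>+\<omega>. num_points (cluster (\<xi> s v \<omega>) v) \<partial>P s) \<le> c"
      unfolding c_def by (rule esssup_AE)
    then show ?thesis
    proof eventually_elim
      case (elim v)
      show ?case
      proof (intro allI)
        fix k n
        have "cluster_mean n of_nat (f s k) [v] = (\<integral>\<^sup>+\<omega>. of_nat (min n (card (C s v k \<omega>))) \<partial>P s)"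
          by (rule C_int[OF s(1), symmetric])
        also have "\<dots> \<le> (\<integral>\<^sup>+\<omega>. num_points (cluster (\<xi> s v \<omega>) v) \<partial>P s)"
        proof (rule nn_integral_mono)
          fix \<omega> assume \<omega>: "\<omega> \<in> space (P s)"
          have "C s v k \<omega> \<subseteq> cluster (\<xi> s v \<omega>) v" using C_UN[OF s(1) \<omega>] by blast
          then have "of_nat (card (C s v k \<omega>)) \<le> num_points (cluster (\<xi> s v \<omega>) v)"
            using C_fin[OF s(1) \<omega>] by (auto simp: of_nat_le_num_points_iff)
          then show "of_nat (min n (card (C s v k \<omega>))) \<le> num_points (cluster (\<xi> s v \<omega>) v)"
            by (rule order_trans[rotated]) simp
        qed
        also have "\<dots> \<le> ennreal K" using elim K(1) by (rule order_trans)
        finally show "cluster_mean n of_nat (f s k) [v] \<le> ennreal K" .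
      qed
  qed
  qed

  define D where "D = 2 * K\<^sup>2 * exp ((exp 2 - 1) * K)"
  \<comment> \<open>The first bound gives \<open>\<epsilon> * K \<le> 1\<close> for the increment
    estimate, the second \<open>\<epsilon> * D \<le> 1 / 2\<close>, so that at least half of
    \<open>\<epsilon>\<close> remains in \<open>\<delta>\<close>.\<close>
  define \<epsilon> where "\<epsilon> = min (1 / K) (1 / (2 * D))"
  define \<delta> where "\<delta> = \<epsilon> - \<epsilon>\<^sup>2 * D"
  have D: "0 < D" using K by (simp add: D_def)
  have \<epsilon>: "0 < \<epsilon>" "\<epsilon> * K \<le> 1" "\<epsilon> * D \<le> 1 / 2"
    using K D by (auto simp: \<epsilon>_def min_def field_simps)
  have "\<epsilon>\<^sup>2 * D \<le> \<epsilon> * (1 / 2)"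
    using mult_left_mono[OF \<epsilon>(3), of \<epsilon>] \<epsilon>(1) by (simp add: power2_eq_square mult.assoc)
  then have \<delta>: "0 < \<delta>" using \<epsilon>(1) by (simp add: \<delta>_def)
  define g where "g = (\<lambda>k. ennreal (exp (\<delta> * real k)))"
  have g: "mono g" using \<delta> by (auto simp: g_def mono_def)
  \<comment> \<open>Cap and window grow together, so a single monotone limit recovers the full
    cluster, including the value infinity for infinite clusters.\<close>
  have exp_eq: "(\<integral>\<^sup>+\<omega>. exp_size \<delta> (cluster (\<xi> t v \<omega>) v) \<partial>P t) = (SUP k. cluster_mean k g (f t k) [v])" for v
  proof -
    have "(\<integral>\<^sup>+\<omega>. exp_size \<delta> (cluster (\<xi> t v \<omega>) v) \<partial>P t) = (\<integral>\<^sup>+\<omega>. (SUP k. g (min k (card (C t v k \<omega>)))) \<partial>P t)"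
    proof (rule nn_integral_cong)
      fix \<omega> assume \<omega>: "\<omega> \<in> space (P t)"
      show "exp_size \<delta> (cluster (\<xi> t v \<omega>) v) = (SUP k. g (min k (card (C t v k \<omega>))))"
        unfolding SUP_card_increasing[OF C_inc[OF t(1) \<omega>] C_fin[OF t(1) \<omega>] g] C_UN[OF t(1) \<omega>]
        by (simp add: exp_size_def g_def SUP_exp_eq_top[OF \<delta>])
    qed
    also have "\<dots> = (SUP k. \<integral>\<^sup>+\<omega>. g (min k (card (C t v k \<omega>))) \<partial>P t)"
    proof (rule nn_integral_monotone_convergence_SUP_AE)
      fix k
      show "AE \<omega> in P t. g (min k (card (C t v k \<omega>))) \<le> g (min (Suc k) (card (C t v (Suc k) \<omega>)))"
        by (intro AE_I2 monoD[OF g] min.mono card_mono C_fin[OF t(1)] incseqD[OF C_inc[OF t(1)]]) auto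
    qed (rule C_meas[OF t(1)])
    also have "\<dots> = (SUP k. cluster_mean k g (f t k) [v])" by (simp add: C_int[OF t(1)])
    finally show ?thesis .
  qed
  have "esssup \<Lambda> (\<lambda>v. SUP k. cluster_mean k g (f t k) [v]) \<le> ennreal (exp (\<epsilon> * K))"
  proof (rule esssup_I)
    have "(\<lambda>v. SUP k. cluster_mean k g (f t k) [v]) \<in> borel_measurable borel"
      by (intro borel_measurable_SUP borel_measurable_cluster_mean f_meas) auto
    then show "(\<lambda>v. SUP k. cluster_mean k g (f t k) [v]) \<in> borel_measurable \<Lambda>"
      using borel by (simp cong: measurable_cong_sets)
    show "AE v in \<Lambda>. (SUP k. cluster_mean k g (f t k) [v]) \<le> ennreal (exp (\<epsilon> * K))"
      using good
    proof eventually_elim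
      case (elim v)
      show ?case
      proof (rule SUP_least)
        fix k
        \<comment> \<open>The constant \<open>t / s\<close> acts as the thinning \<open>b\<close> of
          the fixed intensity \<open>f s k\<close>, for which the mean bound \<open>K\<close> is
          available.\<close>
        have ft: "f t k = (\<lambda>x. ennreal (t / s) * f s k x)"
          using s t(1) by (simp add: f_def mult.assoc[symmetric] flip: ennreal_mult)
        have ts: "ennreal (t / s) \<le> 1" using s t(1) by simp
        have "cluster_mean k g (\<lambda>x. ennreal (t / s) * f s k x) [v]
          \<le> ennreal (exp (\<epsilon> * enn2real (cluster_mean k of_nat (\<lambda>x. ennreal (t / s) * f s k x) [v])))"
          unfolding g_def
          by (rule exponential_cluster_mean_le[OF f_meas f_fin _ _ _ \<epsilon>(2) D_def \<delta>_def])
             (use good elim \<epsilon> K \<delta> ts in auto)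
        also have "\<dots> \<le> ennreal (exp (\<epsilon> * K))"
        proof -
          have "cluster_mean k of_nat (\<lambda>x. ennreal (t / s) * f s k x) [v] \<le> cluster_mean k of_nat (f s k) [v]"
            by (rule cluster_mean_thinning[OF f_meas _ f_fin]) (use ts in \<open>auto simp: mono_of_nat_ennreal\<close>)
          also have "\<dots> \<le> ennreal K" using elim by blast
          finally have "enn2real (cluster_mean k of_nat (\<lambda>x. ennreal (t / s) * f s k x) [v]) \<le> K"
            using K by (intro enn2real_leI) auto
          then show ?thesis using \<epsilon> by (intro ennreal_leI) simp
        qed
        finally show "cluster_mean k g (f t k) [v] \<le> ennreal (exp (\<epsilon> * K))" by (simp add: ft)
      qed
    qed
  qed
  then have "esssup \<Lambda> (\<lambda>v. \<integral>\<^sup>+\<omega>. exp_size \<delta> (cluster (\<xi> t v \<omega>) v) \<partial>P t) < \<infinity>"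
    unfolding exp_eq by (rule le_less_trans) simp
  then show "\<exists>\<delta>\<^sub>1>0. esssup \<Lambda> (\<lambda>v. \<integral>\<^sup>+\<omega>. exp_size \<delta>\<^sub>1 (cluster (\<xi> t v \<omega>) v) \<partial>P t) < \<infinity>"
    using \<delta> by blast
qed

end
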